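(* Let $\mathcal{L}\subset \mathbb{P}^{2}_{\mathbb{C}}$ be an arrangement of $d$ lines whose only intersection points are nodes (double points) and triple points, and suppose $\mathcal{L}$ is minimal plus-one generated. Then the weak-combinatorics of $\mathcal{L}$ is one of $$(d;n_{2},n_{3}) \in \{(6;9,2),(7;9,4),(8;7,7),(9;6,10)\}.$$ Moreover, each of these four weak-combinatorics is realized by a minimal plus-one generated arrangement of lines (with only double and triple points) defined over the real numbers.
   Context: Let $S=\mathbb{C}[x,y,z]$. For a reduced plane curve $C: f=0$ of degree $d$, the Milnor algebra is $M(f)=S/J_f$, where $J_f=\langle \partial_x f,\partial_y f,\partial_z f\rangle$ is the Jacobian ideal. $C$ is an $m$-syzygy curve if $M(f)$ has a minimal graded free resolution of the form $0 \to \bigoplus_{i=1}^{m-2}S(-e_i) \to \bigoplus_{i=1}^{m}S(1-d-d_i)\to S^3(1-d)\to S\to M(f)\to 0$ with $e_1\le\dots\le e_{m-2}$ and $1\le d_1\le\dots\le d_m$; $(d_1,\dots,d_m)$ are the exponents. $C$ is plus-one generated if it is a $3$-syzygy curve with exponents $(d_1,d_2,d_3)$ satisfying $d_1+d_2=d$; it is minimal plus-one generated if moreover $d_3-d_2=1$. For a line arrangement $\mathcal{L}$ of $d$ lines, $n_i$ denotes the number of points where exactly $i$ lines meet, and the weak-combinatorics is $(d;n_2,n_3)$ when only double and triple points occur. *)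

theory Defs
  imports Complex_Main "HOL-Library.Poly_Mapping" "HOL-Library.Product_Plus"
begin

text \<open>Monomials x^a y^b z^c are encoded by exponent triples (a,b,c);
  polynomials are finitely supported coefficient functions (Poly_Mapping),
  with the convolution product, so S is a commutative ring.\<close>

type_synonym mono3 = "nat \<times> nat \<times> nat"
type_synonym poly3 = "mono3 \<Rightarrow>\<^sub>0 complex"

definition mdeg :: "mono3 \<Rightarrow> nat" where
  "mdeg m = (case m of (a, b, c) \<Rightarrow> a + b + c)"

definition const3 :: "complex \<Rightarrow> poly3" where
  "const3 c = Poly_Mapping.single (0, 0, 0) c"

definition varX :: poly3 where "varX = Poly_Mapping.single (1, 0, 0) 1"
definition varY :: poly3 where "varY = Poly_Mapping.single (0, 1, 0) 1"
definition varZ :: poly3 where "varZ = Poly_Mapping.single (0, 0, 1) 1"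

text \<open>Homogeneous of degree k (the zero polynomial is homogeneous of every degree).\<close>
definition homogeneous :: "nat \<Rightarrow> poly3 \<Rightarrow> bool" where
  "homogeneous k p \<longleftrightarrow> (\<forall>m \<in> Poly_Mapping.keys p. mdeg m = k)"

definition dx :: "poly3 \<Rightarrow> poly3" where
  "dx p = (\<Sum>m \<in> Poly_Mapping.keys p. case m of (a, b, c) \<Rightarrow>
      Poly_Mapping.single (a - 1, b, c) (of_nat a * Poly_Mapping.lookup p m))"
definition dy :: "poly3 \<Rightarrow> poly3" where
  "dy p = (\<Sum>m \<in> Poly_Mapping.keys p. case m of (a, b, c) \<Rightarrow>
      Poly_Mapping.single (a, b - 1, c) (of_nat b * Poly_Mapping.lookup p m))"
definition dz :: "poly3 \<Rightarrow> poly3" where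
  "dz p = (\<Sum>m \<in> Poly_Mapping.keys p. case m of (a, b, c) \<Rightarrow>
      Poly_Mapping.single (a, b, c - 1) (of_nat c * Poly_Mapping.lookup p m))"

type_synonym vec3 = "poly3 \<times> poly3 \<times> poly3"

definition AR :: "poly3 \<Rightarrow> vec3 set" where
  "AR f = {(a, b, c). a * dx f + b * dy f + c * dz f = 0}"

definition vsmult :: "poly3 \<Rightarrow> vec3 \<Rightarrow> vec3" where
  "vsmult s v = (case v of (a, b, c) \<Rightarrow> (s * a, s * b, s * c))"

definition span3 :: "vec3 list \<Rightarrow> vec3 set" where
  "span3 gs = {(\<Sum>i < length gs. vsmult (cf i) (gs ! i)) | cf. True}"

definition homog_vec :: "nat \<Rightarrow> vec3 \<Rightarrow> bool" where
  "homog_vec k v = (case v of (a, b, c) \<Rightarrow> homogeneous k a \<and> homogeneous k b \<and> homogeneous k c)"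

text \<open>C: f = 0 is an m-syzygy curve with exponents ds = (d_1,...,d_m):
  the (graded) syzygy module AR(f) -- the kernel of S^3(1-d) -> S in the minimal
  resolution of M(f) -- is minimally generated by m homogeneous syzygies of
  degrees d_1 <= ... <= d_m, with d_1 >= 1.\<close>
definition syzygy_curve :: "nat \<Rightarrow> poly3 \<Rightarrow> nat list \<Rightarrow> bool" where
  "syzygy_curve m f ds \<longleftrightarrow>
     length ds = m \<and> sorted ds \<and> (\<forall>e \<in> set ds. 1 \<le> e) \<and>
     (\<exists>gs. length gs = m \<and> (\<forall>i < m. homog_vec (ds ! i) (gs ! i)) \<and>
           span3 gs = AR f \<and>
           (\<forall>hs. span3 hs = AR f \<longrightarrow> m \<le> length hs))"

definition plus_one_generated :: "nat \<Rightarrow> poly3 \<Rightarrow> bool" where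
  "plus_one_generated d f \<longleftrightarrow>
     (\<exists>d1 d2 d3. syzygy_curve 3 f [d1, d2, d3] \<and> d1 + d2 = d)"

definition minimal_plus_one_generated :: "nat \<Rightarrow> poly3 \<Rightarrow> bool" where
  "minimal_plus_one_generated d f \<longleftrightarrow>
     (\<exists>d1 d2 d3. syzygy_curve 3 f [d1, d2, d3] \<and> d1 + d2 = d \<and> d3 - d2 = 1)"

type_synonym pt3 = "complex \<times> complex \<times> complex"

definition scale3 :: "complex \<Rightarrow> pt3 \<Rightarrow> pt3" where
  "scale3 t p = (case p of (a, b, c) \<Rightarrow> (t * a, t * b, t * c))"

definition proportional :: "pt3 \<Rightarrow> pt3 \<Rightarrow> bool" where
  "proportional p q \<longleftrightarrow> (\<exists>t. t \<noteq> 0 \<and> q = scale3 t p)"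

definition P2 :: "pt3 set set" where
  "P2 = {{q. q \<noteq> (0, 0, 0) \<and> proportional p q} | p. p \<noteq> (0, 0, 0)}"

definition on_line :: "pt3 \<Rightarrow> pt3 \<Rightarrow> bool" where
  "on_line l p = (case l of (a, b, c) \<Rightarrow> case p of (x, y, z) \<Rightarrow> a * x + b * y + c * z = 0)"

definition lin_form :: "pt3 \<Rightarrow> poly3" where
  "lin_form l = (case l of (a, b, c) \<Rightarrow> const3 a * varX + const3 b * varY + const3 c * varZ)"

definition line_arrangement :: "pt3 list \<Rightarrow> bool" where
  "line_arrangement L \<longleftrightarrow>
     (\<forall>i < length L. L ! i \<noteq> (0, 0, 0)) \<and>
     (\<forall>i j. i < j \<and> j < length L \<longrightarrow> \<not> proportional (L ! i) (L ! j))"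

definition arr_poly :: "pt3 list \<Rightarrow> poly3" where
  "arr_poly L = prod_list (map lin_form L)"

definition point_mult :: "pt3 list \<Rightarrow> pt3 set \<Rightarrow> nat" where
  "point_mult L P = card {i. i < length L \<and> (\<forall>q \<in> P. on_line (L ! i) q)}"

definition n_pts :: "pt3 list \<Rightarrow> nat \<Rightarrow> nat" where
  "n_pts L k = card {P \<in> P2. point_mult L P = k}"

definition only_double_triple :: "pt3 list \<Rightarrow> bool" where
  "only_double_triple L \<longleftrightarrow> (\<forall>P \<in> P2. point_mult L P \<le> 3)"

definition real_arrangement :: "pt3 list \<Rightarrow> bool" where
  "real_arrangement L \<longleftrightarrow>
     (\<forall>l \<in> set L. case l of (a, b, c) \<Rightarrow> a \<in> \<real> \<and> b \<in> \<real> \<and> c \<in> \<real>)"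

end

theory Submission
  imports Defs "HOL-Computational_Algebra.Polynomial_Factorial" "HOL-Computational_Algebra.Field_as_Ring"
begin

text \<open>Deleting the lines one at a time and restricting the logarithmic vector fields to the deleted line
  gives the Hilbert function of the module of logarithmic fields in large degrees; only the number of lines
  and the number of triple points enter. On the other hand, three generators of degrees d1, d2, d2 + 1 with
  d1 + d2 = d have exactly one relation, whose coefficient at the last generator is the linear form h in
  Saito's determinant det(E, g1, g2) = h f. Comparing the two Hilbert functions gives
  2 n3 = d1^2 + d2^2 - d1 - 3 d2 - 2, and with 2 n2 + 6 n3 = d (d - 1) this leaves finitely many (d1, d2).
  The surplus cases are excluded by the parity of the number of nodes on a line and by a lower bound for the
  degree of a syzygy, obtained by restricting E x g to lines with many intersection points. For the four
  examples Saito's criterion shows that explicit fields generate.\<close>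

text \<open>\<open>syzygy_curve\<close> speaks of generators of AR(f), not of a resolution, so
  minimality can enter in one way only: no two elements span AR(f). This is used three times, for g1
  being nonzero, for the independence of g1 and g2, and for the fact that h does not divide both
  other coefficients of the relation; together they make the relation module free of rank one. The
  independence is where factoriality is needed: dependent syzygies must be multiples of a common
  one, hence the transfer to a type with gcds. New triple points on a deleted line are exactly the
  double points of the remaining arrangement on it, and each imposes one vanishing condition on the
  restricted field. That these are the only conditions is an interpolation argument, valid as soon
  as the degree is at least the number of lines. One such degree suffices for the comparison. The
  exponents are not pinned down: (2,4) and (3,5) pass all numerical tests, but give the same
  weak-combinatorics as (3,3) and (4,4). For the examples n2 and n3 are never counted; the first
  half of the theorem and the number of lines determine them.\<close>

section \<open>The polynomial ring: evaluation, and comparison with iterated univariate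
  polynomials\<close>

lemma poly3_induct [case_names zero single add]:
  fixes p :: poly3
  assumes "P 0" "\<And>m c. P (Poly_Mapping.single m c)" "\<And>p q. P p \<Longrightarrow> P q \<Longrightarrow> P (p + q)"
  shows "P p"
proof -
  have "P (\<Sum>m\<in>K. Poly_Mapping.single m (Poly_Mapping.lookup p m))" if "finite K" for K
    using that by (induction K) (auto intro: assms)
  moreover have "(\<Sum>m\<in>Poly_Mapping.keys p. Poly_Mapping.single m (Poly_Mapping.lookup p m)) = p"
    by (rule poly_mapping_eqI)
      (auto simp: lookup_sum lookup_single when_def sum.delta in_keys_iff)
  ultimately show ?thesis by (metis finite_keys)
qed

text \<open>The coefficient map \<open>\<kappa>\<close> is a parameter so that one construction
  covers values at points, substitution of polynomials, restriction to a parametrised line and the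
  map \<open>nested\<close>.\<close>

definition ev :: "(complex \<Rightarrow> 'a::comm_ring_1) \<Rightarrow> 'a \<Rightarrow> 'a \<Rightarrow> 'a \<Rightarrow> poly3 \<Rightarrow> 'a" where
  "ev \<kappa> x y z p = (\<Sum>m\<in>Poly_Mapping.keys p.
     case m of (a, b, c) \<Rightarrow> \<kappa> (Poly_Mapping.lookup p m) * x ^ a * y ^ b * z ^ c)"

definition coeff_hom :: "(complex \<Rightarrow> 'a::comm_ring_1) \<Rightarrow> bool" where
  "coeff_hom \<kappa> \<longleftrightarrow> (\<forall>a b. \<kappa> (a + b) = \<kappa> a + \<kappa> b) \<and> (\<forall>a b. \<kappa> (a * b) = \<kappa> a * \<kappa> b) \<and> \<kappa> 1 = 1"

context
  fixes \<kappa> :: "complex \<Rightarrow> 'a::comm_ring_1"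
  assumes hom: "coeff_hom \<kappa>"
begin

lemma \<kappa>_add: "\<kappa> (a + b) = \<kappa> a + \<kappa> b"
  and \<kappa>_mult: "\<kappa> (a * b) = \<kappa> a * \<kappa> b"
  and \<kappa>_1: "\<kappa> 1 = 1"
  using hom by (simp_all add: coeff_hom_def)

lemma \<kappa>_0: "\<kappa> 0 = 0"
  using \<kappa>_add[of 0 0] by simp

lemma ev_superset:
  assumes "finite K" "Poly_Mapping.keys p \<subseteq> K"
  shows "ev \<kappa> x y z p = (\<Sum>m\<in>K. case m of (a, b, c) \<Rightarrow> \<kappa> (Poly_Mapping.lookup p m) * x ^ a * y ^ b * z ^ c)"
  unfolding ev_def using assms
  by (intro sum.mono_neutral_left) (auto simp: in_keys_iff \<kappa>_0)

lemma ev_0 [simp]: "ev \<kappa> x y z 0 = 0"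
  by (simp add: ev_def \<kappa>_0)

lemma ev_single: "ev \<kappa> x y z (Poly_Mapping.single (a, b, c) k) = \<kappa> k * x ^ a * y ^ b * z ^ c"
  by (simp add: ev_def \<kappa>_0)

lemma ev_add [simp]: "ev \<kappa> x y z (p + q) = ev \<kappa> x y z p + ev \<kappa> x y z q"
proof -
  let ?K = "Poly_Mapping.keys p \<union> Poly_Mapping.keys q \<union> Poly_Mapping.keys (p + q)"
  show ?thesis
    by (simp add: ev_superset[of ?K] sum.distrib[symmetric] lookup_add \<kappa>_add ring_distribs
        case_prod_beta le_supI1)
qed

lemma ev_1 [simp]: "ev \<kappa> x y z 1 = 1"
  by (simp add: ev_def lookup_one zero_prod_def \<kappa>_1)

lemma ev_mult [simp]: "ev \<kappa> x y z (p * q) = ev \<kappa> x y z p * ev \<kappa> x y z q"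
proof (induction p rule: poly3_induct)
  case (single m c)
  show ?case
  proof (induction q rule: poly3_induct)
    case (single n d)
    show ?case
      by (cases m; cases n) (simp add: mult_single ev_single \<kappa>_mult power_add mult_ac)
  qed (auto simp: ring_distribs)
qed (auto simp: ring_distribs)

lemma ev_uminus [simp]: "ev \<kappa> x y z (- p) = - ev \<kappa> x y z p"
  using ev_add[of x y z p "- p"] by (simp add: add_eq_0_iff del: ev_add)

lemma ev_diff [simp]: "ev \<kappa> x y z (p - q) = ev \<kappa> x y z p - ev \<kappa> x y z q"
  using ev_add[of x y z p "- q"] by (simp del: ev_add)

lemma ev_sum: "ev \<kappa> x y z (sum f A) = (\<Sum>i\<in>A. ev \<kappa> x y z (f i))"
  by (induction A rule: infinite_finite_induct) auto

lemma ev_prod: "ev \<kappa> x y z (prod f A) = (\<Prod>i\<in>A. ev \<kappa> x y z (f i))"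
  by (induction A rule: infinite_finite_induct) auto

lemma ev_power [simp]: "ev \<kappa> x y z (p ^ n) = ev \<kappa> x y z p ^ n"
  by (induction n) auto

lemma ev_of_nat [simp]: "ev \<kappa> x y z (of_nat n) = of_nat n"
  by (induction n) auto

lemma ev_numeral [simp]: "ev \<kappa> x y z (numeral n) = numeral n"
  using ev_of_nat[of x y z "numeral n"] by simp

lemma ev_const3 [simp]: "ev \<kappa> x y z (const3 c) = \<kappa> c"
  by (simp add: const3_def ev_single)

lemma ev_varX [simp]: "ev \<kappa> x y z varX = x"
  and ev_varY [simp]: "ev \<kappa> x y z varY = y"
  and ev_varZ [simp]: "ev \<kappa> x y z varZ = z"
  by (simp_all add: varX_def varY_def varZ_def ev_single \<kappa>_1)

end

lemma const3_0 [simp]: "const3 0 = 0"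
  and const3_1 [simp]: "const3 1 = 1"
  and const3_add: "const3 (a + b) = const3 a + const3 b"
  and const3_mult: "const3 (a * b) = const3 a * const3 b"
  and const3_uminus: "const3 (- a) = - const3 a"
  and const3_diff: "const3 (a - b) = const3 a - const3 b"
  by (simp_all add: const3_def single_add mult_single single_diff single_uminus
      flip: zero_prod_def)

lemma const3_eq_0_iff [simp]: "const3 c = 0 \<longleftrightarrow> c = 0"
  by (metis const3_0 const3_def lookup_single_eq)

lemma const3_of_nat: "const3 (of_nat n) = of_nat n"
  by (induction n) (auto simp: const3_add)

lemma const3_numeral [simp]: "const3 (numeral n) = numeral n"
  using const3_of_nat[of "numeral n"] by simp

lemma monomial_eq:
  "Poly_Mapping.single (a, b, c) k = const3 k * varX ^ a * varY ^ b * varZ ^ c"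
proof -
  have "varX ^ n = Poly_Mapping.single (n, 0, 0) 1" "varY ^ n = Poly_Mapping.single (0, n, 0) 1"
    "varZ ^ n = Poly_Mapping.single (0, 0, n) 1" for n
    by (induction n; simp add: varX_def varY_def varZ_def mult_single flip: zero_prod_def)+
  then show ?thesis
    by (simp add: const3_def mult_single)
qed

lemma coeff_hom_instances [simp]:
  "coeff_hom (\<lambda>c::complex. c)" "coeff_hom const3" "coeff_hom (\<lambda>c. [:c:])"
  "coeff_hom (\<lambda>c. [:[:[:c:]:]:])"
  by (simp_all add: coeff_hom_def const3_add const3_mult pCons_one)

text \<open>The isomorphism onto iterated univariate polynomials, a type that the library knows to be
  a factorial domain.\<close>

definition nested :: "poly3 \<Rightarrow> complex poly poly poly" where
  "nested = ev (\<lambda>c. [:[:[:c:]:]:]) [:[:[:0, 1:]:]:] [:[:0, 1:]:] [:0, 1:]"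

lemma nested_hom [simp]:
  "nested (p + q) = nested p + nested q" "nested (p * q) = nested p * nested q"
  "nested (p - q) = nested p - nested q"
  "nested 0 = 0" "nested 1 = 1"
  by (simp_all only: nested_def ev_add ev_mult ev_diff ev_0 ev_1 coeff_hom_instances)

lemma nested_gen:
  "nested (const3 c) = [:[:[:c:]:]:]" "nested varX = [:[:[:0, 1:]:]:]"
  "nested varY = [:[:0, 1:]:]" "nested varZ = [:0, 1:]"
  by (simp_all only: nested_def ev_const3 ev_varX ev_varY ev_varZ coeff_hom_instances)

lemma coeff_nested:
  "poly.coeff (poly.coeff (poly.coeff (nested p) c) b) a = Poly_Mapping.lookup p (a, b, c)"
proof (induction p rule: poly3_induct)
  case (single m k)
  obtain a' b' c' where m: "m = (a', b', c')" by (cases m)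
  have 1: "([:[:[:0, 1:]:]:] :: complex poly poly poly) ^ n = [:[:Polynomial.monom 1 n:]:]" for n
    by (induction n) (simp_all add: monom_Suc monom_0 pCons_one)
  have 2: "([:[:0, 1:]:] :: complex poly poly poly) ^ n = [:Polynomial.monom 1 n:]" for n
    by (induction n) (simp_all add: monom_Suc monom_0 pCons_one)
  have 3: "([:0, 1:] :: complex poly poly poly) ^ n = Polynomial.monom 1 n" for n
    by (induction n) (simp_all add: monom_Suc monom_0 pCons_one)
  have "nested (Poly_Mapping.single m k) =
      [:[:[:k:]:]:] * [:[:Polynomial.monom 1 a':]:] * [:Polynomial.monom 1 b':] * Polynomial.monom 1 c'"
    by (simp only: nested_def m ev_single coeff_hom_instances 1 2 3)
  also have "\<dots> = Polynomial.monom (Polynomial.monom (Polynomial.monom k a') b') c'"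
    by (simp add: smult_monom)
  finally show ?case
    by (simp add: m lookup_single when_def)
qed (auto simp: lookup_add)

lemma nested_inj: "nested p = nested q \<longleftrightarrow> p = q"
proof
  assume "nested p = nested q"
  then have "Poly_Mapping.lookup p (a, b, c) = Poly_Mapping.lookup q (a, b, c)" for a b c
    by (metis coeff_nested)
  then show "p = q" by (intro poly_mapping_eqI) auto
qed auto

lemma nested_eq_0_iff: "nested p = 0 \<longleftrightarrow> p = 0"
  using nested_inj[of p 0] by simp

text \<open>Injectivity would transfer only the absence of zero divisors. Surjectivity is what pulls
  the factors produced by a gcd back to S.\<close>

lemma nested_surj: "\<exists>p. nested p = P"
proof -
  have 1: "\<exists>p. nested p = [:[:A:]:]" for A
  proof (induction A)
    case (pCons a A)
    then obtain p where "nested p = [:[:A:]:]" by blast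
    then have "nested (const3 a + varX * p) = [:[:pCons a A:]:]"
      by (simp add: nested_gen)
    then show ?case by blast
  qed (rule exI[of _ 0], simp)
  have 2: "\<exists>p. nested p = [:A:]" for A
  proof (induction A)
    case (pCons a A)
    then obtain p q where "nested p = [:A:]" "nested q = [:[:a:]:]" using 1 by blast
    then have "nested (q + varY * p) = [:pCons a A:]"
      by (simp add: nested_gen)
    then show ?case by blast
  qed (rule exI[of _ 0], simp)
  show ?thesis
  proof (induction P)
    case (pCons a A)
    then obtain p q where "nested p = A" "nested q = [:a:]" using 2 by blast
    then have "nested (q + varZ * p) = pCons a A"
      by (simp add: nested_gen)
    then show ?case by blast
  qed (rule exI[of _ 0], simp)
qed

lemma poly3_mult_eq_0 [simp]: "p * q = 0 \<longleftrightarrow> p = 0 \<or> q = 0" for p q :: poly3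
  using nested_eq_0_iff[of "p * q"] by (simp add: nested_eq_0_iff)

lemma poly3_cancel_left: "r \<noteq> 0 \<Longrightarrow> r * p = r * q \<longleftrightarrow> p = q" for p q r :: poly3
  using nested_inj[of "r * p" "r * q"] by (simp add: nested_eq_0_iff nested_inj)

lemma poly3_prod_eq_0: "finite A \<Longrightarrow> prod f A = 0 \<longleftrightarrow> (\<exists>a\<in>A. f a = 0)" for f :: "_ \<Rightarrow> poly3"
  by (induction A rule: finite_induct) auto

lemma poly3_power_eq_0: "p ^ n = 0 \<Longrightarrow> p = 0" for p :: poly3
  by (induction n) auto

text \<open>Natural numbers serve as test points because they exist in every iterated polynomial
  ring; the variables of \<open>nested p\<close> can then be removed one after the other by the same
  lemma.\<close>

lemma poly_all_0_imp_0:
  fixes P :: "'a::{idom,ring_char_0} poly"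
  assumes "\<And>x. poly P (of_nat x) = 0"
  shows "P = 0"
proof (rule ccontr)
  assume "P \<noteq> 0"
  then have "finite {x. poly P x = 0}" by (rule poly_roots_finite)
  then have "finite (range (of_nat :: nat \<Rightarrow> 'a))"
    by (rule rev_finite_subset) (auto simp: assms)
  then show False
    using finite_imageD[OF _ inj_of_nat] by auto
qed

lemma ev_nested:
  "ev (\<lambda>c. c) x y z p = poly (poly (poly (nested p) [:[:z:]:]) [:y:]) x"
proof (induction p rule: poly3_induct)
  case (single m k)
  obtain a b c where m: "m = (a, b, c)" by (cases m)
  have "nested (varX ^ n) = [:[:[:0, 1:]:]:] ^ n" "nested (varY ^ n) = [:[:0, 1:]:] ^ n"
    "nested (varZ ^ n) = [:0, 1:] ^ n" for n
    by (induction n) (simp_all add: nested_gen)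
  then show ?case
    by (simp add: m monomial_eq nested_gen)
qed simp_all

lemma poly3_eq_0I:
  assumes "\<And>x y z. ev (\<lambda>c. c) x y z p = 0"
  shows "p = 0"
proof -
  have "poly (poly (nested p) (of_nat i)) (of_nat j) = 0" for i j
    by (rule poly_all_0_imp_0)
      (use assms[of "of_nat _" "of_nat j" "of_nat i"] in \<open>simp add: ev_nested of_nat_poly\<close>)
  then have "poly (nested p) (of_nat i) = 0" for i
    by (intro poly_all_0_imp_0) auto
  then have "nested p = 0"
    by (intro poly_all_0_imp_0) auto
  then show ?thesis using nested_inj[of p 0] by simp
qed

text \<open>Points, lines and fields are triples that are mostly handled as wholes, so quantifiers
  over them stay unsplit.\<close>

declare split_paired_All [simp del] split_paired_Ex [simp del]

subsection \<open>Evaluation, derivatives and homogeneity\<close>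

definition evalp :: "poly3 \<Rightarrow> pt3 \<Rightarrow> complex" where
  "evalp p v = (case v of (x, y, z) \<Rightarrow> ev (\<lambda>c. c) x y z p)"

lemma evalp_simps [simp]:
  "evalp (p + q) v = evalp p v + evalp q v" "evalp (p - q) v = evalp p v - evalp q v" "evalp (- p) v = - evalp p v"
  "evalp (p * q) v = evalp p v * evalp q v" "evalp (p ^ n) v = evalp p v ^ n" "evalp 0 v = 0" "evalp 1 v = 1"
  "evalp (const3 c) v = c" "evalp (numeral k) v = numeral k"
  by (auto simp: evalp_def split: prod.split)

lemma evalp_var [simp]:
  "evalp varX v = fst v" "evalp varY v = fst (snd v)" "evalp varZ v = snd (snd v)"
  by (auto simp: evalp_def split: prod.split)

lemma evalp_sum: "evalp (sum f A) v = (\<Sum>i\<in>A. evalp (f i) v)"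
  by (auto simp: evalp_def ev_sum split: prod.split)

lemma evalp_eqI: "(\<And>v. evalp p v = evalp q v) \<Longrightarrow> p = q"
  using poly3_eq_0I[of "p - q"] by (force simp: evalp_def)

lemma d_superset:
  assumes "finite K" "Poly_Mapping.keys p \<subseteq> K"
  shows "dx p = (\<Sum>m\<in>K. case m of (a, b, c) \<Rightarrow>
      Poly_Mapping.single (a - 1, b, c) (of_nat a * Poly_Mapping.lookup p m))"
    and "dy p = (\<Sum>m\<in>K. case m of (a, b, c) \<Rightarrow>
      Poly_Mapping.single (a, b - 1, c) (of_nat b * Poly_Mapping.lookup p m))"
    and "dz p = (\<Sum>m\<in>K. case m of (a, b, c) \<Rightarrow>
      Poly_Mapping.single (a, b, c - 1) (of_nat c * Poly_Mapping.lookup p m))"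
  unfolding dx_def dy_def dz_def using assms
  by (intro sum.mono_neutral_left; force simp: in_keys_iff)+

lemma d_0 [simp]: "dx 0 = 0" "dy 0 = 0" "dz 0 = 0"
  by (simp_all add: dx_def dy_def dz_def)

lemma d_add [simp]: "dx (p + q) = dx p + dx q" "dy (p + q) = dy p + dy q" "dz (p + q) = dz p + dz q"
proof -
  let ?K = "Poly_Mapping.keys p \<union> Poly_Mapping.keys q \<union> Poly_Mapping.keys (p + q)"
  show "dx (p + q) = dx p + dx q" "dy (p + q) = dy p + dy q" "dz (p + q) = dz p + dz q"
    by (simp_all add: d_superset[of ?K] sum.distrib[symmetric] lookup_add ring_distribs
        case_prod_beta le_supI1 single_add)
qed

lemma d_single:
  "dx (Poly_Mapping.single (a, b, c) k) = Poly_Mapping.single (a - 1, b, c) (of_nat a * k)"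
  "dy (Poly_Mapping.single (a, b, c) k) = Poly_Mapping.single (a, b - 1, c) (of_nat b * k)"
  "dz (Poly_Mapping.single (a, b, c) k) = Poly_Mapping.single (a, b, c - 1) (of_nat c * k)"
  by (simp_all add: dx_def dy_def dz_def)

lemma d_mult:
  "dx (p * q) = dx p * q + p * dx q" "dy (p * q) = dy p * q + p * dy q"
  "dz (p * q) = dz p * q + p * dz q"
proof (induction p rule: poly3_induct)
  case (single m k)
  fix q
  show "dx (Poly_Mapping.single m k * q) = dx (Poly_Mapping.single m k) * q + Poly_Mapping.single m k * dx q"
    "dy (Poly_Mapping.single m k * q) = dy (Poly_Mapping.single m k) * q + Poly_Mapping.single m k * dy q"
    "dz (Poly_Mapping.single m k * q) = dz (Poly_Mapping.single m k) * q + Poly_Mapping.single m k * dz q"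
  proof (induction q rule: poly3_induct)
    case (single n l)
    obtain a b c a' b' c' where mn: "m = (a, b, c)" "n = (a', b', c')"
      by (cases m; cases n)
    show "dx (Poly_Mapping.single m k * Poly_Mapping.single n l) = dx (Poly_Mapping.single m k) *
      Poly_Mapping.single n l + Poly_Mapping.single m k * dx (Poly_Mapping.single n l)"
      unfolding mn by (cases a; cases a')
        (simp_all add: mult_single d_single single_add[symmetric] algebra_simps)
    show "dy (Poly_Mapping.single m k * Poly_Mapping.single n l) = dy (Poly_Mapping.single m k) *
      Poly_Mapping.single n l + Poly_Mapping.single m k * dy (Poly_Mapping.single n l)"
      unfolding mn by (cases b; cases b')
        (simp_all add: mult_single d_single single_add[symmetric] algebra_simps)
    show "dz (Poly_Mapping.single m k * Poly_Mapping.single n l) = dz (Poly_Mapping.single m k) *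
      Poly_Mapping.single n l + Poly_Mapping.single m k * dz (Poly_Mapping.single n l)"
      unfolding mn by (cases c; cases c')
        (simp_all add: mult_single d_single single_add[symmetric] algebra_simps)
  qed (simp_all add: algebra_simps)
qed (simp_all add: algebra_simps)

lemma d_one [simp]: "dx 1 = 0" "dy 1 = 0" "dz 1 = 0"
  using d_single[of 0 0 0 1] by (simp_all flip: zero_prod_def)

lemma hom_0 [simp]: "homogeneous k 0"
  by (simp add: homogeneous_def)

lemma hom_single: "homogeneous (mdeg m) (Poly_Mapping.single m c)"
  by (simp add: homogeneous_def)

lemma hom_add [intro]: "homogeneous k p \<Longrightarrow> homogeneous k q \<Longrightarrow> homogeneous k (p + q)"
  unfolding homogeneous_def using keys_add[of p q] by blast

lemma hom_uminus [intro]: "homogeneous k p \<Longrightarrow> homogeneous k (- p)"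
  by (auto simp: homogeneous_def in_keys_iff)

lemma hom_diff [intro]: "homogeneous k p \<Longrightarrow> homogeneous k q \<Longrightarrow> homogeneous k (p - q)"
  using hom_add[of k p "- q"] hom_uminus by auto

lemma hom_sum [intro]: "(\<And>i. i \<in> A \<Longrightarrow> homogeneous k (f i)) \<Longrightarrow> homogeneous k (sum f A)"
  by (induction A rule: infinite_finite_induct) auto

lemma mdeg_add: "mdeg (m + n) = mdeg m + mdeg n"
  by (cases m; cases n) (simp add: mdeg_def)

lemma hom_mult:
  assumes "homogeneous k p" "homogeneous l q"
  shows "homogeneous (k + l) (p * q)"
  unfolding homogeneous_def
proof
  fix m assume "m \<in> Poly_Mapping.keys (p * q)"
  then obtain a b where "m = a + b" "a \<in> Poly_Mapping.keys p" "b \<in> Poly_Mapping.keys q"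
    using keys_mult[of p q] by blast
  then show "mdeg m = k + l"
    using assms by (auto simp: homogeneous_def mdeg_add)
qed

lemma hom_mult': "homogeneous k p \<Longrightarrow> homogeneous l q \<Longrightarrow> n = k + l \<Longrightarrow> homogeneous n (p * q)"
  using hom_mult by simp

lemma hom_const: "homogeneous 0 (const3 c)"
  by (simp add: homogeneous_def const3_def mdeg_def)

lemma hom_const_mult: "homogeneous k p \<Longrightarrow> homogeneous k (const3 c * p)"
  using hom_mult[OF hom_const] by simp

lemma hom_one: "homogeneous 0 1"
  using hom_const[of 1] by simp

lemma hom_var [simp]: "homogeneous (Suc 0) varX" "homogeneous (Suc 0) varY" "homogeneous (Suc 0) varZ"
  by (simp_all add: homogeneous_def varX_def varY_def varZ_def mdeg_def)

lemma hom_power: "homogeneous k p \<Longrightarrow> homogeneous (n * k) (p ^ n)"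
  by (induction n) (auto intro: hom_one hom_mult)

lemma hom_prod: "finite A \<Longrightarrow> (\<And>i. i \<in> A \<Longrightarrow> homogeneous (Suc 0) (f i)) \<Longrightarrow> homogeneous (card A) (prod f A)"
  by (induction A rule: finite_induct) (auto intro!: hom_one hom_mult')

lemma evalp_hom:
  assumes "homogeneous k p"
  shows "evalp p (scale3 t v) = t ^ k * evalp p v"
proof (cases v)
  case (fields x y z)
  have "ev (\<lambda>c. c) (t * x) (t * y) (t * z) p = t ^ k * ev (\<lambda>c. c) x y z p"
    unfolding ev_def sum_distrib_left
  proof (rule sum.cong, simp)
    fix m assume "m \<in> Poly_Mapping.keys p"
    then have m: "mdeg m = k" using assms by (simp add: homogeneous_def)
    obtain a b c where abc: "m = (a, b, c)" by (cases m)
    then have k: "k = a + b + c" using m by (simp add: mdeg_def)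
    show "(case m of (a, b, c) \<Rightarrow> Poly_Mapping.lookup p m * (t * x) ^ a * (t * y) ^ b * (t * z) ^ c) =
      t ^ k * (case m of (a, b, c) \<Rightarrow> Poly_Mapping.lookup p m * x ^ a * y ^ b * z ^ c)"
      by (simp add: abc k power_add power_mult_distrib mult_ac)
  qed
  then show ?thesis by (simp add: fields evalp_def scale3_def)
qed

text \<open>The homogeneous component of degree k. Quotients coming from divisibility and
  coefficients coming from \<open>span3\<close> are arbitrary polynomials; components make them
  homogeneous.\<close>

definition hcomp :: "nat \<Rightarrow> poly3 \<Rightarrow> poly3" where
  "hcomp k p = (\<Sum>m\<in>{m \<in> Poly_Mapping.keys p. mdeg m = k}. Poly_Mapping.single m (Poly_Mapping.lookup p m))"

lemma lookup_hcomp: "Poly_Mapping.lookup (hcomp k p) m = (if mdeg m = k then Poly_Mapping.lookup p m else 0)"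
  unfolding hcomp_def by (auto simp: lookup_sum lookup_single when_def sum.delta in_keys_iff)

lemma hcomp_add [simp]: "hcomp k (p + q) = hcomp k p + hcomp k q"
  and hcomp_diff [simp]: "hcomp k (p - q) = hcomp k p - hcomp k q"
  and hcomp_0 [simp]: "hcomp k 0 = 0"
  by (rule poly_mapping_eqI; simp add: lookup_hcomp lookup_add lookup_minus)+

lemma hom_hcomp: "homogeneous k (hcomp k p)"
  by (auto simp: homogeneous_def in_keys_iff lookup_hcomp split: if_splits)

lemma hcomp_hom: "homogeneous j p \<Longrightarrow> hcomp k p = (if j = k then p else 0)"
  by (rule poly_mapping_eqI) (auto simp: lookup_hcomp homogeneous_def in_keys_iff)

lemma hcomp_mult:
  assumes "homogeneous d f"
  shows "hcomp (k + d) (p * f) = hcomp k p * f"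
proof (induction p rule: poly3_induct)
  case (single m c)
  show ?case
    using hcomp_hom[OF hom_mult[OF hom_single[of m c] assms], of "k + d"] hcomp_hom[OF hom_single, of k m c]
    by auto
qed (auto simp: ring_distribs)

lemma hcomp_eq_0I: "(\<And>k. hcomp k p = 0) \<Longrightarrow> p = 0"
  by (rule poly_mapping_eqI) (metis lookup_hcomp lookup_zero)

text \<open>Multiplication by a homogeneous f only shifts components, so every component of h in a
  degree other than n is annihilated by the nonzero f.\<close>

lemma hom_cancel:
  assumes "homogeneous (n + d) (h * f)" "homogeneous d f" "f \<noteq> 0"
  shows "homogeneous n h"
proof -
  have "hcomp k (h - hcomp n h) = 0" for k
    using hcomp_mult[OF assms(2), of k h] hcomp_hom[OF assms(1), of "k + d"] hcomp_hom[OF hom_hcomp[of n h], of k]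
      assms(3) by (cases "k = n") auto
  then have "h - hcomp n h = 0" by (rule hcomp_eq_0I)
  then have "hcomp n h = h" by (metis right_minus_eq)
  then show ?thesis using hom_hcomp[of n h] by (rule subst)
qed

lemma hom_cancel_0:
  assumes "homogeneous n (h * f)" "homogeneous d f" "f \<noteq> 0" "n < d"
  shows "h = 0"
proof (rule hcomp_eq_0I)
  fix k
  show "hcomp k h = 0"
    using hcomp_mult[OF assms(2), of k h] hcomp_hom[OF assms(1), of "k + d"] assms(3,4) by auto
qed

subsection \<open>Linear forms\<close>

definition dot :: "pt3 \<Rightarrow> pt3 \<Rightarrow> complex" where
  "dot l v = (case l of (a, b, c) \<Rightarrow> case v of (x, y, z) \<Rightarrow> a * x + b * y + c * z)"

text \<open>Points and lines share the type \<open>pt3\<close>. For two distinct lines this is their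
  intersection point in homogeneous coordinates.\<close>

definition cross :: "pt3 \<Rightarrow> pt3 \<Rightarrow> pt3" where
  "cross l m = (case l of (a, b, c) \<Rightarrow> case m of (d, e, f) \<Rightarrow> (b * f - c * e, c * d - a * f, a * e - b * d))"

lemma on_line_dot: "on_line l v \<longleftrightarrow> dot l v = 0"
  by (auto simp: on_line_def dot_def split: prod.splits)

lemma dot_simps:
  "dot (a, b, c) (x, y, z) = a * x + b * y + c * z"
  "dot l (scale3 t v) = t * dot l v" "dot (scale3 t l) v = t * dot l v"
  "dot l (v + w) = dot l v + dot l w" "dot (l + m) v = dot l v + dot m v"
  "dot l (v - w) = dot l v - dot l w" "dot (l - m) v = dot l v - dot m v"
  by (auto simp: dot_def scale3_def algebra_simps split: prod.splits)

lemma dot_cross: "dot l (cross l m) = 0" "dot m (cross l m) = 0" "dot l (cross m n) = dot m (cross n l)"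
  by (cases l; cases m; cases n; simp add: dot_def cross_def algebra_simps)+

lemma scale3_simps [simp]:
  "scale3 t (x, y, z) = (t * x, t * y, t * z)" "scale3 1 v = v" "scale3 s (scale3 t v) = scale3 (s * t) v"
  "scale3 0 v = (0, 0, 0)"
  by (auto simp: scale3_def split: prod.splits)

lemma scale3_eq_0_iff: "scale3 t v = (0, 0, 0) \<longleftrightarrow> t = 0 \<or> v = (0, 0, 0)"
  by (auto simp: scale3_def split: prod.splits)

lemma cross_anti: "cross m l = scale3 (- 1) (cross l m)"
  by (cases l; cases m) (simp add: cross_def)

lemma cross_scale3: "cross l (scale3 t l) = (0, 0, 0)"
  by (cases l) (simp add: cross_def)

lemma parallel_if_cross_0:
  assumes "cross x w = (0, 0, 0)" "w \<noteq> (0, 0, 0)"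
  shows "\<exists>t. x = scale3 t w"
proof -
  obtain a b c d e f where xw: "x = (a, b, c)" "w = (d, e, f)" by (cases x; cases w)
  have eqs: "b * f = c * e" "c * d = a * f" "a * e = b * d"
    using assms(1) by (auto simp: xw cross_def)
  consider "d \<noteq> 0" | "e \<noteq> 0" | "f \<noteq> 0" using assms(2) xw by auto
  then show ?thesis
  proof cases
    case 1
    then show ?thesis using eqs by (intro exI[of _ "a / d"]) (auto simp: xw field_simps)
  next
    case 2
    then show ?thesis using eqs by (intro exI[of _ "b / e"]) (auto simp: xw field_simps)
  next
    case 3
    then show ?thesis using eqs by (intro exI[of _ "c / f"]) (auto simp: xw field_simps)
  qed
qed

lemma proportional_iff_cross:
  assumes "l \<noteq> (0, 0, 0)" "m \<noteq> (0, 0, 0)"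
  shows "proportional l m \<longleftrightarrow> cross l m = (0, 0, 0)"
proof
  assume "proportional l m"
  then show "cross l m = (0, 0, 0)"
    by (cases l) (auto simp: proportional_def cross_def)
next
  assume "cross l m = (0, 0, 0)"
  then have "cross m l = (0, 0, 0)" using cross_anti[of m l] by simp
  then obtain t where "m = scale3 t l" using parallel_if_cross_0 assms(1) by blast
  then show "proportional l m"
    using assms(2) by (auto simp: proportional_def scale3_eq_0_iff)
qed

lemma proportional_sym: "proportional l m \<Longrightarrow> proportional m l"
proof -
  assume "proportional l m"
  then obtain t where "t \<noteq> 0" "m = scale3 t l" by (auto simp: proportional_def)
  then show "proportional m l"
    unfolding proportional_def by (intro exI[of _ "1 / t"]) auto
qed

text \<open>The double cross product x * (l * m) is a combination of l and m with coefficients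
  \<open>dot m x\<close> and \<open>dot l x\<close>, both zero.\<close>

lemma meet_parallel:
  assumes "dot l x = 0" "dot m x = 0" "cross l m \<noteq> (0, 0, 0)"
  shows "\<exists>t. x = scale3 t (cross l m)"
proof -
  obtain a b c d e f x1 x2 x3 where lm: "l = (a, b, c)" "m = (d, e, f)" "x = (x1, x2, x3)"
    by (cases l; cases m; cases x)
  have 1: "a * x1 + b * x2 + c * x3 = 0" "d * x1 + e * x2 + f * x3 = 0"
    using assms(1,2) by (auto simp: lm dot_def)
  have "cross x (cross l m) = (0, 0, 0)"
    using 1 unfolding lm cross_def by simp algebra
  then show ?thesis using parallel_if_cross_0 assms(3) by blast
qed

lemma evalp_lin_form [simp]: "evalp (lin_form l) v = dot l v"
  by (cases l; cases v) (simp add: lin_form_def dot_def)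

lemma hom_lin_form: "homogeneous (Suc 0) (lin_form l)"
  by (cases l) (auto simp: lin_form_def intro!: hom_const_mult hom_add)

lemma dot_nondeg:
  assumes "l \<noteq> (0, 0, 0)"
  shows "\<exists>v. dot l v = 1"
proof -
  obtain a b c where l: "l = (a, b, c)" by (cases l)
  then consider "a \<noteq> 0" | "b \<noteq> 0" | "c \<noteq> 0" using assms by auto
  then show ?thesis
  proof cases
    case 1 then show ?thesis by (intro exI[of _ "(1 / a, 0, 0)"]) (simp add: l dot_def)
  next
    case 2 then show ?thesis by (intro exI[of _ "(0, 1 / b, 0)"]) (simp add: l dot_def)
  next
    case 3 then show ?thesis by (intro exI[of _ "(0, 0, 1 / c)"]) (simp add: l dot_def)
  qed
qed

lemma lin_form_nz: "l \<noteq> (0, 0, 0) \<Longrightarrow> lin_form l \<noteq> 0"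
  by (metis dot_nondeg evalp_lin_form evalp_simps(6) zero_neq_one)

text \<open>The vectors u, v, w form a basis adapted to the line l = 0, with dual basis a, b, l.\<close>

definition frame :: "pt3 \<Rightarrow> pt3 \<Rightarrow> pt3 \<Rightarrow> pt3 \<Rightarrow> pt3 \<Rightarrow> pt3 \<Rightarrow> bool" where
  "frame l u v w a b \<longleftrightarrow> dot l u = 0 \<and> dot l v = 0 \<and> dot l w = 1 \<and>
     dot a u = 1 \<and> dot a v = 0 \<and> dot a w = 0 \<and> dot b u = 0 \<and> dot b v = 1 \<and> dot b w = 0 \<and>
     (\<forall>x. x = scale3 (dot a x) u + scale3 (dot b x) v + scale3 (dot l x) w)"

lemma frame_exists:
  assumes "l \<noteq> (0, 0, 0)"
  shows "\<exists>u v w a b. frame l u v w a b"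
proof -
  obtain p q r where l: "l = (p, q, r)" by (cases l)
  then consider "p \<noteq> 0" | "q \<noteq> 0" | "r \<noteq> 0" using assms by auto
  then show ?thesis
  proof cases
    case 1
    have "frame l (- q / p, 1, 0) (- r / p, 0, 1) (1 / p, 0, 0) (0, 1, 0) (0, 0, 1)"
      using 1 by (auto simp: frame_def l dot_def plus_prod_def field_simps)
    then show ?thesis by blast
  next
    case 2
    have "frame l (1, - p / q, 0) (0, - r / q, 1) (0, 1 / q, 0) (1, 0, 0) (0, 0, 1)"
      using 2 by (auto simp: frame_def l dot_def plus_prod_def field_simps)
    then show ?thesis by blast
  next
    case 3
    have "frame l (1, 0, - p / r) (0, 1, - q / r) (0, 0, 1 / r) (1, 0, 0) (0, 1, 0)"
      using 3 by (auto simp: frame_def l dot_def plus_prod_def field_simps)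
    then show ?thesis by blast
  qed
qed

lemma frame_shear:
  assumes "frame l u v w a b"
  shows "frame l u (v + scale3 t u) w (a - scale3 t b) b"
proof -
  have "x = scale3 (dot a x - t * dot b x) u + scale3 (dot b x) (v + scale3 t u) + scale3 (dot l x) w" for x
  proof -
    have "scale3 (dot a x - t * dot b x) u + scale3 (dot b x) (v + scale3 t u) =
      scale3 (dot a x) u + scale3 (dot b x) v"
      by (cases u; cases v) (simp add: algebra_simps)
    then show ?thesis using assms unfolding frame_def by metis
  qed
  then show ?thesis
    using assms by (simp add: frame_def dot_simps)
qed

text \<open>Shearing makes the point at infinity of the chart s -> u + s v of the line l avoid the finitely
  many other lines. Hence restricting to the chart loses no intersection point.\<close>

lemma frame_generic:
  assumes "l \<noteq> (0, 0, 0)" "finite A" "\<And>m. m \<in> A \<Longrightarrow> m \<noteq> (0, 0, 0) \<and> \<not> proportional l m"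
  shows "\<exists>u v w a b. frame l u v w a b \<and> (\<forall>m\<in>A. dot m v \<noteq> 0)"
proof -
  obtain u v w a b where fr: "frame l u v w a b" using frame_exists[OF assms(1)] by blast
  have "finite {t. dot m (v + scale3 t u) = 0}" if m: "m \<in> A" for m
  proof (cases "dot m u = 0")
    case True
    \<comment> \<open>Otherwise m vanishes at u and v, which span the line l, and would be
      proportional to l.\<close>
    have "dot m v \<noteq> 0"
    proof
      assume "dot m v = 0"
      then have *: "dot m x = dot l x * dot m w" for x
        using fr True unfolding frame_def by (metis dot_simps(2,4) mult_zero_right add.left_neutral)
      have "m = scale3 (dot m w) l"
        using *[of "(1,0,0)"] *[of "(0,1,0)"] *[of "(0,0,1)"]
        by (cases l; cases m) (simp add: dot_simps(1) mult.commute)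
      then have "cross l m = (0, 0, 0)"
        using cross_scale3 by metis
      then show False using assms(3)[OF m] proportional_iff_cross assms(1) by blast
    qed
    then show ?thesis using True by (simp add: dot_simps)
  next
    case False
    have "{t. dot m (v + scale3 t u) = 0} \<subseteq> {- dot m v / dot m u}"
      using False by (auto simp: dot_simps field_simps add_eq_0_iff)
    then show ?thesis using finite_subset by blast
  qed
  then have "finite (\<Union>m\<in>A. {t. dot m (v + scale3 t u) = 0})"
    using assms(2) by blast
  then obtain t where "t \<notin> (\<Union>m\<in>A. {t. dot m (v + scale3 t u) = 0})"
    using ex_new_if_finite infinite_UNIV_char_0 by blast
  then show ?thesis using frame_shear[OF fr, of t] by blast
qed

text \<open>Composition with the projection x -> a(x) u + b(x) v onto the plane l = 0 of the frame.
  It is a ring homomorphism into a domain and will turn out to have the multiples of the linear form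
  l as its kernel.\<close>

definition res :: "pt3 \<Rightarrow> pt3 \<Rightarrow> pt3 \<Rightarrow> pt3 \<Rightarrow> poly3 \<Rightarrow> poly3" where
  "res u v a b p = (case u of (u1, u2, u3) \<Rightarrow> case v of (v1, v2, v3) \<Rightarrow>
     ev const3 (const3 u1 * lin_form a + const3 v1 * lin_form b)
       (const3 u2 * lin_form a + const3 v2 * lin_form b)
       (const3 u3 * lin_form a + const3 v3 * lin_form b) p)"

lemma res_simps [simp]:
  "res u v a b (p * q) = res u v a b p * res u v a b q"
  "res u v a b (p - q) = res u v a b p - res u v a b q"
  "res u v a b 0 = 0"
  by (auto simp: res_def split: prod.splits)

lemma evalp_ev: "evalp (ev const3 p q r f) v = evalp f (evalp p v, evalp q v, evalp r v)"
proof (induction f rule: poly3_induct)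
  case (single m k)
  then show ?case by (cases m) (simp add: ev_single monomial_eq)
qed auto

lemma evalp_res: "evalp (res u v a b p) x = evalp p (scale3 (dot a x) u + scale3 (dot b x) v)"
  by (cases u; cases v) (simp add: res_def evalp_ev mult.commute)

lemma dvd_ev_diff:
  assumes "d dvd varX - P" "d dvd varY - Q" "d dvd varZ - R"
  shows "d dvd p - ev const3 P Q R p"
proof -
  have mult: "d dvd x * y - x' * y'" if "d dvd x - x'" "d dvd y - y'" for x y x' y' :: poly3
  proof -
    have "x * y - x' * y' = (x - x') * y + x' * (y - y')" by (simp add: algebra_simps)
    then show ?thesis using that by (metis dvd_add dvd_mult dvd_mult2)
  qed
  have pow: "d dvd x ^ n - x' ^ n" if "d dvd x - x'" for x x' :: poly3 and n
    by (induction n) (auto intro: mult that)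
  show ?thesis
  proof (induction p rule: poly3_induct)
    case (single m k)
    show ?case by (cases m) (auto simp: ev_single monomial_eq intro!: mult pow assms)
  next
    case (add p q)
    have "p + q - ev const3 P Q R (p + q) = (p - ev const3 P Q R p) + (q - ev const3 P Q R q)"
      by simp
    then show ?case using add dvd_add by metis
  qed auto
qed

text \<open>A vector and its projection differ by \<open>dot l x\<close> times w, so every variable
  is congruent to its substitute modulo l.\<close>

lemma dvd_res_diff:
  assumes "frame l u v w a b"
  shows "lin_form l dvd p - res u v a b p"
proof -
  obtain u1 u2 u3 v1 v2 v3 w1 w2 w3 where uvw: "u = (u1, u2, u3)" "v = (v1, v2, v3)" "w = (w1, w2, w3)"
    by (cases u; cases v; cases w)
  have *: "x = scale3 (dot a x) u + scale3 (dot b x) v + scale3 (dot l x) w" for x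
    using assms unfolding frame_def by blast
  have "varX - (const3 u1 * lin_form a + const3 v1 * lin_form b) = lin_form l * const3 w1"
    by (rule evalp_eqI, subst evalp_simps(2), subst evalp_var(1), subst *) (simp add: uvw)
  moreover have "varY - (const3 u2 * lin_form a + const3 v2 * lin_form b) = lin_form l * const3 w2"
    by (rule evalp_eqI, subst evalp_simps(2), subst evalp_var(2), subst *) (simp add: uvw)
  moreover have "varZ - (const3 u3 * lin_form a + const3 v3 * lin_form b) = lin_form l * const3 w3"
    by (rule evalp_eqI, subst evalp_simps(2), subst evalp_var(3), subst *) (simp add: uvw)
  ultimately show ?thesis
    using dvd_ev_diff[of "lin_form l"] by (simp add: res_def uvw)
qed

text \<open>The Nullstellensatz for a plane: a polynomial vanishing there has zero
  \<open>res\<close>, and it is congruent to its \<open>res\<close> modulo l.\<close>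

lemma lin_form_dvd_iff:
  assumes "l \<noteq> (0, 0, 0)"
  shows "lin_form l dvd p \<longleftrightarrow> (\<forall>v. dot l v = 0 \<longrightarrow> evalp p v = 0)"
proof
  assume "lin_form l dvd p"
  then show "\<forall>v. dot l v = 0 \<longrightarrow> evalp p v = 0" by (auto elim!: dvdE)
next
  assume R: "\<forall>v. dot l v = 0 \<longrightarrow> evalp p v = 0"
  obtain u v w a b where fr: "frame l u v w a b" using frame_exists[OF assms] by blast
  have "res u v a b p = 0"
    using fr R by (intro evalp_eqI) (simp add: evalp_res dot_simps frame_def)
  then show "lin_form l dvd p" using dvd_res_diff[OF fr, of p] by simp
qed

lemma lin_form_prime:
  assumes "l \<noteq> (0, 0, 0)" "lin_form l dvd p * q"
  shows "lin_form l dvd p \<or> lin_form l dvd q"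
proof -
  obtain u v w a b where fr: "frame l u v w a b" using frame_exists[OF assms(1)] by blast
  have "res u v a b (p * q) = 0"
    using fr assms by (intro evalp_eqI) (simp add: evalp_res dot_simps frame_def lin_form_dvd_iff)
  then have "res u v a b p = 0 \<or> res u v a b q = 0" by simp
  then show ?thesis using dvd_res_diff[OF fr, of p] dvd_res_diff[OF fr, of q] by auto
qed

text \<open>The vectors \<open>cross l x\<close> all lie in the plane l = 0, so m annihilates them;
  cyclic symmetry of the triple product moves this to \<open>cross l m\<close>.\<close>

lemma lin_form_dvd_lin_form:
  assumes "l \<noteq> (0, 0, 0)" "m \<noteq> (0, 0, 0)" "lin_form l dvd lin_form m"
  shows "proportional l m"
proof -
  have "\<forall>v. dot l v = 0 \<longrightarrow> dot m v = 0"
    using assms(3) lin_form_dvd_iff[OF assms(1)] by simp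
  then have "dot m (cross l x) = 0" for x
    by (simp add: dot_cross(1))
  then have *: "dot x (cross l m) = 0" for x
    using dot_cross(3)[of x l m] dot_cross(3)[of m l x] dot_cross(3)[of l m x] cross_anti[of x l]
      dot_simps(2)[of m "-1" "cross l x"] by simp
  have "cross l m = (0, 0, 0)"
    using *[of "(1,0,0)"] *[of "(0,1,0)"] *[of "(0,0,1)"] by (cases "cross l m") (simp add: dot_simps(1))
  then show ?thesis using proportional_iff_cross assms by blast
qed

subsection \<open>Dimensions\<close>

text \<open>A relation that exhibits a finite basis: it contains finite dimension and the subspace
  property at once and never sees the default value of a dimension function. The scaling is a
  parameter because several spaces occur side by side.\<close>

definition fdim :: "('c::field \<Rightarrow> 'b::ab_group_add \<Rightarrow> 'b) \<Rightarrow> 'b set \<Rightarrow> nat \<Rightarrow> bool" where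
  "fdim s V n \<longleftrightarrow> (\<exists>B. finite B \<and> card B = n \<and> \<not> module.dependent s B \<and> module.span s B = V)"

lemma fdim_unique:
  assumes "vector_space s" "fdim s V m" "fdim s V n"
  shows "m = n"
proof -
  interpret vector_space s by fact
  show ?thesis using assms(2,3) unfolding fdim_def by (metis dim_eq_card)
qed

lemma fdim_subspace:
  assumes "vector_space s" "fdim s V n"
  shows "module.subspace s V"
proof -
  interpret vector_space s by fact
  show ?thesis using assms(2) unfolding fdim_def by auto
qed

lemma fdim_0:
  assumes "vector_space s"
  shows "fdim s {0} 0"
proof -
  interpret vector_space s by fact
  show ?thesis unfolding fdim_def by (rule exI[of _ "{}"]) (simp add: independent_empty)
qed

text \<open>A basis B0 of the kernel is extended to a basis B of V; the images of the added vectors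
  C form a basis of the image.\<close>

lemma rank_nullity:
  fixes s1 :: "'c::field \<Rightarrow> 'b::ab_group_add \<Rightarrow> 'b" and s2 :: "'c \<Rightarrow> 'd::ab_group_add \<Rightarrow> 'd"
  assumes lin: "Vector_Spaces.linear s1 s2 f" and V: "fdim s1 V n"
  shows "\<exists>m r. fdim s1 {x \<in> V. f x = 0} m \<and> fdim s2 (f ` V) r \<and> n = m + r"
proof -
  interpret Vector_Spaces.linear s1 s2 f by (rule lin)
  have scaleV: "vs1.subspace V" using fdim_subspace[OF vs1.vector_space_axioms V] .
  let ?K = "{x \<in> V. f x = 0}"
  have sK: "vs1.subspace ?K"
    using scaleV by (auto simp: vs1.subspace_def add scale zero)
  obtain B0 where B0: "B0 \<subseteq> ?K" "vs1.independent B0" "?K \<subseteq> vs1.span B0"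
    using vs1.maximal_independent_subset by blast
  have spB0: "vs1.span B0 = ?K" using B0(1,3) sK by (rule vs1.span_subspace)
  obtain B where B: "B0 \<subseteq> B" "B \<subseteq> V" "vs1.independent B" "V \<subseteq> vs1.span B"
    using vs1.maximal_independent_subset_extend[of B0 V] B0(1,2) by blast
  have spB: "vs1.span B = V" using B(2,4) scaleV by (rule vs1.span_subspace)
  obtain B' where B': "finite B'" "card B' = n" "vs1.span B' = V" "vs1.independent B'"
    using V unfolding fdim_def by blast
  have finB: "finite B"
    using vs1.independent_span_bound[OF B'(1) B(3)] B(2) B'(3) by blast
  have cardB: "card B = n"
    using fdim_unique[OF vs1.vector_space_axioms _ V] finB B(3) spB unfolding fdim_def by blast
  define C where "C = B - B0"
  have finC: "finite C" "finite B0" using finB B(1) finite_subset by (auto simp: C_def)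
  have zero_if: "x = 0" if x: "x \<in> vs1.span C" "f x = 0" for x
  proof -
    have "x \<in> V" using x(1) spB vs1.span_mono[of C B] by (auto simp: C_def)
    then have "x \<in> vs1.span B0" using spB0 x(2) by blast
    then obtain u w where u: "x = (\<Sum>v\<in>C. s1 (u v) v)" and w: "x = (\<Sum>v\<in>B0. s1 (w v) v)"
      using x(1) finC unfolding vs1.span_finite[OF finC(1)] vs1.span_finite[OF finC(2)] by blast
    let ?g = "\<lambda>v. if v \<in> B0 then - w v else u v"
    have "(\<Sum>v\<in>B. s1 (?g v) v) = (\<Sum>v\<in>B0. s1 (?g v) v) + (\<Sum>v\<in>C. s1 (?g v) v)"
      using finB B(1) by (simp add: C_def sum.subset_diff add.commute)
    also have "(\<Sum>v\<in>B0. s1 (?g v) v) = - x"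
      by (simp add: w vs1.scale_minus_left sum_negf)
    also have "(\<Sum>v\<in>C. s1 (?g v) v) = x"
      unfolding u by (rule sum.cong) (auto simp: C_def)
    finally have "(\<Sum>v\<in>B. s1 (?g v) v) = 0" by simp
    then have "?g v = 0" if "v \<in> B" for v
      using vs1.independentD[OF B(3) finB order_refl, where u = ?g] that by blast
    then have "u v = 0" if "v \<in> C" for v using that by (force simp: C_def)
    then show "x = 0" unfolding u by simp
  qed
  have inj: "inj_on f (vs1.span C)"
    unfolding inj_on_iff_eq_0[OF vs1.subspace_span] using zero_if by blast
  have indC: "vs1.independent C" using vs1.independent_mono[OF B(3)] by (auto simp: C_def)
  have "vs2.independent (f ` C)"
    using independent_injective_image[OF indC inj] .
  moreover have "card (f ` C) = card C"
    using inj_on_subset[OF inj vs1.span_superset] by (rule card_image)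
  moreover have "vs2.span (f ` C) = f ` V"
  proof
    show "vs2.span (f ` C) \<subseteq> f ` V"
      unfolding span_image using spB vs1.span_mono[of C B] by (auto simp: C_def)
    have "f ` V = vs2.span (f ` B)" using spB span_image by simp
    also have "\<dots> \<subseteq> vs2.span (f ` C)"
    proof (rule vs2.span_minimal)
      show "f ` B \<subseteq> vs2.span (f ` C)"
      proof
        fix y assume "y \<in> f ` B"
        then obtain x where x: "x \<in> B" "y = f x" by blast
        show "y \<in> vs2.span (f ` C)"
        proof (cases "x \<in> B0")
          case True
          then have "y = 0" using B0(1) x(2) by blast
          then show ?thesis by (simp add: vs2.span_zero)
        next
          case False
          then show ?thesis using x by (intro vs2.span_base) (auto simp: C_def)
        qed
      qed
    qed simp
    finally show "f ` V \<subseteq> vs2.span (f ` C)" .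
  qed
  ultimately have "fdim s2 (f ` V) (card C)"
    using finC unfolding fdim_def by blast
  moreover have "fdim s1 ?K (card B0)"
    using finC(2) B0(2) spB0 unfolding fdim_def by blast
  moreover have "n = card B0 + card C"
    using cardB finB B(1) by (metis C_def card_Diff_subset card_mono finC(2) le_add_diff_inverse)
  ultimately show ?thesis by blast
qed

lemma fdim_inj_image:
  assumes lin: "Vector_Spaces.linear s1 s2 f" and V: "fdim s1 V n"
    and inj: "\<And>x. x \<in> V \<Longrightarrow> f x = 0 \<Longrightarrow> x = 0"
  shows "fdim s2 (f ` V) n"
proof -
  interpret Vector_Spaces.linear s1 s2 f by (rule lin)
  obtain m r where mr: "fdim s1 {x \<in> V. f x = 0} m" "fdim s2 (f ` V) r" "n = m + r"
    using rank_nullity[OF lin V] by blast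
  have "0 \<in> V" using fdim_subspace[OF vs1.vector_space_axioms V] vs1.subspace_0 by blast
  then have "{x \<in> V. f x = 0} = {0}" using inj by (auto simp: zero)
  then have "m = 0" using fdim_unique[OF vs1.vector_space_axioms mr(1)] fdim_0[OF vs1.vector_space_axioms] by simp
  then show ?thesis using mr by simp
qed

section \<open>Dimensions of products, of spaces of forms and of univariate polynomials\<close>

definition sprod :: "('c \<Rightarrow> 'a \<Rightarrow> 'a) \<Rightarrow> ('c \<Rightarrow> 'b \<Rightarrow> 'b) \<Rightarrow> 'c \<Rightarrow> 'a \<times> 'b \<Rightarrow> 'a \<times> 'b" where
  "sprod s t c v = (s c (fst v), t c (snd v))"

lemma vector_space_sprod: "vector_space s \<Longrightarrow> vector_space t \<Longrightarrow> vector_space (sprod s t)"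
  unfolding vector_space_def sprod_def by (auto simp: plus_prod_def)

lemma fdim_Times:
  fixes s :: "'c::field \<Rightarrow> 'a::ab_group_add \<Rightarrow> 'a" and t :: "'c \<Rightarrow> 'b::ab_group_add \<Rightarrow> 'b"
  assumes st: "vector_space s" "vector_space t" and A: "fdim s A m" and B: "fdim t B n"
  shows "fdim (sprod s t) (A \<times> B) (m + n)"
proof -
  interpret s: vector_space s by (rule st(1))
  interpret t: vector_space t by (rule st(2))
  interpret st: vector_space "sprod s t" using st by (rule vector_space_sprod)
  obtain BA where BA: "finite BA" "card BA = m" "s.independent BA" "s.span BA = A"
    using A unfolding fdim_def by blast
  obtain BB where BB: "finite BB" "card BB = n" "t.independent BB" "t.span BB = B"
    using B unfolding fdim_def by blast
  let ?B = "(\<lambda>x. (x, 0)) ` BA \<union> (\<lambda>y. (0, y)) ` BB"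
  have zA: "0 \<notin> BA" and zB: "0 \<notin> BB"
    using BA(3) BB(3) s.dependent_zero t.dependent_zero by blast+
  have disj: "(\<lambda>x. (x, 0)) ` BA \<inter> (\<lambda>y. (0, y)) ` BB = {}"
    using zA by auto
  have inj: "inj_on (\<lambda>x. (x, 0::'b)) BA" "inj_on (\<lambda>y. (0::'a, y)) BB" by (auto simp: inj_on_def)
  have card: "card ?B = m + n"
    using BA BB disj card_image[OF inj(1)] card_image[OF inj(2)] by (simp add: card_Un_disjoint)
  have sums: "(\<Sum>v\<in>?B. sprod s t (u v) v) = ((\<Sum>x\<in>BA. s (u (x, 0)) x), (\<Sum>y\<in>BB. t (u (0, y)) y))" for u
  proof -
    have "(\<Sum>v\<in>?B. sprod s t (u v) v) =
        (\<Sum>x\<in>BA. sprod s t (u (x, 0)) (x, 0)) + (\<Sum>y\<in>BB. sprod s t (u (0, y)) (0, y))"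
      using BA BB disj inj by (simp add: sum.union_disjoint sum.reindex)
    then show ?thesis
      by (simp add: sprod_def prod_eq_iff fst_sum snd_sum)
  qed
  have ind: "st.independent ?B"
  proof (rule st.independent_if_scalars_zero)
    fix u v assume *: "(\<Sum>v\<in>?B. sprod s t (u v) v) = 0" "v \<in> ?B"
    then have "(\<Sum>x\<in>BA. s (u (x, 0)) x) = 0" "(\<Sum>y\<in>BB. t (u (0, y)) y) = 0"
      unfolding sums by (simp_all add: zero_prod_def)
    then show "u v = 0"
      using s.independentD[OF BA(3,1) order_refl, where u = "\<lambda>x. u (x, 0)"]
        t.independentD[OF BB(3,1) order_refl, where u = "\<lambda>y. u (0, y)"] *(2)
      by blast
  qed (use BA BB in auto)
  have span: "st.span ?B = A \<times> B"
  proof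
    show "st.span ?B \<subseteq> A \<times> B"
    proof (rule st.span_minimal)
      show "?B \<subseteq> A \<times> B"
        using BA(4) BB(4) s.span_superset[of BA] t.span_superset[of BB] s.span_zero[of BA] t.span_zero[of BB]
        by auto
      show "st.subspace (A \<times> B)"
        using fdim_subspace[OF st(1) A] fdim_subspace[OF st(2) B]
        by (auto simp: st.subspace_def s.subspace_def t.subspace_def sprod_def zero_prod_def plus_prod_def)
    qed
    show "A \<times> B \<subseteq> st.span ?B"
    proof clarify
      fix a b assume ab: "a \<in> A" "b \<in> B"
      have "a \<in> range (\<lambda>u. \<Sum>v\<in>BA. s (u v) v)" "b \<in> range (\<lambda>u. \<Sum>v\<in>BB. t (u v) v)"
        using ab unfolding BA(4)[symmetric] BB(4)[symmetric] s.span_finite[OF BA(1)] t.span_finite[OF BB(1)] .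
      then obtain u w where uw: "a = (\<Sum>v\<in>BA. s (u v) v)" "b = (\<Sum>v\<in>BB. t (w v) v)"
        by (elim rangeE)
      \<comment> \<open>A zero second entry marks the vectors coming from BA; this is unambiguous
        because 0 is not in BB.\<close>
      let ?g = "\<lambda>v. if snd v = 0 \<and> fst v \<in> BA then u (fst v) else w (snd v)"
      have "(\<Sum>y\<in>BB. t (?g (0, y)) y) = (\<Sum>y\<in>BB. t (w y) y)" "(\<Sum>x\<in>BA. s (?g (x, 0)) x) = (\<Sum>x\<in>BA. s (u x) x)"
        using zB zA by (auto intro!: sum.cong)
      then have "(a, b) = (\<Sum>v\<in>?B. sprod s t (?g v) v)"
        unfolding sums uw by simp
      moreover have "(\<Sum>v\<in>?B. sprod s t (?g v) v) \<in> st.span ?B"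
        by (intro st.span_sum st.span_scale st.span_base)
      ultimately show "(a, b) \<in> st.span ?B" by (rule ssubst)
    qed
  qed
  show ?thesis unfolding fdim_def
    by (rule exI[of _ ?B]) (use card ind span BA BB in auto)
qed

definition scaleP :: "complex \<Rightarrow> poly3 \<Rightarrow> poly3" where "scaleP c p = const3 c * p"
definition scaleV :: "complex \<Rightarrow> vec3 \<Rightarrow> vec3" where "scaleV = sprod scaleP (sprod scaleP scaleP)"

lemma vector_space_scaleP: "vector_space scaleP"
  by unfold_locales (simp_all add: scaleP_def const3_add const3_mult algebra_simps)

lemma vector_space_scaleV: "vector_space scaleV"
  unfolding scaleV_def by (intro vector_space_sprod vector_space_scaleP)

lemma scaleV_simp: "scaleV c (p, q, r) = (const3 c * p, const3 c * q, const3 c * r)"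
  by (simp add: scaleV_def sprod_def scaleP_def)

lemma vector_space_smult: "vector_space (smult :: complex \<Rightarrow> complex poly \<Rightarrow> complex poly)"
  by unfold_locales (simp_all add: smult_add_right smult_add_left)

definition forms :: "nat \<Rightarrow> poly3 set" where "forms k = {p. homogeneous k p}"

text \<open>A monomial of degree k + 1 is either x times one of degree k, or free of x, and then one
  of k + 2. The count is doubled to stay clear of division.\<close>

lemma card_monomials: "finite {m. mdeg m = k} \<and> 2 * card {m. mdeg m = k} = (k + 1) * (k + 2)"
proof (induction k)
  case 0
  have "{m. mdeg m = 0} = {(0, 0, 0)}" by (auto simp: mdeg_def)
  then show ?case by simp
next
  case (Suc k)
  let ?A = "(\<lambda>(a, b, c). (Suc a, b, c)) ` {m. mdeg m = k}"
  let ?B = "(\<lambda>b. (0::nat, b, Suc k - b)) ` {..Suc k}"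
  have "{m. mdeg m = Suc k} = ?A \<union> ?B"
  proof (rule set_eqI)
    fix m :: mono3
    obtain a b c where m: "m = (a, b, c)" by (cases m)
    show "m \<in> {m. mdeg m = Suc k} \<longleftrightarrow> m \<in> ?A \<union> ?B"
      by (cases a) (auto simp: m mdeg_def image_iff Bex_def split_paired_Ex)
  qed
  moreover have "card ?A = card {m. mdeg m = k}" by (rule card_image) (auto simp: inj_on_def)
  moreover have "card ?B = k + 2" by (subst card_image) (auto simp: inj_on_def)
  moreover have "?A \<inter> ?B = {}" by auto
  ultimately show ?case using Suc by (simp add: card_Un_disjoint algebra_simps)
qed

lemma fdim_forms: "fdim scaleP (forms k) ((k + 1) * (k + 2) div 2)"
proof -
  interpret vector_space scaleP by (rule vector_space_scaleP)
  let ?M = "{m. mdeg m = k}"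
  let ?e = "\<lambda>m::mono3. Poly_Mapping.single m (1::complex)"
  have fin: "finite ?M" using card_monomials by blast
  have inj: "inj_on ?e ?M"
    by (rule inj_onI) (metis lookup_single_eq lookup_single_not_eq zero_neq_one)
  have sc: "scaleP c (?e m) = Poly_Mapping.single m c" for c m
    by (cases m) (simp add: scaleP_def const3_def mult_single)
  have lk: "Poly_Mapping.lookup (\<Sum>v\<in>?e ` ?M. scaleP (u v) v) m = (if mdeg m = k then u (?e m) else 0)" for u m
    using fin by (simp add: sum.reindex[OF inj] sc lookup_sum lookup_single when_def sum.delta)
  have ind: "independent (?e ` ?M)"
  proof (rule independent_if_scalars_zero)
    fix u v assume "(\<Sum>v\<in>?e ` ?M. scaleP (u v) v) = 0" "v \<in> ?e ` ?M"
    then show "u v = 0" using lk[of u] by (metis (mono_tags, lifting) imageE lookup_zero mem_Collect_eq)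
  qed (use fin in simp)
  have "span (?e ` ?M) = forms k"
  proof (rule span_subspace)
    show "?e ` ?M \<subseteq> forms k" using hom_single by (auto simp: forms_def)
    show "subspace (forms k)"
      by (auto simp: subspace_def forms_def scaleP_def intro: hom_const_mult hom_add)
    show "forms k \<subseteq> span (?e ` ?M)"
    proof
      fix p assume p: "p \<in> forms k"
      \<comment> \<open>On a basis monomial v the set of keys is a singleton, whose element is the
        exponent at which the coefficient of p is read.\<close>
      define u where "u v = Poly_Mapping.lookup p (the_elem (Poly_Mapping.keys v))" for v :: poly3
      have "p = (\<Sum>v\<in>?e ` ?M. scaleP (u v) v)"
      proof (rule poly_mapping_eqI)
        fix m
        show "Poly_Mapping.lookup p m = Poly_Mapping.lookup (\<Sum>v\<in>?e ` ?M. scaleP (u v) v) m"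
          using p unfolding lk by (auto simp: u_def forms_def homogeneous_def in_keys_iff)
      qed
      moreover have "(\<Sum>v\<in>?e ` ?M. scaleP (u v) v) \<in> span (?e ` ?M)"
        by (intro span_sum span_scale span_base)
      ultimately show "p \<in> span (?e ` ?M)" by (rule ssubst)
    qed
  qed
  moreover have "card (?e ` ?M) = (k + 1) * (k + 2) div 2"
    using card_monomials[of k] card_image[OF inj] by (metis nonzero_mult_div_cancel_left zero_neq_numeral)
  ultimately show ?thesis using ind fin unfolding fdim_def by blast
qed

lemma fdim_poly: "fdim (smult :: complex \<Rightarrow> complex poly \<Rightarrow> complex poly) {F. degree F \<le> k} (k + 1)"
proof -
  interpret vector_space "smult :: complex \<Rightarrow> complex poly \<Rightarrow> complex poly" by (rule vector_space_smult)
  let ?e = "\<lambda>i. Polynomial.monom (1::complex) i"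
  have inj: "inj_on ?e {..k}" by (rule inj_onI) (metis degree_monom_eq zero_neq_one)
  have eq: "(\<Sum>v\<in>?e ` {..k}. smult (u v) v) = (\<Sum>i\<le>k. Polynomial.monom (u (?e i)) i)" for u
    by (simp add: sum.reindex[OF inj] smult_monom)
  have lk: "poly.coeff (\<Sum>v\<in>?e ` {..k}. smult (u v) v) i = (if i \<le> k then u (?e i) else 0)" for u i
    unfolding eq by (auto simp: coeff_sum)
  have ind: "independent (?e ` {..k})"
  proof (rule independent_if_scalars_zero)
    fix u v assume *: "(\<Sum>v\<in>?e ` {..k}. smult (u v) v) = 0" "v \<in> ?e ` {..k}"
    then obtain i where i: "i \<le> k" "v = ?e i" by auto
    have "poly.coeff (\<Sum>v\<in>?e ` {..k}. smult (u v) v) i = 0" using *(1) by (simp only: coeff_0)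
    then show "u v = 0" unfolding lk using i by simp
  qed simp
  have "span (?e ` {..k}) = {F. degree F \<le> k}"
  proof (rule span_subspace)
    show "?e ` {..k} \<subseteq> {F. degree F \<le> k}" by (auto simp: degree_monom_eq)
    show "subspace {F::complex poly. degree F \<le> k}"
      by (auto simp: subspace_def intro: degree_add_le order.trans[OF degree_smult_le])
    show "{F. degree F \<le> k} \<subseteq> span (?e ` {..k})"
    proof clarify
      fix F :: "complex poly" assume F: "degree F \<le> k"
      have "F = (\<Sum>v\<in>?e ` {..k}. smult (poly.coeff F (degree v)) v)"
        by (rule poly_eqI) (use F in \<open>auto simp: lk degree_monom_eq coeff_eq_0\<close>)
      moreover have "(\<Sum>v\<in>?e ` {..k}. smult (poly.coeff F (degree v)) v) \<in> span (?e ` {..k})"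
        by (intro span_sum span_scale span_base)
      ultimately show "F \<in> span (?e ` {..k})" by (rule ssubst)
    qed
  qed
  then show ?thesis unfolding fdim_def
    by (intro exI[of _ "?e ` {..k}"]) (auto simp: ind card_image[OF inj])
qed

definition vforms :: "nat \<Rightarrow> vec3 set" where "vforms k = {v. homog_vec k v}"

lemma fdim_forms3:
  "fdim scaleV (forms i \<times> forms j \<times> forms k)
    ((i + 1) * (i + 2) div 2 + ((j + 1) * (j + 2) div 2 + (k + 1) * (k + 2) div 2))"
  unfolding scaleV_def
  by (intro fdim_Times vector_space_sprod vector_space_scaleP fdim_forms)

lemma vforms_eq: "vforms k = forms k \<times> forms k \<times> forms k"
  by (auto simp: vforms_def forms_def homog_vec_def)

subsection \<open>Logarithmic vector fields\<close>

text \<open>Sets replace the lists of the statement so that lines can be deleted and inserted in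
  inductions.\<close>

definition arrangement :: "pt3 set \<Rightarrow> bool" where
  "arrangement A \<longleftrightarrow> finite A \<and> (0, 0, 0) \<notin> A \<and> (\<forall>l\<in>A. \<forall>m\<in>A. l \<noteq> m \<longrightarrow> \<not> proportional l m)"

definition defpoly :: "pt3 set \<Rightarrow> poly3" where "defpoly A = prod lin_form A"

text \<open>The derivation \<theta> applied to the linear form l, as \<open>app_lin_form\<close>
  confirms.\<close>

definition tang :: "vec3 \<Rightarrow> pt3 \<Rightarrow> poly3" where
  "tang \<theta> l = (case \<theta> of (p, q, r) \<Rightarrow> case l of (a, b, c) \<Rightarrow> const3 a * p + const3 b * q + const3 c * r)"

definition app :: "vec3 \<Rightarrow> poly3 \<Rightarrow> poly3" where
  "app \<theta> f = (case \<theta> of (p, q, r) \<Rightarrow> p * dx f + q * dy f + r * dz f)"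

text \<open>The module D(A) of logarithmic fields, described line by line instead of by the
  condition that f divides \<theta>(f); this form is inherited by subarrangements.\<close>

definition logder :: "pt3 set \<Rightarrow> vec3 set" where
  "logder A = {\<theta>. \<forall>l\<in>A. lin_form l dvd tang \<theta> l}"

definition eul :: vec3 where "eul = (varX, varY, varZ)"

lemma arrangement_subset: "arrangement A \<Longrightarrow> B \<subseteq> A \<Longrightarrow> arrangement B"
  unfolding arrangement_def using finite_subset by blast

lemma arrD: "arrangement A \<Longrightarrow> l \<in> A \<Longrightarrow> m \<in> A \<Longrightarrow> l \<noteq> m \<Longrightarrow> \<not> proportional l m"
  by (simp add: arrangement_def)

lemma arrangement_insertD:
  assumes "arrangement (insert l A)" "l \<notin> A"
  shows "finite A" "arrangement A" "l \<noteq> (0, 0, 0)" "\<And>m. m \<in> A \<Longrightarrow> m \<noteq> (0, 0, 0) \<and> \<not> proportional l m"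
  using assms arrangement_subset[OF assms(1), of A] unfolding arrangement_def by auto

lemma AR_app: "AR f = {\<theta>. app \<theta> f = 0}"
  by (auto simp: AR_def app_def)

lemma vsmult_simp [simp]: "vsmult s (p, q, r) = (s * p, s * q, s * r)"
  by (simp add: vsmult_def)

lemma tang_simps [simp]:
  "tang (\<theta> + \<eta>) l = tang \<theta> l + tang \<eta> l" "tang (\<theta> - \<eta>) l = tang \<theta> l - tang \<eta> l"
  "tang (vsmult s \<theta>) l = s * tang \<theta> l" "tang 0 l = 0" "tang eul l = lin_form l"
  by (auto simp: tang_def eul_def lin_form_def algebra_simps zero_prod_def split: prod.splits)

lemma app_simps [simp]:
  "app (\<theta> + \<eta>) l = app \<theta> l + app \<eta> l" "app (\<theta> - \<eta>) l = app \<theta> l - app \<eta> l"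
  "app (vsmult s \<theta>) l = s * app \<theta> l" "app 0 l = 0"
  by (auto simp: app_def algebra_simps zero_prod_def split: prod.splits)

lemma tang_sum: "tang (sum f I) l = (\<Sum>i\<in>I. tang (f i) l)"
  by (induction I rule: infinite_finite_induct) auto

lemma app_mult: "app \<theta> (p * q) = app \<theta> p * q + p * app \<theta> q"
  by (cases \<theta>) (simp add: app_def d_mult algebra_simps)

lemma d_const [simp]: "dx (const3 c) = 0" "dy (const3 c) = 0" "dz (const3 c) = 0"
  by (simp_all add: const3_def d_single)

lemma d_var [simp]:
  "dx varX = 1" "dx varY = 0" "dx varZ = 0" "dy varX = 0" "dy varY = 1" "dy varZ = 0"
  "dz varX = 0" "dz varY = 0" "dz varZ = 1"
proof -
  have *: "Poly_Mapping.single (0, 0, 0) (1::complex) = 1" by (simp flip: zero_prod_def)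
  show "dx varX = 1" "dx varY = 0" "dx varZ = 0" "dy varX = 0" "dy varY = 1" "dy varZ = 0"
    "dz varX = 0" "dz varY = 0" "dz varZ = 1"
    by (simp_all add: varX_def varY_def varZ_def d_single *)
qed

lemma app_lin_form [simp]: "app \<theta> (lin_form l) = tang \<theta> l"
  by (cases \<theta>; cases l) (simp add: app_def tang_def lin_form_def d_mult algebra_simps)

lemma defpoly_insert: "finite A \<Longrightarrow> l \<notin> A \<Longrightarrow> defpoly (insert l A) = lin_form l * defpoly A"
  by (simp add: defpoly_def)

lemma defpoly_remove: "finite A \<Longrightarrow> l \<in> A \<Longrightarrow> defpoly A = lin_form l * defpoly (A - {l})"
  by (simp add: defpoly_def prod.remove)

lemma defpoly_empty [simp]: "defpoly {} = 1"
  by (simp add: defpoly_def)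

lemma hom_defpoly: "finite A \<Longrightarrow> homogeneous (card A) (defpoly A)"
  unfolding defpoly_def by (intro hom_prod hom_lin_form)

lemma defpoly_nz: "arrangement A \<Longrightarrow> defpoly A \<noteq> 0"
  unfolding defpoly_def arrangement_def using lin_form_nz poly3_prod_eq_0 by metis

text \<open>The logarithmic derivative: \<theta>(f) / f is the sum of the quotients \<theta>(l) /
  l.\<close>

lemma app_defpoly:
  assumes "finite A" "\<And>l. l \<in> A \<Longrightarrow> tang \<theta> l = k l * lin_form l"
  shows "app \<theta> (defpoly A) = (\<Sum>l\<in>A. k l) * defpoly A"
  using assms
proof (induction A rule: finite_induct)
  case empty
  then show ?case by (cases \<theta>) (simp add: app_def)
next
  case (insert l A)
  then show ?case by (simp add: defpoly_insert app_mult algebra_simps)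
qed

lemma app_eul: "finite A \<Longrightarrow> app eul (defpoly A) = of_nat (card A) * defpoly A"
  using app_defpoly[of A eul "\<lambda>_. 1"] by simp

lemma lin_form_dvd_defpoly:
  assumes "finite A" "l \<noteq> (0, 0, 0)" "(0, 0, 0) \<notin> A" "lin_form l dvd defpoly A"
  shows "\<exists>m\<in>A. proportional l m"
  using assms(1,3,4)
proof (induction A rule: finite_induct)
  case empty
  then have "lin_form l dvd 1" by simp
  then have "\<forall>v. dot l v = 0 \<longrightarrow> evalp 1 v = 0" using lin_form_dvd_iff assms(2) by blast
  then show ?case using dot_simps(2)[of l 0 "(0,0,0)"] by (metis mult_zero_left evalp_simps(7) zero_neq_one)
next
  case (insert m A)
  then show ?case
    using lin_form_prime[OF assms(2), of "lin_form m" "defpoly A"] lin_form_dvd_lin_form[OF assms(2), of m]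
    by (auto simp: defpoly_insert)
qed

text \<open>The linear forms are primes, pairwise not associated, so their product divides whatever
  each of them divides.\<close>

lemma defpoly_dvd:
  assumes "arrangement A" "\<And>l. l \<in> A \<Longrightarrow> lin_form l dvd p"
  shows "defpoly A dvd p"
proof -
  have "finite A" using assms(1) by (simp add: arrangement_def)
  then show ?thesis using assms
  proof (induction A rule: finite_induct)
    case (insert l A)
    note D = arrangement_insertD[OF insert.prems(1) insert.hyps(2)]
    have "defpoly A dvd p" using insert.IH[OF D(2)] insert.prems(2) by blast
    then obtain q where q: "p = defpoly A * q" by blast
    have "\<not> lin_form l dvd defpoly A"
      using lin_form_dvd_defpoly[OF D(1) D(3)] D(2,4) unfolding arrangement_def by blast
    then have "lin_form l dvd q"
      using insert.prems(2)[of l] q lin_form_prime[OF D(3)] by blast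
    then show ?case using q by (auto simp: defpoly_insert[OF D(1) insert.hyps(2)] mult_ac intro: mult_dvd_mono)
  qed simp
qed

text \<open>With f = l f' the Leibniz rule gives \<theta>(l) f' = - l \<theta>(f'), and the prime l
  does not divide f'.\<close>

lemma AR_subset_logder:
  assumes "arrangement A"
  shows "AR (defpoly A) \<subseteq> logder A"
  unfolding logder_def
proof clarify
  fix \<theta> l assume \<theta>: "\<theta> \<in> AR (defpoly A)" and l: "l \<in> A"
  have fin: "finite A" and l0: "l \<noteq> (0, 0, 0)" using assms l by (auto simp: arrangement_def)
  have "tang \<theta> l * defpoly (A - {l}) + lin_form l * app \<theta> (defpoly (A - {l})) = 0"
    using \<theta> l fin by (simp add: AR_app defpoly_remove[of A l] app_mult)
  then have "tang \<theta> l * defpoly (A - {l}) = lin_form l * - app \<theta> (defpoly (A - {l}))"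
    by (simp add: add_eq_0_iff)
  then have "lin_form l dvd tang \<theta> l * defpoly (A - {l})"
    by (metis dvd_triv_left)
  moreover have "\<not> lin_form l dvd defpoly (A - {l})"
  proof
    assume "lin_form l dvd defpoly (A - {l})"
    then obtain m where "m \<in> A - {l}" "proportional l m"
      using lin_form_dvd_defpoly[of "A - {l}" l] fin l0 assms unfolding arrangement_def by blast
    then show False using arrD[OF assms l, of m] by (metis DiffE singletonI)
  qed
  ultimately show "lin_form l dvd tang \<theta> l" using lin_form_prime[OF l0] by blast
qed

lemma hom_tang: "homog_vec k \<theta> \<Longrightarrow> homogeneous k (tang \<theta> l)"
  by (cases \<theta>; cases l) (auto simp: tang_def homog_vec_def intro!: hom_add hom_const_mult)

subsection \<open>Restriction to a line\<close>

definition restr :: "pt3 \<Rightarrow> pt3 \<Rightarrow> poly3 \<Rightarrow> complex poly" where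
  "restr u v = (case u of (u1, u2, u3) \<Rightarrow> case v of (v1, v2, v3) \<Rightarrow>
     ev (\<lambda>c. [:c:]) [:u1, v1:] [:u2, v2:] [:u3, v3:])"

lemma restr_simps [simp]:
  "restr u v (p + q) = restr u v p + restr u v q" "restr u v (p * q) = restr u v p * restr u v q"
  "restr u v 0 = 0" "restr u v 1 = 1" "restr u v (const3 c * p) = smult c (restr u v p)"
  by (auto simp: restr_def split: prod.splits)

lemma restr_prod: "restr u v (prod f I) = (\<Prod>i\<in>I. restr u v (f i))"
  by (auto simp: restr_def ev_prod split: prod.splits)

lemma restr_sum: "restr u v (sum f I) = (\<Sum>i\<in>I. restr u v (f i))"
  by (auto simp: restr_def ev_sum split: prod.splits)

lemma poly_restr: "poly (restr u v p) s = evalp p (u + scale3 s v)"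
proof (induction p rule: poly3_induct)
  case (single m k)
  show ?case
    by (cases m; cases u; cases v)
      (simp add: restr_def ev_single monomial_eq poly_power plus_prod_def)
qed auto

lemma restr_lin_form: "restr u v (lin_form l) = [:dot l u, dot l v:]"
  by (cases l; cases u; cases v) (simp add: restr_def lin_form_def dot_def)

lemma restr_degree:
  assumes "homogeneous k p"
  shows "degree (restr u v p) \<le> k"
proof -
  obtain u1 u2 u3 v1 v2 v3 where uv: "u = (u1, u2, u3)" "v = (v1, v2, v3)" by (cases u; cases v)
  have lin: "degree ([:x, y:] ^ n) \<le> n" for x y :: complex and n
    by (rule order.trans[OF degree_power_le]) (cases "y = 0"; simp)
  show ?thesis
    unfolding uv restr_def prod.case ev_def
  proof (rule degree_sum_le)
    fix m assume m: "m \<in> Poly_Mapping.keys p"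
    obtain a b c where abc: "m = (a, b, c)" by (cases m)
    then have k: "k = a + b + c" using m assms by (auto simp: homogeneous_def mdeg_def)
    have "degree ([:x:] * X * Y * Z) \<le> a + b + c"
      if "degree X \<le> a" "degree Y \<le> b" "degree Z \<le> c" for X Y Z and x :: complex
    proof -
      have "degree ([:x:] * X) \<le> a" using that by (simp add: order.trans[OF degree_smult_le])
      then have "degree ([:x:] * X * Y) \<le> a + b" using degree_mult_le[of "[:x:] * X" Y] that by linarith
      then show ?thesis using degree_mult_le[of "[:x:] * X * Y" Z] that by linarith
    qed
    then show "degree (case m of (a, b, c) \<Rightarrow> [:Poly_Mapping.lookup p m:] * [:u1, v1:] ^ a * [:u2, v2:] ^ b * [:u3, v3:] ^ c) \<le> k"
      using lin unfolding abc prod.case k by blast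
  qed simp
qed

text \<open>The chart s -> u + s v misses only the point v of the line, where a vanishes. So a p
  vanishes on all of l, by homogeneity of p, and the prime l, not dividing a, divides p.\<close>

lemma restr_eq_0_iff:
  assumes fr: "frame l u v w a b" and l: "l \<noteq> (0, 0, 0)" and p: "homogeneous k p"
  shows "restr u v p = 0 \<longleftrightarrow> lin_form l dvd p"
proof
  assume "lin_form l dvd p"
  then have "evalp p (u + scale3 s v) = 0" for s
    using fr by (simp add: lin_form_dvd_iff[OF l] frame_def dot_simps)
  then show "restr u v p = 0" by (simp add: poly_restr flip: poly_all_0_iff_0)
next
  assume 0: "restr u v p = 0"
  have a0: "a \<noteq> (0, 0, 0)" using fr by (auto simp: frame_def dot_def split: prod.splits)
  have "lin_form l dvd lin_form a * p"
    unfolding lin_form_dvd_iff[OF l]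
  proof (intro allI impI)
    fix x assume x: "dot l x = 0"
    show "evalp (lin_form a * p) x = 0"
    proof (cases "dot a x = 0")
      case False
      have "x = scale3 (dot a x) u + scale3 (dot b x) v + scale3 (dot l x) w"
        using fr unfolding frame_def by blast
      also have "\<dots> = scale3 (dot a x) (u + scale3 (dot b x / dot a x) v)"
        using False by (cases u; cases v; cases w) (simp add: x plus_prod_def ring_distribs)
      finally have "evalp p x = dot a x ^ k * evalp p (u + scale3 (dot b x / dot a x) v)"
        using evalp_hom[OF p] by metis
      also have "\<dots> = 0" by (simp add: 0 flip: poly_restr)
      finally show ?thesis by simp
    qed simp
  qed
  moreover have "\<not> lin_form l dvd lin_form a"
    using fr unfolding lin_form_dvd_iff[OF l] frame_def by force
  ultimately show "lin_form l dvd p" using lin_form_prime[OF l] by blast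
qed

text \<open>F is homogenised in a and b; on the chart a takes the value 1 and b the value s.\<close>

lemma restr_surj:
  assumes fr: "frame l u v w a b" and F: "degree F \<le> e"
  shows "\<exists>m. homogeneous e m \<and> restr u v m = F"
proof -
  let ?m = "\<Sum>i\<le>e. const3 (poly.coeff F i) * (lin_form a ^ (e - i) * lin_form b ^ i)"
  have "homogeneous e ?m"
  proof (intro hom_sum hom_const_mult hom_mult')
    fix i assume "i \<in> {..e}"
    then show "e = (e - i) * Suc 0 + i * Suc 0" by simp
  qed (intro hom_power hom_lin_form)+
  moreover have "restr u v ?m = F"
  proof -
    have "poly (restr u v ?m) s = poly F s" for s
    proof -
      have "dot a (u + scale3 s v) = 1" "dot b (u + scale3 s v) = s"
        using fr by (simp_all add: frame_def dot_simps)
      then have "poly (restr u v ?m) s = (\<Sum>i\<le>e. poly.coeff F i * s ^ i)"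
        by (simp add: poly_restr evalp_sum)
      also have "\<dots> = (\<Sum>i\<le>degree F. poly.coeff F i * s ^ i)"
        using F by (intro sum.mono_neutral_right) (auto simp: coeff_eq_0)
      finally show ?thesis by (simp add: poly_altdef)
    qed
    then have "poly (restr u v ?m) = poly F" by (rule ext)
    then show ?thesis by (simp only: poly_eq_poly_eq_iff)
  qed
  ultimately show ?thesis by blast
qed

subsection \<open>Polynomials with prescribed zeros\<close>

lemma poly_vanish_dvd:
  fixes F :: "complex poly"
  assumes "finite T" "\<And>t. t \<in> T \<Longrightarrow> poly F t = 0"
  shows "\<exists>G. F = (\<Prod>t\<in>T. [:- t, 1:]) * G"
  using assms
proof (induction T rule: finite_induct)
  case (insert t T)
  then obtain G where G: "F = (\<Prod>t\<in>T. [:- t, 1:]) * G" by blast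
  have "poly (\<Prod>t\<in>T. [:- t, 1:]) t \<noteq> 0"
    using insert.hyps by (simp add: poly_prod)
  then have "poly G t = 0" using insert.prems[of t] G by simp
  then obtain H where H: "G = [:- t, 1:] * H" using poly_eq_0_iff_dvd by blast
  have "(\<Prod>t\<in>insert t T. [:- t, 1:]) = [:- t, 1:] * (\<Prod>t\<in>T. [:- t, 1:])"
    using insert.hyps by (rule prod.insert)
  then show ?case by (intro exI[of _ H]) (simp only: G H mult_ac)
qed simp

lemma degree_prod_lin: "finite T \<Longrightarrow> degree (\<Prod>t\<in>T. [:- t, 1:] :: complex poly) = card T"
  by (subst degree_prod_eq_sum_degree) auto

lemma prod_lin_nz: "finite T \<Longrightarrow> (\<Prod>t\<in>T. [:- t, 1:] :: complex poly) \<noteq> 0"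
  by simp

text \<open>Multiplication by the product of the factors s - t identifies the polynomials of degree
  at most k - card T with this space.\<close>

lemma fdim_vanish:
  fixes T :: "complex set"
  assumes "finite T" "card T \<le> k"
  shows "fdim smult {F. degree F \<le> k \<and> (\<forall>t\<in>T. poly F t = 0)} (k - card T + 1)"
proof -
  let ?b = "\<Prod>t\<in>T. [:- t, 1:] :: complex poly"
  have "{F. degree F \<le> k \<and> (\<forall>t\<in>T. poly F t = 0)} = (\<lambda>G. ?b * G) ` {F. degree F \<le> k - card T}"
  proof (intro set_eqI iffI)
    fix F assume F: "F \<in> {F. degree F \<le> k \<and> (\<forall>t\<in>T. poly F t = 0)}"
    then obtain G where G: "F = ?b * G" using poly_vanish_dvd[OF assms(1)] by blast
    have "degree G \<le> k - card T"
    proof (cases "G = 0")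
      case False
      then have "degree F = card T + degree G"
        unfolding G using degree_mult_eq[OF prod_lin_nz[OF assms(1)]] degree_prod_lin[OF assms(1)] by simp
      then show ?thesis using F by auto
    qed simp
    then show "F \<in> (\<lambda>G. ?b * G) ` {F. degree F \<le> k - card T}" using G by blast
  next
    fix F assume "F \<in> (\<lambda>G. ?b * G) ` {F. degree F \<le> k - card T}"
    then obtain G where G: "F = ?b * G" "degree G \<le> k - card T" by blast
    have "degree F \<le> card T + degree G"
      unfolding G(1) using degree_mult_le[of ?b G] degree_prod_lin[OF assms(1)] by simp
    moreover have "poly F t = 0" if "t \<in> T" for t
      using that assms(1) by (auto simp: G(1) poly_prod)
    ultimately show "F \<in> {F. degree F \<le> k \<and> (\<forall>t\<in>T. poly F t = 0)}"
      using G(2) assms(2) by auto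
  qed
  moreover have "fdim smult ((\<lambda>G. ?b * G) ` {F. degree F \<le> k - card T}) (k - card T + 1)"
  proof (rule fdim_inj_image[OF _ fdim_poly])
    show "Vector_Spaces.linear smult smult (\<lambda>G. ?b * G)"
      by (simp add: Vector_Spaces.linear_iff vector_space_smult ring_distribs)
  qed (use assms(1) in auto)
  ultimately show ?thesis by simp
qed

text \<open>Lagrange interpolation with polynomial coefficients. The products are, up to a common
  factor, the restrictions of f / j to a further line, which is why fields built from f / j suffice
  in \<open>logder_image\<close>.\<close>

lemma lagrange_basis:
  fixes F :: "complex poly"
  assumes "finite Q" "Q \<noteq> {}" "degree F \<le> card Q - 1 + e"
  shows "\<exists>c. (\<forall>q\<in>Q. degree (c q) \<le> e) \<and> F = (\<Sum>q\<in>Q. c q * (\<Prod>r\<in>Q - {q}. [:- r, 1:]))"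
  using assms
proof (induction Q arbitrary: F rule: finite_ne_induct)
  case (singleton q)
  then show ?case by (intro exI[of _ "\<lambda>_. F"]) simp
next
  case (insert q Q)
  let ?P = "\<Prod>r\<in>Q. [:- r, 1:] :: complex poly"
  have P: "poly ?P q \<noteq> 0" using insert.hyps by (simp add: poly_prod)
  \<comment> \<open>At q only the product over the other points is nonzero; subtracting this
    multiple leaves a polynomial divisible by s - q, to which the induction hypothesis
    applies.\<close>
  define x where "x = poly F q / poly ?P q"
  have "poly (F - smult x ?P) q = 0" using P by (simp add: x_def)
  then obtain G where G: "F - smult x ?P = [:- q, 1:] * G" using poly_eq_0_iff_dvd by blast
  have cQ: "card Q \<ge> 1" using insert.hyps by (simp add: Suc_le_eq card_gt_0_iff)
  have "degree (F - smult x ?P) \<le> card Q + e"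
  proof (rule degree_diff_le)
    show "degree F \<le> card Q + e" using insert.prems insert.hyps by simp
    show "degree (smult x ?P) \<le> card Q + e"
      using order.trans[OF degree_smult_le] degree_prod_lin[OF insert.hyps(1)] by simp
  qed
  then have "degree G \<le> card Q - 1 + e"
    using cQ degree_mult_eq[of "[:- q, 1:]" G] unfolding G by (cases "G = 0") simp_all
  then obtain c where c: "\<forall>q\<in>Q. degree (c q) \<le> e" "G = (\<Sum>q\<in>Q. c q * (\<Prod>r\<in>Q - {q}. [:- r, 1:]))"
    using insert.IH by blast
  let ?c = "c(q := [:x:])"
  have eq: "(\<Prod>r\<in>insert q Q - {q'}. [:- r, 1:]) = [:- q, 1:] * (\<Prod>r\<in>Q - {q'}. [:- r, 1:] :: complex poly)"
    if "q' \<in> Q" for q'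
  proof -
    have "insert q Q - {q'} = insert q (Q - {q'})" using that insert.hyps by auto
    then show ?thesis using insert.hyps by simp
  qed
  have "F = smult x ?P + [:- q, 1:] * G" using G by (simp add: algebra_simps)
  also have "[:- q, 1:] * G = (\<Sum>q'\<in>Q. ?c q' * (\<Prod>r\<in>insert q Q - {q'}. [:- r, 1:]))"
    unfolding c(2) sum_distrib_left
  proof (rule sum.cong)
    fix q' assume q': "q' \<in> Q"
    then have "?c q' = c q'" using insert.hyps by auto
    then show "[:- q, 1:] * (c q' * (\<Prod>r\<in>Q - {q'}. [:- r, 1:])) =
        ?c q' * (\<Prod>r\<in>insert q Q - {q'}. [:- r, 1:])"
      unfolding eq[OF q'] by (simp only: mult_ac)
  qed simp
  also have "smult x ?P = ?c q * (\<Prod>r\<in>insert q Q - {q}. [:- r, 1:])"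
    using insert.hyps by simp
  finally have "F = (\<Sum>q'\<in>insert q Q. ?c q' * (\<Prod>r\<in>insert q Q - {q'}. [:- r, 1:]))"
    unfolding sum.insert[OF insert.hyps(1,3)] .
  moreover have "\<forall>q'\<in>insert q Q. degree (?c q') \<le> e" using c(1) by auto
  ultimately show ?case by blast
qed

subsection \<open>Points and incidences\<close>

definition pclass :: "pt3 \<Rightarrow> pt3 set" where "pclass p = {q. q \<noteq> (0, 0, 0) \<and> proportional p q}"

definition mult_at :: "pt3 set \<Rightarrow> pt3 set \<Rightarrow> nat" where
  "mult_at A P = card {l \<in> A. \<forall>q\<in>P. on_line l q}"

definition npts :: "pt3 set \<Rightarrow> nat \<Rightarrow> nat" where "npts A k = card {P \<in> P2. mult_at A P = k}"

lemma P2_pclass: "P \<in> P2 \<longleftrightarrow> (\<exists>p. p \<noteq> (0, 0, 0) \<and> P = pclass p)"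
  unfolding P2_def pclass_def by blast

lemma on_pclass: "p \<noteq> (0, 0, 0) \<Longrightarrow> (\<forall>q\<in>pclass p. on_line l q) \<longleftrightarrow> dot l p = 0"
proof
  assume p: "p \<noteq> (0, 0, 0)"
  have "proportional p p" unfolding proportional_def by (intro exI[of _ 1]) simp
  then have "p \<in> pclass p" using p by (simp add: pclass_def)
  then show "\<forall>q\<in>pclass p. on_line l q \<Longrightarrow> dot l p = 0" by (simp add: on_line_dot)
  assume 0: "dot l p = 0"
  show "\<forall>q\<in>pclass p. on_line l q"
  proof
    fix q assume "q \<in> pclass p"
    then obtain t where "q = scale3 t p" unfolding pclass_def proportional_def by blast
    then show "on_line l q" using 0 by (simp add: on_line_dot dot_simps)
  qed
qed

lemma proportional_trans: "proportional p q \<Longrightarrow> proportional q r \<Longrightarrow> proportional p r"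
  unfolding proportional_def by (metis mult_eq_0_iff scale3_simps(3))

lemma proportional_refl: "proportional p p"
  unfolding proportional_def by (intro exI[of _ 1]) simp

lemma pclass_eq: "q \<noteq> (0, 0, 0) \<Longrightarrow> pclass p = pclass q \<longleftrightarrow> proportional p q"
proof
  assume "q \<noteq> (0, 0, 0)" "pclass p = pclass q"
  then have "q \<in> pclass p" using proportional_refl by (simp add: pclass_def)
  then show "proportional p q" by (simp add: pclass_def)
next
  assume "proportional p q"
  then show "pclass p = pclass q"
    unfolding pclass_def by (metis proportional_sym proportional_trans)
qed

lemma mult_at_pclass: "p \<noteq> (0, 0, 0) \<Longrightarrow> mult_at A (pclass p) = card {l \<in> A. dot l p = 0}"
  by (simp add: mult_at_def on_pclass)

lemma mult_at_insert:
  assumes "finite A" "l \<notin> A"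
  shows "mult_at (insert l A) P = (if \<forall>q\<in>P. on_line l q then 1 else 0) + mult_at A P"
proof (cases "\<forall>q\<in>P. on_line l q")
  case True
  then have "{m \<in> insert l A. \<forall>q\<in>P. on_line m q} = insert l {m \<in> A. \<forall>q\<in>P. on_line m q}" by blast
  then show ?thesis using assms True by (simp add: mult_at_def)
next
  case False
  then have "{m \<in> insert l A. \<forall>q\<in>P. on_line m q} = {m \<in> A. \<forall>q\<in>P. on_line m q}" by blast
  then show ?thesis using False by (simp add: mult_at_def)
qed

lemma mult_at_mono: "finite A \<Longrightarrow> B \<subseteq> A \<Longrightarrow> mult_at B P \<le> mult_at A P"
  unfolding mult_at_def by (rule card_mono) auto

definition chart :: "pt3 set \<Rightarrow> pt3 \<Rightarrow> pt3 \<Rightarrow> pt3 \<Rightarrow> pt3 \<Rightarrow> pt3 \<Rightarrow> pt3 \<Rightarrow> bool" where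
  "chart A l u v w a b \<longleftrightarrow> frame l u v w a b \<and> (\<forall>m\<in>A. dot m v \<noteq> 0)"

text \<open>In the chart s -> u + s v of the line l, the line m meets l at the parameter value
  meet u v m.\<close>

definition meet :: "pt3 \<Rightarrow> pt3 \<Rightarrow> pt3 \<Rightarrow> complex" where "meet u v m = - dot m u / dot m v"

definition fibre :: "pt3 set \<Rightarrow> pt3 \<Rightarrow> pt3 \<Rightarrow> complex \<Rightarrow> pt3 set" where
  "fibre A u v s = {m \<in> A. meet u v m = s}"

lemma chart_exists:
  assumes "arrangement (insert l A)" "l \<notin> A"
  shows "\<exists>u v w a b. chart A l u v w a b"
  using frame_generic[of l A] arrangement_insertD[OF assms] unfolding chart_def by blast

lemma meet_iff: "dot m v \<noteq> 0 \<Longrightarrow> meet u v m = s \<longleftrightarrow> dot m (u + scale3 s v) = 0"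
  by (auto simp: meet_def dot_simps field_simps add_eq_0_iff)

lemma chart_nz: "frame l u v w a b \<Longrightarrow> u + scale3 s v \<noteq> (0, 0, 0)"
proof
  assume fr: "frame l u v w a b" and 0: "u + scale3 s v = (0, 0, 0)"
  have "dot a (u + scale3 s v) = 1" using fr by (simp add: frame_def dot_simps)
  then show False unfolding 0 by (cases a) (simp add: dot_simps)
qed

lemma mult_at_chart:
  assumes "chart A l u v w a b"
  shows "mult_at A (pclass (u + scale3 s v)) = card (fibre A u v s)"
proof -
  have "m \<in> A \<Longrightarrow> dot m (u + scale3 s v) = 0 \<longleftrightarrow> meet u v m = s" for m
    using assms meet_iff unfolding chart_def by blast
  then have "{m \<in> A. dot m (u + scale3 s v) = 0} = fibre A u v s"
    unfolding fibre_def by blast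
  then show ?thesis
    using mult_at_pclass[OF chart_nz, of l u v w a b A s] assms by (simp add: chart_def)
qed

lemma chart_points:
  assumes ch: "chart A l u v w a b" and fin: "finite A" and j: "j \<noteq> 0"
  shows "bij_betw (\<lambda>s. pclass (u + scale3 s v)) {s. card (fibre A u v s) = j}
    {P \<in> P2. (\<forall>q\<in>P. on_line l q) \<and> mult_at A P = j}"
proof -
  have fr: "frame l u v w a b" using ch by (simp add: chart_def)
  note nz = chart_nz[OF fr]
  have onl: "dot l (u + scale3 s v) = 0" for s using fr by (simp add: frame_def dot_simps)
  show ?thesis unfolding bij_betw_def
  proof
    show "inj_on (\<lambda>s. pclass (u + scale3 s v)) {s. card (fibre A u v s) = j}"
    proof (rule inj_onI)
      fix s t assume "pclass (u + scale3 s v) = pclass (u + scale3 t v)"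
      then obtain r where "u + scale3 t v = scale3 r (u + scale3 s v)"
        using pclass_eq nz unfolding proportional_def by blast
      then have "dot a (u + scale3 t v) = r * dot a (u + scale3 s v)"
        "dot b (u + scale3 t v) = r * dot b (u + scale3 s v)"
        by (simp_all add: dot_simps(2))
      then show "s = t" using fr by (simp add: frame_def dot_simps)
    qed
    show "(\<lambda>s. pclass (u + scale3 s v)) ` {s. card (fibre A u v s) = j} =
      {P \<in> P2. (\<forall>q\<in>P. on_line l q) \<and> mult_at A P = j}" (is "?L = ?R")
    proof
      show "?L \<subseteq> ?R"
      proof
        fix P assume "P \<in> ?L"
        then obtain s where s: "P = pclass (u + scale3 s v)" "card (fibre A u v s) = j" by blast
        have "P \<in> P2" using P2_pclass nz s(1) by blast
        moreover have "\<forall>q\<in>P. on_line l q" using on_pclass[OF nz] onl s(1) by blast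
        ultimately show "P \<in> ?R" using mult_at_chart[OF ch, of s] s by blast
      qed
      show "?R \<subseteq> ?L"
      proof
        fix P assume P: "P \<in> ?R"
        then obtain p where p: "p \<noteq> (0, 0, 0)" "P = pclass p" using P2_pclass by blast
        have lp: "dot l p = 0" using P p on_pclass by blast
        have pmj: "mult_at A P = j" using P by blast
        then have "card {m \<in> A. dot m p = 0} = j" using mult_at_pclass[OF p(1), of A] p(2) by simp
        then have "{m \<in> A. dot m p = 0} \<noteq> {}" using j by force
        then obtain m where m: "m \<in> A" "dot m p = 0" by blast
        have "p = scale3 (dot a p) u + scale3 (dot b p) v + scale3 (dot l p) w"
          using fr unfolding frame_def by blast
        then have evalp: "p = scale3 (dot a p) u + scale3 (dot b p) v"
          unfolding lp by (cases "scale3 (dot a p) u + scale3 (dot b p) v") simp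
        \<comment> \<open>Otherwise p is the point v at infinity of the chart, through which no line
          of A passes, whereas m passes through p.\<close>
        have "dot a p \<noteq> 0"
        proof
          assume a0: "dot a p = 0"
          have eq: "p = scale3 (dot b p) v" using evalp unfolding a0 by (cases "scale3 (dot b p) v") simp
          have "dot m p = dot b p * dot m v"
            using arg_cong[OF eq, of "dot m"] by (simp only: dot_simps(2))
          then have "dot b p = 0" using ch m by (simp add: chart_def)
          then have "p = scale3 0 v" using eq by (simp only:)
          then show False using p(1) by simp
        qed
        have "scale3 (dot a p) (u + scale3 (dot b p / dot a p) v) = scale3 (dot a p) u + scale3 (dot b p) v"
          using \<open>dot a p \<noteq> 0\<close> by (cases u; cases v) (simp add: ring_distribs)
        then have "p = scale3 (dot a p) (u + scale3 (dot b p / dot a p) v)"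
          using trans[OF evalp sym] by blast
        then have "proportional (u + scale3 (dot b p / dot a p) v) p"
          using \<open>dot a p \<noteq> 0\<close> unfolding proportional_def by blast
        then have Pe: "P = pclass (u + scale3 (dot b p / dot a p) v)" using pclass_eq p by blast
        moreover have "card (fibre A u v (dot b p / dot a p)) = j"
          using pmj Pe mult_at_chart[OF ch, of "dot b p / dot a p"] by simp
        ultimately show "P \<in> ?L" by blast
      qed
    qed
  qed
qed

lemma fibre_finite: "finite A \<Longrightarrow> j \<noteq> 0 \<Longrightarrow> finite {s. card (fibre A u v s) = j}"
proof -
  assume A: "finite A" "j \<noteq> 0"
  have "{s. card (fibre A u v s) = j} \<subseteq> meet u v ` A"
  proof
    fix s assume "s \<in> {s. card (fibre A u v s) = j}"
    then have "fibre A u v s \<noteq> {}" using A(2) by force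
    then show "s \<in> meet u v ` A" unfolding fibre_def by blast
  qed
  then show ?thesis using A(1) finite_subset by blast
qed

lemma fibre_sum:
  assumes "finite A"
  shows "card A = (\<Sum>s\<in>meet u v ` A. card (fibre A u v s))"
proof -
  have "card A = (\<Sum>m\<in>A. 1)" by simp
  also have "\<dots> = (\<Sum>s\<in>meet u v ` A. sum (\<lambda>_. 1) (fibre A u v s))"
    unfolding fibre_def using assms by (rule sum.image_gen)
  finally show ?thesis by simp
qed

lemma finite_points:
  assumes "arrangement A"
  shows "finite {P \<in> P2. mult_at A P \<ge> 2}"
proof -
  have fin: "finite A" using assms by (simp add: arrangement_def)
  have "{P \<in> P2. mult_at A P \<ge> 2} \<subseteq> (\<lambda>(l, m). pclass (cross l m)) ` (A \<times> A)"
  proof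
    fix P assume P: "P \<in> {P \<in> P2. mult_at A P \<ge> 2}"
    then obtain p where p: "p \<noteq> (0, 0, 0)" "P = pclass p" using P2_pclass by blast
    have "mult_at A P \<ge> 2" using P by blast
    then have "\<not> card {l \<in> A. dot l p = 0} \<le> Suc 0" using p mult_at_pclass[OF p(1), of A] by simp
    then have "\<not> (\<forall>x\<in>{l \<in> A. dot l p = 0}. \<forall>y\<in>{l \<in> A. dot l p = 0}. x = y)"
      using card_le_Suc0_iff_eq[of "{l \<in> A. dot l p = 0}"] fin by simp
    then obtain l m where lm: "l \<in> A" "m \<in> A" "l \<noteq> m" "dot l p = 0" "dot m p = 0"
      by blast
    then have "l \<noteq> (0, 0, 0)" "m \<noteq> (0, 0, 0)" using assms unfolding arrangement_def by blast+
    then have c: "cross l m \<noteq> (0, 0, 0)"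
      using arrD[OF assms lm(1-3)] proportional_iff_cross[of l m] by blast
    then obtain t where t: "p = scale3 t (cross l m)" using meet_parallel lm by blast
    then have "t \<noteq> 0" using p(1) by (intro notI) simp
    then have "proportional (cross l m) p"
      using t unfolding proportional_def by blast
    then have "P = pclass (cross l m)" using pclass_eq p by blast
    then show "P \<in> (\<lambda>(l, m). pclass (cross l m)) ` (A \<times> A)" using lm by force
  qed
  then show ?thesis using fin finite_subset by blast
qed

text \<open>A triple point of A cannot lie on l, since it would become a quadruple point; so the new
  triple points are the double points of A on l.\<close>

lemma npts_insert:
  assumes arrangement: "arrangement (insert l A)" "l \<notin> A" and le3: "\<And>P. P \<in> P2 \<Longrightarrow> mult_at (insert l A) P \<le> 3"
    and ch: "chart A l u v w a b"
  shows "npts (insert l A) 3 = npts A 3 + card {s. card (fibre A u v s) = 2}"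
proof -
  note D = arrangement_insertD[OF arrangement]
  let ?X = "{P \<in> P2. mult_at A P = 3}" and ?Y = "{P \<in> P2. (\<forall>q\<in>P. on_line l q) \<and> mult_at A P = 2}"
  have ins: "mult_at (insert l A) P = (if \<forall>q\<in>P. on_line l q then 1 else 0) + mult_at A P" for P
    using mult_at_insert[OF D(1) arrangement(2)] .
  have "{P \<in> P2. mult_at (insert l A) P = 3} = ?X \<union> ?Y"
  proof (intro set_eqI iffI)
    fix P assume "P \<in> {P \<in> P2. mult_at (insert l A) P = 3}"
    then show "P \<in> ?X \<union> ?Y" unfolding ins by (auto split: if_splits)
  next
    fix P assume P: "P \<in> ?X \<union> ?Y"
    then have "mult_at (insert l A) P \<le> 3" using le3 by blast
    then show "P \<in> {P \<in> P2. mult_at (insert l A) P = 3}" using P unfolding ins by (auto split: if_splits)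
  qed
  moreover have "finite ?X" "finite ?Y"
    using finite_points[OF D(2)] by (auto elim!: rev_finite_subset)
  moreover have "?X \<inter> ?Y = {}" by auto
  ultimately have "npts (insert l A) 3 = npts A 3 + card ?Y"
    by (simp add: npts_def card_Un_disjoint)
  moreover have "card {s. card (fibre A u v s) = 2} = card ?Y"
    using chart_points[OF ch D(1), of 2] by (intro bij_betw_same_card) auto
  ultimately show ?thesis by simp
qed

text \<open>The line l itself passes through the point, which accounts for one unit of the
  multiplicity. The bound stays general because arrangements with nodes only are treated as
  well.\<close>

lemma fibre_le:
  assumes arrangement: "arrangement (insert l A)" "l \<notin> A" and le: "\<And>P. P \<in> P2 \<Longrightarrow> mult_at (insert l A) P \<le> Suc \<mu>"
    and ch: "chart A l u v w a b"
  shows "card (fibre A u v s) \<le> \<mu>"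
proof -
  note D = arrangement_insertD[OF arrangement]
  have fr: "frame l u v w a b" using ch by (simp add: chart_def)
  have "dot l (u + scale3 s v) = 0" using fr by (simp add: frame_def dot_simps)
  then have "\<forall>q\<in>pclass (u + scale3 s v). on_line l q" using on_pclass chart_nz[OF fr] by blast
  then have "mult_at (insert l A) (pclass (u + scale3 s v)) = Suc (card (fibre A u v s))"
    using mult_at_insert[OF D(1) arrangement(2)] mult_at_chart[OF ch] by simp
  moreover have "pclass (u + scale3 s v) \<in> P2" using P2_pclass chart_nz[OF fr] by blast
  ultimately show ?thesis using le by fastforce
qed

subsection \<open>The Hilbert function of the module of logarithmic vector fields\<close>

text \<open>At a point p on two lines m and n of A, the value of \<theta> is annihilated by m and n,
  hence is a multiple of p itself; l vanishes at p and therefore at this value.\<close>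

lemma tang_vanishes:
  assumes arrangement: "arrangement (insert l A)" "l \<notin> A" and ch: "chart A l u v w a b"
    and \<theta>: "\<theta> \<in> logder A" and s: "card (fibre A u v s) = 2"
  shows "poly (restr u v (tang \<theta> l)) s = 0"
proof -
  note D = arrangement_insertD[OF arrangement]
  have fr: "frame l u v w a b" using ch by (simp add: chart_def)
  let ?p = "u + scale3 s v"
  obtain m n where mn: "m \<in> A" "n \<in> A" "m \<noteq> n" "meet u v m = s" "meet u v n = s"
    using s unfolding card_2_iff fibre_def by blast
  have on: "dot m ?p = 0" "dot n ?p = 0" "dot l ?p = 0"
    using mn ch fr meet_iff by (auto simp: chart_def frame_def dot_simps)
  have 0: "evalp (tang \<theta> m) ?p = 0" "evalp (tang \<theta> n) ?p = 0"
    using \<theta> mn on D lin_form_dvd_iff unfolding logder_def by blast+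
  obtain x y z where \<theta>e: "\<theta> = (x, y, z)" by (cases \<theta>)
  let ?V = "(evalp x ?p, evalp y ?p, evalp z ?p)"
  have pt: "evalp (tang \<theta> k) ?p = dot k ?V" for k
    by (cases k) (simp add: \<theta>e tang_def dot_def)
  have c: "cross m n \<noteq> (0, 0, 0)"
    using D(4)[OF mn(1)] D(4)[OF mn(2)] arrD[OF D(2) mn(1-3)] proportional_iff_cross[of m n] by blast
  obtain t where t: "?p = scale3 t (cross m n)" using meet_parallel on c by blast
  obtain r where r: "?V = scale3 r (cross m n)" using meet_parallel[OF _ _ c] 0 unfolding pt by blast
  have "t \<noteq> 0" using t chart_nz[OF fr, of s] by (intro notI) simp
  moreover have "t * dot l (cross m n) = 0" using on(3) unfolding t dot_simps(2) .
  ultimately have "dot l (cross m n) = 0" by simp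
  then have "dot l ?V = 0" unfolding r by (simp add: dot_simps)
  then show ?thesis unfolding poly_restr pt .
qed

text \<open>On the line l the forms of A restrict to linear factors, each root occurring once or
  twice. The second occurrences give the product over double fibres; removing j drops one factor
  from the product over all roots.\<close>

lemma restr_defpoly:
  assumes "finite A" "\<And>m. m \<in> A \<Longrightarrow> dot m v \<noteq> 0" "\<And>s. card (fibre A u v s) \<le> 2" "j \<in> A"
  shows "\<exists>c. c \<noteq> 0 \<and> restr u v (defpoly (A - {j})) = smult c ((\<Prod>t\<in>{s. card (fibre A u v s) = 2}. [:- t, 1:]) *
     (\<Prod>t\<in>meet u v ` A - {meet u v j}. [:- t, 1:]))"
proof -
  let ?Q = "meet u v ` A" and ?T = "{s. card (fibre A u v s) = 2}"
  let ?g = "\<lambda>t::complex. [:- t, 1:]"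
  have lin: "restr u v (lin_form m) = smult (dot m v) (?g (meet u v m))" if "m \<in> A" for m
    using assms(2)[OF that] by (simp add: restr_lin_form meet_def)
  have "(\<Prod>m\<in>A. ?g (meet u v m)) = (\<Prod>t\<in>?Q. \<Prod>m\<in>fibre A u v t. ?g (meet u v m))"
    unfolding fibre_def using assms(1) by (rule prod.image_gen)
  also have "\<dots> = (\<Prod>t\<in>?Q. ?g t ^ card (fibre A u v t))"
    by (intro prod.cong refl) (simp add: fibre_def)
  also have "\<dots> = (\<Prod>t\<in>?Q. ?g t * (if t \<in> ?T then ?g t else 1))"
  proof (rule prod.cong)
    fix t assume t: "t \<in> ?Q"
    then have "fibre A u v t \<noteq> {}" by (auto simp: fibre_def)
    then have "card (fibre A u v t) \<noteq> 0" using assms(1) by (simp add: fibre_def)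
    then have "card (fibre A u v t) = 1 \<or> card (fibre A u v t) = 2" using assms(3)[of t] by linarith
    then show "?g t ^ card (fibre A u v t) = ?g t * (if t \<in> ?T then ?g t else 1)"
      by (elim disjE) (simp_all add: power2_eq_square)
  qed simp
  also have "\<dots> = (\<Prod>t\<in>?Q. ?g t) * (\<Prod>t\<in>?Q \<inter> ?T. ?g t)"
    using assms(1) by (simp only: prod.distrib prod.inter_restrict finite_imageI)
  also have "?Q \<inter> ?T = ?T"
  proof -
    have "?T \<subseteq> ?Q"
    proof
      fix s assume "s \<in> ?T"
      then have "fibre A u v s \<noteq> {}" by force
      then show "s \<in> ?Q" unfolding fibre_def by blast
    qed
    then show ?thesis by blast
  qed
  finally have all: "(\<Prod>m\<in>A. ?g (meet u v m)) = (\<Prod>t\<in>?Q. ?g t) * (\<Prod>t\<in>?T. ?g t)" .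
  have "?g (meet u v j) * (\<Prod>m\<in>A - {j}. ?g (meet u v m)) =
     ?g (meet u v j) * ((\<Prod>t\<in>?Q - {meet u v j}. ?g t) * (\<Prod>t\<in>?T. ?g t))"
    using all prod.remove[OF assms(1,4), of "\<lambda>m. ?g (meet u v m)"]
      prod.remove[of ?Q "meet u v j" ?g] assms(1,4) by (simp only: finite_imageI imageI mult_ac)
  moreover have "?g (meet u v j) \<noteq> 0" by simp
  ultimately have rem: "(\<Prod>m\<in>A - {j}. ?g (meet u v m)) = (\<Prod>t\<in>?Q - {meet u v j}. ?g t) * (\<Prod>t\<in>?T. ?g t)"
    using mult_left_cancel by blast
  have "restr u v (defpoly (A - {j})) = (\<Prod>m\<in>A - {j}. smult (dot m v) (?g (meet u v m)))"
    unfolding defpoly_def restr_prod by (rule prod.cong) (auto simp only: lin Diff_iff)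
  also have "\<dots> = smult (\<Prod>m\<in>A - {j}. dot m v) (\<Prod>m\<in>A - {j}. ?g (meet u v m))"
    by (simp only: prod_smult)
  finally have "restr u v (defpoly (A - {j})) =
      smult (\<Prod>m\<in>A - {j}. dot m v) ((\<Prod>t\<in>?T. ?g t) * (\<Prod>t\<in>?Q - {meet u v j}. ?g t))"
    unfolding rem by (simp only: mult.commute)
  moreover have "(\<Prod>m\<in>A - {j}. dot m v) \<noteq> 0" using assms(1,2) by simp
  ultimately show ?thesis by blast
qed

text \<open>Provides a constant vector field that is tangent to m and takes the value 1 on
  l.\<close>

lemma dual_vector:
  assumes "l \<noteq> (0, 0, 0)" "m \<noteq> (0, 0, 0)" "\<not> proportional l m"
  shows "\<exists>z. dot l z = 1 \<and> dot m z = 0"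
proof (rule ccontr)
  assume no: "\<not> ?thesis"
  have "dot l z = 0" if "dot m z = 0" for z
  proof (rule ccontr)
    assume nz: "dot l z \<noteq> 0"
    have "dot l (scale3 (1 / dot l z) z) = 1" "dot m (scale3 (1 / dot l z) z) = 0"
      using nz that by (simp_all add: dot_simps)
    then show False using no by blast
  qed
  then have "lin_form m dvd lin_form l" using lin_form_dvd_iff[OF assms(2)] by simp
  then have "proportional m l" using lin_form_dvd_lin_form assms by blast
  then show False using assms(3) proportional_sym by blast
qed

lemma fibre_card:
  assumes "finite A" "\<And>s. card (fibre A u v s) \<le> 2"
  shows "card A = card (meet u v ` A) + card {s. card (fibre A u v s) = 2}"
proof -
  let ?Q = "meet u v ` A" and ?T = "{s. card (fibre A u v s) = 2}"
  have "card (fibre A u v s) = 1 + (if s \<in> ?T then 1 else 0)" if "s \<in> ?Q" for s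
  proof -
    have "fibre A u v s \<noteq> {}" using that unfolding fibre_def by blast
    moreover have "finite (fibre A u v s)" using assms(1) unfolding fibre_def by simp
    ultimately have "card (fibre A u v s) \<noteq> 0" by simp
    then show ?thesis using assms(2)[of s] by simp
  qed
  then have "card A = (\<Sum>s\<in>?Q. 1 + (if s \<in> ?T then 1 else 0))"
    unfolding fibre_sum[OF assms(1), of u v] by (rule sum.cong[OF refl])
  also have "\<dots> = card ?Q + card (?Q \<inter> ?T)"
    using assms(1) by (simp only: sum.distrib sum.inter_restrict[symmetric] finite_imageI card_eq_sum)
  also have "?Q \<inter> ?T = ?T"
  proof -
    have "?T \<subseteq> ?Q"
    proof
      fix s assume "s \<in> ?T"
      then have "fibre A u v s \<noteq> {}" by force
      then show "s \<in> ?Q" unfolding fibre_def by blast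
    qed
    then show ?thesis by blast
  qed
  finally show ?thesis .
qed

text \<open>The constant vector field with direction z.\<close>

definition cvec :: "pt3 \<Rightarrow> vec3" where
  "cvec z = (case z of (x, y, t) \<Rightarrow> (const3 x, const3 y, const3 t))"

lemma tang_cvec: "tang (cvec z) l = const3 (dot l z)"
  by (cases z; cases l) (simp add: cvec_def tang_def dot_def const3_add const3_mult)

lemma vforms_cvec: "homogeneous k m \<Longrightarrow> vsmult m (cvec z) \<in> vforms k"
  by (cases z) (auto simp: cvec_def vforms_def homog_vec_def intro: hom_mult'[OF _ hom_const])

lemma scaleV_vsmult: "scaleV c \<theta> = vsmult (const3 c) \<theta>"
  by (cases \<theta>) (simp add: scaleV_simp)

lemma vforms_simps:
  "0 \<in> vforms k" "\<theta> \<in> vforms k \<Longrightarrow> \<eta> \<in> vforms k \<Longrightarrow> \<theta> + \<eta> \<in> vforms k"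
  "\<theta> \<in> vforms k \<Longrightarrow> \<eta> \<in> vforms k \<Longrightarrow> \<theta> - \<eta> \<in> vforms k"
  "homogeneous j s \<Longrightarrow> \<theta> \<in> vforms k \<Longrightarrow> vsmult s \<theta> \<in> vforms (j + k)"
proof -
  show "0 \<in> vforms k" by (simp add: vforms_def homog_vec_def zero_prod_def)
  show "\<theta> \<in> vforms k \<Longrightarrow> \<eta> \<in> vforms k \<Longrightarrow> \<theta> + \<eta> \<in> vforms k"
    by (cases \<theta>; cases \<eta>) (simp add: vforms_def homog_vec_def hom_add)
  show "\<theta> \<in> vforms k \<Longrightarrow> \<eta> \<in> vforms k \<Longrightarrow> \<theta> - \<eta> \<in> vforms k"
    by (cases \<theta>; cases \<eta>) (simp add: vforms_def homog_vec_def hom_diff)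
  show "homogeneous j s \<Longrightarrow> \<theta> \<in> vforms k \<Longrightarrow> vsmult s \<theta> \<in> vforms (j + k)"
    by (cases \<theta>) (simp add: vforms_def homog_vec_def hom_mult)
qed

lemma logder_simps:
  "0 \<in> logder A" "\<theta> \<in> logder A \<Longrightarrow> \<eta> \<in> logder A \<Longrightarrow> \<theta> + \<eta> \<in> logder A" "\<theta> \<in> logder A \<Longrightarrow> vsmult s \<theta> \<in> logder A"
  "\<theta> \<in> logder A \<Longrightarrow> \<eta> \<in> logder A \<Longrightarrow> \<theta> - \<eta> \<in> logder A"
  by (simp_all add: logder_def)

lemma subspace_logder: "module.subspace scaleV (logder A \<inter> vforms k)"
proof -
  interpret vector_space scaleV by (rule vector_space_scaleV)
  have "vsmult (const3 c) \<theta> \<in> vforms k" if "\<theta> \<in> vforms k" for c \<theta>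
    using vforms_simps(4)[OF hom_const that] by simp
  then show ?thesis
    by (simp add: subspace_def scaleV_vsmult vforms_simps(1,2) logder_simps(1-3))
qed

lemma restr_const: "restr u v (const3 c) = [:c:]"
  by (simp add: restr_def split: prod.split)

lemma linear_restr_tang: "Vector_Spaces.linear scaleV smult (\<lambda>\<theta>. restr u v (tang \<theta> l))"
  by (simp add: Vector_Spaces.linear_iff vector_space_scaleV vector_space_smult scaleV_vsmult restr_const)

text \<open>The heart of the dimension count. The inclusion from left to right is
  \<open>tang_vanishes\<close>. Conversely, after division by the product over the double points, F
  is a combination of the products of \<open>lagrange_basis\<close>, each of which is realised by a
  field m (f / j) z with a constant vector z tangent to j.\<close>

lemma logder_image:
  assumes arrangement: "arrangement (insert l A)" "l \<notin> A" and le2: "\<And>s. card (fibre A u v s) \<le> 2"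
    and ch: "chart A l u v w a b" and k: "card A \<le> k"
  shows "(\<lambda>\<theta>. restr u v (tang \<theta> l)) ` (logder A \<inter> vforms k) =
    {F. degree F \<le> k \<and> (\<forall>s\<in>{s. card (fibre A u v s) = 2}. poly F s = 0)}" (is "?L = ?R")
proof
  note D = arrangement_insertD[OF arrangement]
  let ?T = "{s. card (fibre A u v s) = 2}" and ?Q = "meet u v ` A"
  have fr: "frame l u v w a b" using ch by (simp add: chart_def)
  have finT: "finite ?T" using fibre_finite[OF D(1), of 2] by simp
  show "?L \<subseteq> ?R"
  proof
    fix F assume "F \<in> ?L"
    then obtain \<theta> where \<theta>: "\<theta> \<in> logder A" "\<theta> \<in> vforms k" "F = restr u v (tang \<theta> l)" by blast
    have "degree F \<le> k" unfolding \<theta>(3) using \<theta>(2) by (intro restr_degree hom_tang) (simp add: vforms_def)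
    moreover have "poly F s = 0" if "s \<in> ?T" for s
      unfolding \<theta>(3) using that by (intro tang_vanishes[OF arrangement ch \<theta>(1)]) simp
    ultimately show "F \<in> ?R" by blast
  qed
  interpret vector_space scaleV by (rule vector_space_scaleV)
  show "?R \<subseteq> ?L"
  proof
    fix F assume F: "F \<in> ?R"
    show "F \<in> ?L"
    proof (cases "A = {}")
      case True
      \<comment> \<open>Without a line j to build fields from, a constant field transversal to l
        does everything.\<close>
      obtain z where z: "dot l z = 1" using dot_nondeg[OF D(3)] by blast
      obtain m where m: "homogeneous k m" "restr u v m = F" using restr_surj[OF fr] F by blast
      have "vsmult m (cvec z) \<in> logder A \<inter> vforms k"
        using vforms_cvec[OF m(1)] True by (simp add: logder_def)
      moreover have "restr u v (tang (vsmult m (cvec z)) l) = F"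
        using z m(2) by (simp add: tang_cvec)
      ultimately show ?thesis by blast
    next
      case False
      let ?b = "\<Prod>t\<in>?T. [:- t, 1:] :: complex poly"
      obtain G where G: "F = ?b * G" using poly_vanish_dvd[OF finT, of F] F by blast
      \<comment> \<open>The degree left for the coefficient m in a field of degree k, as f / j has
        degree \<open>card A - 1\<close>.\<close>
      define e where "e = k + 1 - card A"
      have Qne: "finite ?Q" "?Q \<noteq> {}" using D(1) False by auto
      have cA: "card A = card ?Q + card ?T" using fibre_card[OF D(1) le2] .
      have cQ: "card ?Q \<ge> 1" using Qne by (simp add: Suc_le_eq card_gt_0_iff)
      have "degree G \<le> card ?Q - 1 + e"
      proof (cases "G = 0")
        case False
        then have "degree F = card ?T + degree G"
          unfolding G using degree_mult_eq[OF prod_lin_nz[OF finT]] degree_prod_lin[OF finT] by simp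
        moreover have "degree F \<le> k" using F by blast
        ultimately show ?thesis using cA cQ k unfolding e_def by linarith
      qed simp
      then obtain c where c: "\<forall>q\<in>?Q. degree (c q) \<le> e"
        "G = (\<Sum>q\<in>?Q. c q * (\<Prod>r\<in>?Q - {q}. [:- r, 1:]))"
        using lagrange_basis[OF Qne] by blast
      have "\<exists>\<eta>. \<eta> \<in> logder A \<inter> vforms k \<and> restr u v (tang \<eta> l) = ?b * (c q * (\<Prod>r\<in>?Q - {q}. [:- r, 1:]))"
        if q: "q \<in> ?Q" for q
      proof -
        obtain j where j: "j \<in> A" "q = meet u v j" using q by blast
        obtain x where x: "x \<noteq> 0" "restr u v (defpoly (A - {j})) = smult x (?b * (\<Prod>t\<in>?Q - {meet u v j}. [:- t, 1:]))"
          using restr_defpoly[OF D(1) _ le2 j(1)] ch unfolding chart_def by blast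
        have "degree (smult (1 / x) (c q)) \<le> e"
          using order.trans[OF degree_smult_le] c(1) q by blast
        then obtain m where m: "homogeneous e m" "restr u v m = smult (1 / x) (c q)"
          using restr_surj[OF fr] by blast
        obtain z where z: "dot l z = 1" "dot j z = 0"
          using dual_vector[OF D(3)] D(4)[OF j(1)] by blast
        \<comment> \<open>Logarithmic for j because z is tangent to j, and for every other line
          because that line divides f / j.\<close>
        let ?\<eta> = "vsmult (m * defpoly (A - {j})) (cvec z)"
        have "homogeneous k (m * defpoly (A - {j}))"
        proof (rule hom_mult'[OF m(1) hom_defpoly])
          have "card A \<ge> 1" using cA cQ by linarith
          then show "k = e + card (A - {j})" using j(1) k D(1) by (simp add: e_def)
        qed (use D(1) in simp)
        then have "?\<eta> \<in> vforms k" by (rule vforms_cvec)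
        moreover have "?\<eta> \<in> logder A"
          unfolding logder_def
        proof (intro CollectI ballI)
          fix i assume i: "i \<in> A"
          show "lin_form i dvd tang ?\<eta> i"
          proof (cases "i = j")
            case True
            then show ?thesis using z(2) by (simp add: tang_cvec)
          next
            case False
            then have "defpoly (A - {j}) = lin_form i * defpoly (A - {j} - {i})"
              using i D(1) by (intro defpoly_remove) auto
            then show ?thesis by (simp add: mult_ac)
          qed
        qed
        moreover have "restr u v (tang ?\<eta> l) = ?b * (c q * (\<Prod>r\<in>?Q - {q}. [:- r, 1:]))"
          using x(1) by (simp add: tang_cvec z(1) x(2) m(2) j(2) mult_ac)
        ultimately show ?thesis by blast
      qed
      then have "\<forall>q\<in>?Q. \<exists>\<eta>. \<eta> \<in> logder A \<inter> vforms k \<and> restr u v (tang \<eta> l) = ?b * (c q * (\<Prod>r\<in>?Q - {q}. [:- r, 1:]))"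
        by blast
      then obtain \<eta> where \<eta>: "\<forall>q\<in>?Q. \<eta> q \<in> logder A \<inter> vforms k \<and>
          restr u v (tang (\<eta> q) l) = ?b * (c q * (\<Prod>r\<in>?Q - {q}. [:- r, 1:]))"
        using bchoice by meson
      have "(\<Sum>q\<in>?Q. \<eta> q) \<in> logder A \<inter> vforms k"
        using \<eta> by (intro subspace_sum[OF subspace_logder]) blast
      moreover have "restr u v (tang (\<Sum>q\<in>?Q. \<eta> q) l) = F"
        unfolding tang_sum restr_sum G c(2) sum_distrib_left using \<eta> by (intro sum.cong) blast+
      ultimately show ?thesis by blast
    qed
  qed
qed

text \<open>Adding a line l passes to the kernel of restriction to l, which lowers the dimension by
  k + 1 - t, where t is the number of double points of A on l. These t points are the new triple
  points, so the corrections add up to \<open>npts A 3\<close>. The equation is written without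
  subtraction.\<close>

theorem hilbert_logder:
  assumes "arrangement A" "\<And>P. P \<in> P2 \<Longrightarrow> mult_at A P \<le> 3" "card A \<le> k"
  shows "\<exists>N. fdim scaleV (logder A \<inter> vforms k) N \<and>
    N + card A * (k + 1) = 3 * ((k + 1) * (k + 2) div 2) + npts A 3"
proof -
  have "finite A" using assms(1) by (simp add: arrangement_def)
  then show ?thesis using assms
  proof (induction A rule: finite_induct)
    case empty
    let ?x = "(k + 1) * (k + 2) div 2"
    have eq: "logder {} \<inter> vforms k = forms k \<times> forms k \<times> forms k"
      by (simp add: logder_def vforms_eq)
    have "fdim scaleV (logder {} \<inter> vforms k) (?x + (?x + ?x))"
      unfolding eq by (rule fdim_forms3)
    moreover have "x + (x + x) + card ({} :: pt3 set) * (k + 1) = 3 * x + 0" for x by simp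
    moreover have "npts {} 3 = 0" by (simp add: npts_def mult_at_def)
    ultimately show ?case by metis
  next
    case (insert l A)
    note D = arrangement_insertD[OF insert.prems(1) insert.hyps(2)]
    let ?T = "\<lambda>u v. {s. card (fibre A u v s) = 2}"
    have "mult_at A P \<le> 3" if "P \<in> P2" for P
      using insert.prems(2)[OF that] mult_at_mono[of "insert l A" A P] D(1) by fastforce
    then obtain N where N: "fdim scaleV (logder A \<inter> vforms k) N"
      "N + card A * (k + 1) = 3 * ((k + 1) * (k + 2) div 2) + npts A 3"
      using insert.IH[OF D(2)] insert.prems(3) insert.hyps by force
    obtain u v w a b where ch: "chart A l u v w a b"
      using chart_exists[OF insert.prems(1) insert.hyps(2)] by blast
    then have fr: "frame l u v w a b" by (simp add: chart_def)
    have le2: "card (fibre A u v s) \<le> 2" for s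
      using fibre_le[OF insert.prems(1) insert.hyps(2) _ ch, of 2] insert.prems(2)
      by (simp add: numeral_3_eq_3 numeral_2_eq_2)
    have cA: "card A \<le> k" using insert.prems(3) insert.hyps by simp
    have cT: "card (?T u v) \<le> k" using fibre_card[OF D(1) le2] cA by linarith
    obtain m r where mr: "fdim scaleV {\<theta> \<in> logder A \<inter> vforms k. restr u v (tang \<theta> l) = 0} m"
      "fdim smult ((\<lambda>\<theta>. restr u v (tang \<theta> l)) ` (logder A \<inter> vforms k)) r" "N = m + r"
      using rank_nullity[OF linear_restr_tang N(1)] by blast
    have "finite (?T u v)" using fibre_finite[OF D(1), of 2] by simp
    then have r: "r = k - card (?T u v) + 1"
      using mr(2) fdim_vanish[OF _ cT] fdim_unique[OF vector_space_smult]
      unfolding logder_image[OF insert.prems(1) insert.hyps(2) le2 ch cA] by blast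
    have "{\<theta> \<in> logder A \<inter> vforms k. restr u v (tang \<theta> l) = 0} = logder (insert l A) \<inter> vforms k"
    proof -
      have "restr u v (tang \<theta> l) = 0 \<longleftrightarrow> lin_form l dvd tang \<theta> l" if "\<theta> \<in> vforms k" for \<theta>
        using that restr_eq_0_iff[OF fr D(3) hom_tang[of k \<theta> l]] by (simp add: vforms_def)
      then show ?thesis unfolding logder_def by blast
    qed
    then have "fdim scaleV (logder (insert l A) \<inter> vforms k) m" using mr(1) by simp
    moreover have "m + card (insert l A) * (k + 1) = 3 * ((k + 1) * (k + 2) div 2) + npts (insert l A) 3"
      using N(2) mr(3) r cT insert.hyps
        npts_insert[OF insert.prems(1) insert.hyps(2) insert.prems(2) ch] by simp
    ultimately show ?case by blast
  qed
qed

subsection \<open>Counting incidences\<close>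

definition pts_on :: "pt3 set \<Rightarrow> nat \<Rightarrow> pt3 \<Rightarrow> nat" where
  "pts_on A k l = card {P \<in> P2. mult_at A P = k \<and> (\<forall>q\<in>P. on_line l q)}"

lemma pts_on_chart:
  assumes arrangement: "arrangement (insert l B)" "l \<notin> B" and ch: "chart B l u v w a b" and j: "j \<noteq> 0"
  shows "pts_on (insert l B) (Suc j) l = card {s. card (fibre B u v s) = j}"
proof -
  note D = arrangement_insertD[OF arrangement]
  have "{P \<in> P2. mult_at (insert l B) P = Suc j \<and> (\<forall>q\<in>P. on_line l q)} =
    {P \<in> P2. (\<forall>q\<in>P. on_line l q) \<and> mult_at B P = j}"
  proof (rule Collect_cong)
    fix P
    have "n = (if X then 1 else 0) + n' \<Longrightarrow> (Y \<and> n = Suc j \<and> X) = (Y \<and> X \<and> n' = j)" for n n' X Y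
      by auto
    from this[OF mult_at_insert[OF D(1) arrangement(2), of P]]
    show "(P \<in> P2 \<and> mult_at (insert l B) P = Suc j \<and> (\<forall>q\<in>P. on_line l q)) =
      (P \<in> P2 \<and> (\<forall>q\<in>P. on_line l q) \<and> mult_at B P = j)" .
  qed
  then show ?thesis
    using bij_betw_same_card[OF chart_points[OF ch D(1) j]] by (simp add: pts_on_def)
qed

lemma sum_pts_on:
  assumes "arrangement A" "k \<ge> 2"
  shows "(\<Sum>l\<in>A. pts_on A k l) = k * npts A k"
proof -
  have finA: "finite A" using assms(1) by (simp add: arrangement_def)
  let ?X = "{P \<in> P2. mult_at A P = k}"
  have finX: "finite ?X"
    by (rule finite_subset[OF _ finite_points[OF assms(1)]]) (use assms(2) in auto)
  have "(\<Sum>l\<in>A. pts_on A k l) = (\<Sum>l\<in>A. \<Sum>P\<in>?X. if \<forall>q\<in>P. on_line l q then 1 else 0)"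
  proof (rule sum.cong[OF refl])
    fix l
    have "{P \<in> P2. mult_at A P = k \<and> (\<forall>q\<in>P. on_line l q)} = {P \<in> ?X. \<forall>q\<in>P. on_line l q}" by blast
    then show "pts_on A k l = (\<Sum>P\<in>?X. if \<forall>q\<in>P. on_line l q then 1 else 0)"
      using finX by (simp add: pts_on_def sum.If_cases Int_def)
  qed
  also have "\<dots> = (\<Sum>P\<in>?X. \<Sum>l\<in>A. if \<forall>q\<in>P. on_line l q then 1 else 0)"
    by (rule sum.swap)
  also have "\<dots> = (\<Sum>P\<in>?X. mult_at A P)"
    using finA by (intro sum.cong refl) (simp add: mult_at_def sum.If_cases Int_def)
  also have "\<dots> = (\<Sum>P\<in>?X. k)" by (rule sum.cong) auto
  finally show ?thesis by (simp add: npts_def)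
qed

text \<open>Every other line meets l in exactly one point; a node accounts for one of them and a
  triple point for two.\<close>

lemma card_line:
  assumes arrangement: "arrangement A" and le: "\<And>P. P \<in> P2 \<Longrightarrow> mult_at A P \<le> 3" and l: "l \<in> A"
  shows "card A = 1 + pts_on A 2 l + 2 * pts_on A 3 l"
proof -
  define B where "B = A - {l}"
  have A: "A = insert l B" "l \<notin> B" using l by (auto simp: B_def)
  note arrangement' = arrangement[unfolded A(1)]
  note D = arrangement_insertD[OF arrangement' A(2)]
  obtain u v w a b where ch: "chart B l u v w a b" using chart_exists[OF arrangement' A(2)] by blast
  have le2: "card (fibre B u v s) \<le> 2" for s
    by (rule fibre_le[OF arrangement' A(2) _ ch]) (use le A(1) in \<open>simp add: numeral_3_eq_3 numeral_2_eq_2\<close>)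
  let ?Q = "meet u v ` B" and ?T1 = "{s. card (fibre B u v s) = 1}" and ?T2 = "{s. card (fibre B u v s) = 2}"
  have "?Q = ?T1 \<union> ?T2"
  proof (intro set_eqI iffI)
    fix s assume "s \<in> ?Q"
    then have "fibre B u v s \<noteq> {}" unfolding fibre_def by blast
    moreover have "finite (fibre B u v s)" using D(1) unfolding fibre_def by simp
    ultimately have "card (fibre B u v s) \<noteq> 0" by simp
    then show "s \<in> ?T1 \<union> ?T2" using le2[of s] by (simp add: le_Suc_eq numeral_2_eq_2)
  next
    fix s assume "s \<in> ?T1 \<union> ?T2"
    then have "fibre B u v s \<noteq> {}" by force
    then show "s \<in> ?Q" unfolding fibre_def by blast
  qed
  moreover have "finite ?T1" "finite ?T2" using fibre_finite[OF D(1)] by simp_all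
  ultimately have "card ?Q = card ?T1 + card ?T2" by (simp add: card_Un_disjoint disjoint_iff)
  then have "card B = card ?T1 + 2 * card ?T2" using fibre_card[OF D(1) le2] by simp
  moreover have "pts_on A 2 l = card ?T1" "pts_on A 3 l = card ?T2"
    using pts_on_chart[OF arrangement' A(2) ch, of 1] pts_on_chart[OF arrangement' A(2) ch, of 2]
    unfolding A(1) by (simp_all add: numeral_3_eq_3 numeral_2_eq_2)
  ultimately show ?thesis using D(1) A by simp
qed

lemma count_pairs:
  assumes "arrangement A" "\<And>P. P \<in> P2 \<Longrightarrow> mult_at A P \<le> 3"
  shows "card A * (card A - 1) = 2 * npts A 2 + 6 * npts A 3"
proof -
  have "(\<Sum>l\<in>A. card A - 1) = (\<Sum>l\<in>A. pts_on A 2 l + 2 * pts_on A 3 l)"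
    using card_line[OF assms] by (intro sum.cong refl) fastforce
  also have "\<dots> = 2 * npts A 2 + 6 * npts A 3"
    using sum_pts_on[OF assms(1), of 2] sum_pts_on[OF assms(1), of 3]
    by (simp add: sum.distrib flip: sum_distrib_left)
  finally show ?thesis by simp
qed

text \<open>With an even number of lines each line carries an odd number of nodes, hence at least
  one, and every node lies on two lines.\<close>

lemma even_count:
  assumes "arrangement A" "\<And>P. P \<in> P2 \<Longrightarrow> mult_at A P \<le> 3" "even (card A)"
  shows "card A \<le> 2 * npts A 2"
proof -
  have "pts_on A 2 l \<ge> 1" if "l \<in> A" for l
    using card_line[OF assms(1,2) that] assms(3) by (cases "pts_on A 2 l") auto
  then have "(\<Sum>l\<in>A. 1) \<le> (\<Sum>l\<in>A. pts_on A 2 l)" by (intro sum_mono)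
  then show ?thesis using sum_pts_on[OF assms(1), of 2] by simp
qed

lemma node_on_line:
  assumes arrangement: "arrangement A" and n: "npts A 2 \<noteq> 0"
  shows "\<exists>l m. l \<in> A \<and> m \<in> A \<and> l \<noteq> m \<and> pts_on A 2 l \<noteq> 0 \<and> pts_on A 2 m \<noteq> 0"
proof -
  have fin: "finite {P \<in> P2. mult_at A P = 2 \<and> X P}" for X
    by (rule finite_subset[OF _ finite_points[OF arrangement]]) auto
  have "{P \<in> P2. mult_at A P = 2} \<noteq> {}" using n unfolding npts_def by force
  then obtain P where P: "P \<in> P2" "mult_at A P = 2" by blast
  then obtain l m where lm: "l \<in> A" "m \<in> A" "l \<noteq> m" "\<forall>q\<in>P. on_line l q" "\<forall>q\<in>P. on_line m q"
    unfolding mult_at_def card_2_iff by blast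
  have "pts_on A 2 k \<noteq> 0" if "\<forall>q\<in>P. on_line k q" for k
  proof -
    have "P \<in> {P \<in> P2. mult_at A P = 2 \<and> (\<forall>q\<in>P. on_line k q)}" using P that by blast
    then have "{P \<in> P2. mult_at A P = 2 \<and> (\<forall>q\<in>P. on_line k q)} \<noteq> {}" by blast
    then show ?thesis
      using card_0_eq[OF fin[of "\<lambda>P. \<forall>q\<in>P. on_line k q"]] unfolding pts_on_def by blast
  qed
  then show ?thesis using lm by blast
qed

text \<open>With an odd number of lines each line carries an even number of nodes, so the two lines
  through a node carry at least two each.\<close>

lemma odd_count:
  assumes "arrangement A" "\<And>P. P \<in> P2 \<Longrightarrow> mult_at A P \<le> 3" "odd (card A)"
  shows "npts A 2 \<noteq> 1"
proof
  assume 1: "npts A 2 = 1"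
  then obtain l m where lm: "l \<in> A" "m \<in> A" "l \<noteq> m" "pts_on A 2 l \<noteq> 0" "pts_on A 2 m \<noteq> 0"
    using node_on_line[OF assms(1)] by force
  have ge2: "pts_on A 2 k \<ge> 2" if "k \<in> A" "pts_on A 2 k \<noteq> 0" for k
  proof -
    have "even (pts_on A 2 k)" using card_line[OF assms(1,2) that(1)] assms(3) by simp
    then show ?thesis using that(2) by presburger
  qed
  have "(\<Sum>k\<in>{l, m}. pts_on A 2 k) \<le> (\<Sum>k\<in>A. pts_on A 2 k)"
    using lm assms(1) by (intro sum_mono2) (simp_all add: arrangement_def)
  then show False
    using sum_pts_on[OF assms(1), of 2] 1 ge2[OF lm(1,4)] ge2[OF lm(2,5)] lm(3) by simp
qed

subsection \<open>A lower bound for the degrees of syzygies\<close>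

text \<open>The wedge E x theta of a logarithmic field with the Euler field is normal to every line of the
  arrangement along that line. Hence it vanishes at the intersection points, and if a line carries more
  of them than its degree, it is divisible by the equation of that line, which can be removed.\<close>

definition vcross :: "vec3 \<Rightarrow> pt3 \<Rightarrow> vec3" where
  "vcross W l = (case W of (p, q, r) \<Rightarrow> case l of (a, b, c) \<Rightarrow>
    (q * const3 c - r * const3 b, r * const3 a - p * const3 c, p * const3 b - q * const3 a))"

definition vdvd :: "poly3 \<Rightarrow> vec3 \<Rightarrow> bool" where
  "vdvd d W \<longleftrightarrow> (\<exists>V. W = vsmult d V)"

definition normal_along :: "pt3 set \<Rightarrow> vec3 \<Rightarrow> bool" where
  "normal_along A W \<longleftrightarrow> (\<forall>l\<in>A. vdvd (lin_form l) (vcross W l))"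

lemma vdvd_iff: "vdvd d (p, q, r) \<longleftrightarrow> d dvd p \<and> d dvd q \<and> d dvd r"
proof
  assume "vdvd d (p, q, r)"
  then obtain V where "(p, q, r) = vsmult d V" by (auto simp: vdvd_def)
  then show "d dvd p \<and> d dvd q \<and> d dvd r" by (cases V) simp
next
  assume "d dvd p \<and> d dvd q \<and> d dvd r"
  then obtain x y z where "p = d * x" "q = d * y" "r = d * z" by (elim conjE dvdE)
  then have "(p, q, r) = vsmult d (x, y, z)" by simp
  then show "vdvd d (p, q, r)" unfolding vdvd_def by blast
qed

definition evalv :: "vec3 \<Rightarrow> pt3 \<Rightarrow> pt3" where
  "evalv W x = (case W of (p, q, r) \<Rightarrow> (evalp p x, evalp q x, evalp r x))"

lemma evalv_vcross: "evalv (vcross W l) x = cross (evalv W x) l"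
  by (cases W; cases l) (simp add: evalv_def vcross_def cross_def)

lemma evalv_vsmult: "evalv (vsmult s W) x = scale3 (evalp s x) (evalv W x)"
  by (cases W) (simp add: evalv_def)

lemma parallel_both_0:
  assumes "cross x l = (0, 0, 0)" "cross x m = (0, 0, 0)" "cross l m \<noteq> (0, 0, 0)"
  shows "x = (0, 0, 0)"
proof (rule ccontr)
  assume x: "x \<noteq> (0, 0, 0)"
  have "cross l x = (0, 0, 0)" "cross m x = (0, 0, 0)" using assms(1,2) cross_anti[of l x] cross_anti[of m x] by simp_all
  then obtain s t where "l = scale3 s x" "m = scale3 t x" using parallel_if_cross_0 x by meson
  then have "cross l m = (0, 0, 0)" by (cases x) (simp add: cross_def)
  then show False using assms(3) by blast
qed

text \<open>At an intersection point on l the value of W is parallel to two different lines, hence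
  zero. More than m such points force the restriction of degree at most m to vanish.\<close>

lemma normal_step:
  assumes arrangement: "arrangement (insert l B)" "l \<notin> B" and ch: "chart B l u v w a b"
    and W: "W \<in> vforms m" "normal_along (insert l B) W" and card: "card (meet u v ` B) > m"
  shows "vdvd (lin_form l) W"
proof -
  note D = arrangement_insertD[OF arrangement]
  have fr: "frame l u v w a b" using ch by (simp add: chart_def)
  have van: "evalv W (u + scale3 s v) = (0, 0, 0)" if s: "s \<in> meet u v ` B" for s
  proof -
    let ?p = "u + scale3 s v"
    obtain n where n: "n \<in> B" "meet u v n = s" using s by blast
    have "dot n ?p = 0" using n ch meet_iff unfolding chart_def by blast
    moreover have "dot l ?p = 0" using fr by (simp add: frame_def dot_simps)
    moreover have "cross (evalv W ?p) k = (0, 0, 0)" if k: "k \<in> insert l B" "dot k ?p = 0" for k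
    proof -
      obtain V where V: "vcross W k = vsmult (lin_form k) V"
        using W(2) k(1) unfolding normal_along_def vdvd_def by blast
      show ?thesis unfolding evalv_vcross[symmetric] V evalv_vsmult using k(2) by simp
    qed
    ultimately have "cross (evalv W ?p) l = (0, 0, 0)" "cross (evalv W ?p) n = (0, 0, 0)" using n(1) by simp_all
    moreover have "cross l n \<noteq> (0, 0, 0)" using D(4)[OF n(1)] D(3) proportional_iff_cross[of l n] by blast
    ultimately show ?thesis by (rule parallel_both_0)
  qed
  obtain p q r where We: "W = (p, q, r)" by (cases W)
  have hom: "homogeneous m p" "homogeneous m q" "homogeneous m r"
    using W(1) by (simp_all add: We vforms_def homog_vec_def)
  have key: "restr u v f = 0" if f: "homogeneous m f" "\<And>s. s \<in> meet u v ` B \<Longrightarrow> evalp f (u + scale3 s v) = 0" for f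
  proof (rule ccontr)
    assume nz: "restr u v f \<noteq> 0"
    have "meet u v ` B \<subseteq> {s. poly (restr u v f) s = 0}" using f(2) by (auto simp: poly_restr)
    then have "card (meet u v ` B) \<le> card {s. poly (restr u v f) s = 0}"
      using poly_roots_finite[OF nz] by (intro card_mono)
    also have "\<dots> \<le> degree (restr u v f)" using card_poly_roots_bound[OF nz] .
    also have "\<dots> \<le> m" using restr_degree[OF f(1)] .
    finally show False using card by simp
  qed
  have vp: "evalp p (u + scale3 s v) = 0" "evalp q (u + scale3 s v) = 0" "evalp r (u + scale3 s v) = 0"
    if "s \<in> meet u v ` B" for s
    using van[OF that] by (simp_all add: We evalv_def)
  have "restr u v p = 0" "restr u v q = 0" "restr u v r = 0"
    by (rule key[OF hom(1) vp(1)] key[OF hom(2) vp(2)] key[OF hom(3) vp(3)]; assumption)+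
  then show ?thesis
    unfolding We vdvd_iff using hom by (simp add: restr_eq_0_iff[OF fr D(3)])
qed

text \<open>Another line k is a prime not dividing l, so normality along k survives the division by
  l. Degree 0 is impossible since W is nonzero.\<close>

lemma normal_reduce:
  assumes arrangement: "arrangement (insert l B)" "l \<notin> B"
    and W: "W \<in> vforms m" "normal_along (insert l B) W" "vdvd (lin_form l) W" "W \<noteq> 0"
  shows "\<exists>n V. m = Suc n \<and> V \<in> vforms n \<and> normal_along B V \<and> V \<noteq> 0"
proof -
  note D = arrangement_insertD[OF arrangement]
  obtain p q r where V: "W = vsmult (lin_form l) (p, q, r)"
    using W(3) unfolding vdvd_def by (metis prod_cases3)
  have hom: "homogeneous m (p * lin_form l)" "homogeneous m (q * lin_form l)" "homogeneous m (r * lin_form l)"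
    using W(1) by (simp_all add: V vforms_def homog_vec_def mult.commute)
  note nz = lin_form_nz[OF D(3)]
  have Vnz: "(p, q, r) \<noteq> 0" using W(4) by (auto simp: V zero_prod_def)
  obtain n where m: "m = Suc n"
  proof (cases m)
    case 0
    then have "p = 0" "q = 0" "r = 0"
      using hom hom_cancel_0[OF _ hom_lin_form nz, of 0] by simp_all
    then show ?thesis using Vnz by (simp add: zero_prod_def)
  qed
  have "(p, q, r) \<in> vforms n"
    using hom hom_cancel[OF _ hom_lin_form nz, of n] by (simp add: m vforms_def homog_vec_def)
  moreover have "normal_along B (p, q, r)"
    unfolding normal_along_def
  proof
    fix k assume k: "k \<in> B"
    have k0: "k \<noteq> (0, 0, 0)" "\<not> lin_form k dvd lin_form l"
      using D(4)[OF k] D(3) lin_form_dvd_lin_form[of k l] proportional_sym[of k l] by blast+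
    have "vcross W k = vsmult (lin_form l) (vcross (p, q, r) k)"
      by (cases k) (simp add: V vcross_def algebra_simps)
    moreover have "vdvd (lin_form k) (vcross W k)" using W(2) k by (simp add: normal_along_def)
    ultimately have "vdvd (lin_form k) (vsmult (lin_form l) (vcross (p, q, r) k))" by simp
    then show "vdvd (lin_form k) (vcross (p, q, r) k)"
      using lin_form_prime[OF k0(1)] k0(2)
      by (cases "vcross (p, q, r) k") (simp add: vdvd_iff, blast)
  qed
  ultimately show ?thesis using m Vnz by blast
qed

text \<open>Each point of l lies on at most \<open>\<mu>\<close> other lines, so l carries more than
  m points and \<open>normal_step\<close> applies to any l. Dividing lowers m by one and removes one
  line, which preserves the inequality because \<open>\<mu>\<close> is at least 1.\<close>

lemma normal_zero:
  assumes "arrangement A" "\<And>P. P \<in> P2 \<Longrightarrow> mult_at A P \<le> Suc \<mu>" "\<mu> \<ge> 1" "W \<in> vforms m" "normal_along A W"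
    "\<mu> * m + 2 \<le> card A"
  shows "W = 0"
  using assms
proof (induction m arbitrary: A W rule: less_induct)
  case (less m)
  show ?case
  proof (rule ccontr)
    assume nz: "W \<noteq> 0"
    have "A \<noteq> {}" using less.prems(6) by force
    then obtain l where l: "l \<in> A" by blast
    define B where "B = A - {l}"
    have A: "A = insert l B" "l \<notin> B" using l by (auto simp: B_def)
    note arrangement' = less.prems(1)[unfolded A(1)]
    note D = arrangement_insertD[OF arrangement' A(2)]
    have cB: "card A = Suc (card B)" using D(1) A by simp
    obtain u v w a b where ch: "chart B l u v w a b" using chart_exists[OF arrangement' A(2)] by blast
    have le: "card (fibre B u v s) \<le> \<mu>" for s
      by (rule fibre_le[OF arrangement' A(2) _ ch]) (use less.prems(2) A(1) in simp)
    have "card B \<le> (\<Sum>s\<in>meet u v ` B. \<mu>)"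
      unfolding fibre_sum[OF D(1), of u v] using le by (rule sum_mono)
    then have "card B \<le> \<mu> * card (meet u v ` B)" by (simp add: mult.commute)
    then have "\<mu> * m < \<mu> * card (meet u v ` B)" using less.prems(6) cB by linarith
    then have "m < card (meet u v ` B)" by simp
    then have "vdvd (lin_form l) W"
      using normal_step[OF arrangement' A(2) ch less.prems(4)] less.prems(5) A(1) by simp
    then obtain n V where n: "m = Suc n" "V \<in> vforms n" "normal_along B V" "V \<noteq> 0"
      using normal_reduce[OF arrangement' A(2) less.prems(4)] less.prems(5) A(1) nz by metis
    have "mult_at B P \<le> Suc \<mu>" if "P \<in> P2" for P
      using less.prems(2)[OF that] mult_at_mono[of A B P] D(1) A(1) by fastforce
    then have "V = 0"
      using less.IH[of n B V] n less.prems(3,6) D(2) cB by simp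
    then show False using n(4) by blast
  qed
qed

text \<open>One line short of \<open>normal_zero\<close> for multiplicity 3. A line through a node
  still carries more than m points, as the 2 m other lines cannot all be paired up; after one
  division the inequality of \<open>normal_zero\<close> holds again.\<close>

lemma normal_zero_node:
  assumes arrangement: "arrangement A" and le: "\<And>P. P \<in> P2 \<Longrightarrow> mult_at A P \<le> 3" and W: "W \<in> vforms m" "normal_along A W"
    and card: "card A = 2 * m + 1" and node: "npts A 2 \<noteq> 0"
  shows "W = 0"
proof (rule ccontr)
  assume nz: "W \<noteq> 0"
  obtain l where l: "l \<in> A" "pts_on A 2 l \<noteq> 0" using node_on_line[OF arrangement node] by blast
  define B where "B = A - {l}"
  have A: "A = insert l B" "l \<notin> B" using l by (auto simp: B_def)
  note arrangement' = arrangement[unfolded A(1)]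
  note D = arrangement_insertD[OF arrangement' A(2)]
  have cB: "card A = Suc (card B)" using D(1) A by simp
  obtain u v w a b where ch: "chart B l u v w a b" using chart_exists[OF arrangement' A(2)] by blast
  have le2: "card (fibre B u v s) \<le> 2" for s
    by (rule fibre_le[OF arrangement' A(2) _ ch]) (use le A(1) in \<open>simp add: numeral_3_eq_3 numeral_2_eq_2\<close>)
  have "card A = 1 + pts_on A 2 l + 2 * pts_on A 3 l" using card_line[OF arrangement le l(1)] .
  moreover have "pts_on A 3 l = card {s. card (fibre B u v s) = 2}"
    using pts_on_chart[OF arrangement' A(2) ch, of 2] unfolding A(1) by (simp add: numeral_3_eq_3 numeral_2_eq_2)
  ultimately have "m < card (meet u v ` B)"
    using fibre_card[OF D(1) le2] l(2) cB card by linarith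
  then have "vdvd (lin_form l) W"
    using normal_step[OF arrangement' A(2) ch W(1)] W(2) A(1) by simp
  then obtain n V where n: "m = Suc n" "V \<in> vforms n" "normal_along B V" "V \<noteq> 0"
    using normal_reduce[OF arrangement' A(2) W(1)] W(2) A(1) nz by metis
  have "mult_at B P \<le> Suc 2" if "P \<in> P2" for P
    using le[OF that] mult_at_mono[of A B P] D(1) A(1) by fastforce
  then have "V = 0"
    using normal_zero[OF D(2) _ _ n(2,3), of 2] n(1) card cB by simp
  then show False using n(4) by blast
qed

definition wedge :: "vec3 \<Rightarrow> vec3" where
  "wedge \<theta> = (case \<theta> of (p, q, r) \<Rightarrow>
    (varY * r - varZ * q, varZ * p - varX * r, varX * q - varY * p))"

text \<open>The double cross product (E x \<theta>) x l equals l(E) \<theta> - \<theta>(l) E, and l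
  divides both l(E) = l and \<theta>(l).\<close>

lemma wedge_normal:
  assumes "\<theta> \<in> logder A"
  shows "normal_along A (wedge \<theta>)"
  unfolding normal_along_def
proof
  fix l assume l: "l \<in> A"
  obtain p q r where \<theta>: "\<theta> = (p, q, r)" by (cases \<theta>)
  obtain a b c where le: "l = (a, b, c)" by (cases l)
  obtain k where k: "tang \<theta> l = lin_form l * k" using assms l unfolding logder_def by (blast elim: dvdE)
  have "vcross (wedge \<theta>) l = (p * lin_form l - varX * tang \<theta> l, q * lin_form l - varY * tang \<theta> l,
      r * lin_form l - varZ * tang \<theta> l)"
    by (simp add: \<theta> le vcross_def wedge_def lin_form_def tang_def algebra_simps)
  then show "vdvd (lin_form l) (vcross (wedge \<theta>) l)"
    unfolding k by (simp add: vdvd_iff)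
qed

lemma wedge_vforms:
  assumes "\<theta> \<in> vforms k"
  shows "wedge \<theta> \<in> vforms (Suc k)"
proof -
  obtain p q r where \<theta>: "\<theta> = (p, q, r)" by (cases \<theta>)
  have h: "homogeneous (Suc k) (x * s)" if "homogeneous (Suc 0) x" "homogeneous k s" for x s
    using hom_mult[OF that] by simp
  show ?thesis
    using assms unfolding \<theta> wedge_def vforms_def homog_vec_def mem_Collect_eq prod.case
    by (intro conjI hom_diff h hom_var) simp_all
qed

text \<open>If \<theta> is parallel to E, then p E(f) = x \<theta>(f) = 0 for its first entry p, and
  similarly for the others; but E(f) is a nonzero multiple of f.\<close>

lemma wedge_nz:
  assumes "arrangement A" "A \<noteq> {}" "\<theta> \<in> AR (defpoly A)" "\<theta> \<noteq> 0"
  shows "wedge \<theta> \<noteq> 0"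
proof
  assume w: "wedge \<theta> = 0"
  obtain p q r where \<theta>: "\<theta> = (p, q, r)" by (cases \<theta>)
  have fin: "finite A" using assms(1) by (simp add: arrangement_def)
  let ?f = "defpoly A"
  have w': "varY * r = varZ * q" "varZ * p = varX * r" "varX * q = varY * p"
    using w by (simp_all add: \<theta> wedge_def zero_prod_def)
  have th: "p * dx ?f + q * dy ?f + r * dz ?f = 0"
    using assms(3) by (simp add: AR_app app_def \<theta>)
  have e: "varX * dx ?f + varY * dy ?f + varZ * dz ?f = of_nat (card A) * ?f"
    using app_eul[OF fin] by (simp add: app_def eul_def)
  have nz: "of_nat (card A) * ?f \<noteq> 0"
    using assms(1,2) defpoly_nz[OF assms(1)] fin const3_of_nat[of "card A"] const3_eq_0_iff[of "of_nat (card A)"]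
    by simp
  have "p * (varX * dx ?f + varY * dy ?f + varZ * dz ?f) = varX * (p * dx ?f + q * dy ?f + r * dz ?f)"
    using w' by (simp add: ring_distribs mult_ac) (simp add: w' mult.left_commute mult.assoc[symmetric])
  then have "p = 0" using th e nz by simp
  have "q * (varX * dx ?f + varY * dy ?f + varZ * dz ?f) = varY * (p * dx ?f + q * dy ?f + r * dz ?f)"
    using w' by (simp add: ring_distribs mult_ac) (simp add: w' mult.left_commute mult.assoc[symmetric])
  then have "q = 0" using th e nz by simp
  have "r * (varX * dx ?f + varY * dy ?f + varZ * dz ?f) = varZ * (p * dx ?f + q * dy ?f + r * dz ?f)"
    using w' by (simp add: ring_distribs mult_ac) (simp add: w' mult.left_commute mult.assoc[symmetric])
  then have "r = 0" using th e nz by simp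
  show False using assms(4) \<open>p = 0\<close> \<open>q = 0\<close> \<open>r = 0\<close> by (simp add: \<theta> zero_prod_def)
qed

text \<open>The wedge has degree r + 1. The thresholds come from \<open>normal_zero\<close> with
  \<open>\<mu>\<close> equal to 2, from its sharpening in the presence of a node, and from
  \<open>\<mu>\<close> equal to 1 if there are no triple points.\<close>

lemma syzygy_degree_bounds:
  assumes arrangement: "arrangement A" "A \<noteq> {}" and le: "\<And>P. P \<in> P2 \<Longrightarrow> mult_at A P \<le> 3"
    and \<theta>: "\<theta> \<in> AR (defpoly A)" "\<theta> \<in> vforms r" "\<theta> \<noteq> 0"
  shows "card A < 2 * r + 4" "npts A 2 \<noteq> 0 \<Longrightarrow> card A \<noteq> 2 * r + 3" "npts A 3 = 0 \<Longrightarrow> card A < r + 3"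
proof -
  have W: "wedge \<theta> \<in> vforms (Suc r)" "normal_along A (wedge \<theta>)" "wedge \<theta> \<noteq> 0"
    using wedge_vforms[OF \<theta>(2)] wedge_normal AR_subset_logder[OF arrangement(1)] \<theta>(1) wedge_nz[OF arrangement \<theta>(1,3)] by blast+
  have le': "mult_at A P \<le> Suc 2" if "P \<in> P2" for P using le[OF that] by simp
  show "card A < 2 * r + 4"
    using normal_zero[OF arrangement(1) le' _ W(1,2)] W(3) by force
  show "card A \<noteq> 2 * r + 3" if "npts A 2 \<noteq> 0"
    using normal_zero_node[OF arrangement(1) le W(1,2) _ that] W(3) by force
  show "card A < r + 3" if n: "npts A 3 = 0"
  proof -
    have "finite {P \<in> P2. mult_at A P = 3}"
      by (rule finite_subset[OF _ finite_points[OF arrangement(1)]]) auto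
    then have "{P \<in> P2. mult_at A P = 3} = {}" using n unfolding npts_def by simp
    then have "mult_at A P \<noteq> 3" if "P \<in> P2" for P using that by blast
    then have "mult_at A P \<le> Suc 1" if "P \<in> P2" for P using le[OF that] that by (metis One_nat_def le_SucE numeral_3_eq_3)
    then show ?thesis using normal_zero[OF arrangement(1) _ _ W(1,2), of 1] W(3) by force
  qed
qed

subsection \<open>Syzygies\<close>

lemma AR_simps:
  "\<theta> \<in> AR f \<Longrightarrow> \<eta> \<in> AR f \<Longrightarrow> \<theta> + \<eta> \<in> AR f" "\<theta> \<in> AR f \<Longrightarrow> \<eta> \<in> AR f \<Longrightarrow> \<theta> - \<eta> \<in> AR f"
  "\<theta> \<in> AR f \<Longrightarrow> vsmult s \<theta> \<in> AR f"
  by (simp_all add: AR_app)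

lemma vsmult_algebra:
  "vsmult s (\<theta> + \<eta>) = vsmult s \<theta> + vsmult s \<eta>" "vsmult (s + t) \<theta> = vsmult s \<theta> + vsmult t \<theta>"
  "vsmult (s - t) \<theta> = vsmult s \<theta> - vsmult t \<theta>" "vsmult s (\<theta> - \<eta>) = vsmult s \<theta> - vsmult s \<eta>"
  "vsmult s (vsmult t \<theta>) = vsmult (s * t) \<theta>" "vsmult 0 \<theta> = 0" "vsmult 1 \<theta> = \<theta>" "vsmult s 0 = 0"
  "vsmult (- s) \<theta> = - vsmult s \<theta>"
  by (cases \<theta>; cases \<eta>; simp add: zero_prod_def algebra_simps)+

lemma vsmult_cancel: "s \<noteq> 0 \<Longrightarrow> vsmult s \<theta> = vsmult s \<eta> \<longleftrightarrow> \<theta> = \<eta>"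
  by (cases \<theta>; cases \<eta>) (simp add: poly3_cancel_left)

lemma span3_two: "span3 [g, h] = {vsmult a g + vsmult b h | a b. True}"
proof -
  have e: "(\<Sum>i<length [g, h]. vsmult (c i) ([g, h] ! i)) = vsmult (c 0) g + vsmult (c 1) h" for c
    by (simp add: numeral_2_eq_2)
  show ?thesis unfolding span3_def e
  proof (intro set_eqI iffI)
    fix x assume "x \<in> {vsmult a g + vsmult b h | a b. True}"
    then obtain a b where "x = vsmult a g + vsmult b h" by blast
    then show "x \<in> {vsmult (c (0::nat)) g + vsmult (c 1) h | c. True}"
      by (intro CollectI exI[of _ "\<lambda>i. if i = 0 then a else b"]) simp
  qed blast
qed

lemma span3_three: "span3 [g, h, k] = {vsmult a g + vsmult b h + vsmult c k | a b c. True}"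
proof -
  have e: "(\<Sum>i<length [g, h, k]. vsmult (c i) ([g, h, k] ! i)) = vsmult (c 0) g + vsmult (c 1) h + vsmult (c 2) k" for c
    by (simp add: numeral_2_eq_2)
  show ?thesis unfolding span3_def e
  proof (intro set_eqI iffI)
    fix x assume "x \<in> {vsmult a g + vsmult b h + vsmult c k | a b c. True}"
    then obtain a b c where "x = vsmult a g + vsmult b h + vsmult c k" by blast
    then show "x \<in> {vsmult (c (0::nat)) g + vsmult (c 1) h + vsmult (c 2) k | c. True}"
      by (intro CollectI exI[of _ "\<lambda>i. if i = 0 then a else if i = 1 then b else c"]) simp
  qed blast
qed

lemma linear_app: "Vector_Spaces.linear scaleV scaleP (\<lambda>\<theta>. app \<theta> f)"
  by (simp add: Vector_Spaces.linear_iff vector_space_scaleV vector_space_scaleP scaleV_vsmult scaleP_def)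

lemma of_nat_const3: "of_nat n = const3 (of_nat n)"
  by (simp add: const3_of_nat)

lemma app_logder:
  assumes arrangement: "arrangement A" and \<theta>: "\<theta> \<in> logder A" "\<theta> \<in> vforms (Suc k)"
  shows "\<exists>q. homogeneous k q \<and> app \<theta> (defpoly A) = q * defpoly A"
proof -
  have fin: "finite A" using arrangement by (simp add: arrangement_def)
  have "\<forall>l\<in>A. \<exists>c. tang \<theta> l = c * lin_form l"
    using \<theta>(1) unfolding logder_def by (metis (mono_tags, lifting) mem_Collect_eq dvdE mult.commute)
  then obtain c where c: "\<forall>l\<in>A. tang \<theta> l = c l * lin_form l" by metis
  have "homogeneous k (c l)" if l: "l \<in> A" for l
  proof (rule hom_cancel[OF _ hom_lin_form])
    have "homogeneous (Suc k) (tang \<theta> l)" using \<theta>(2) by (intro hom_tang) (simp add: vforms_def)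
    then show "homogeneous (k + Suc 0) (c l * lin_form l)" using c l by simp
    show "lin_form l \<noteq> 0" using l arrangement unfolding arrangement_def by (intro lin_form_nz) metis
  qed
  then have "homogeneous k (\<Sum>l\<in>A. c l)" by blast
  moreover have "app \<theta> (defpoly A) = (\<Sum>l\<in>A. c l) * defpoly A" using c by (intro app_defpoly[OF fin]) blast
  ultimately show ?thesis by blast
qed

text \<open>Applying fields to f maps the logarithmic fields onto the multiples of f, since
  multiples of E are available, and the kernel is AR(f). In effect D(A) is the sum of AR(f) and S
  E.\<close>

lemma fdim_AR:
  assumes arrangement: "arrangement A" "A \<noteq> {}" and N: "fdim scaleV (logder A \<inter> vforms (Suc k)) N"
  shows "\<exists>M. fdim scaleV (AR (defpoly A) \<inter> vforms (Suc k)) M \<and> N = M + (k + 1) * (k + 2) div 2"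
proof -
  have fin: "finite A" using arrangement(1) by (simp add: arrangement_def)
  let ?f = "defpoly A"
  have d0: "(of_nat (card A) :: complex) \<noteq> 0" using fin arrangement(2) by simp
  obtain m r where mr: "fdim scaleV {\<theta> \<in> logder A \<inter> vforms (Suc k). app \<theta> ?f = 0} m"
    "fdim scaleP ((\<lambda>\<theta>. app \<theta> ?f) ` (logder A \<inter> vforms (Suc k))) r" "N = m + r"
    using rank_nullity[OF linear_app N] by blast
  have "{\<theta> \<in> logder A \<inter> vforms (Suc k). app \<theta> ?f = 0} = AR ?f \<inter> vforms (Suc k)"
    using AR_subset_logder[OF arrangement(1)] unfolding AR_app by blast
  moreover have "(\<lambda>\<theta>. app \<theta> ?f) ` (logder A \<inter> vforms (Suc k)) = (\<lambda>q. q * ?f) ` forms k" (is "?L = ?R")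
  proof
    show "?L \<subseteq> ?R"
    proof
      fix x assume "x \<in> ?L"
      then obtain \<theta> where \<theta>: "\<theta> \<in> logder A" "\<theta> \<in> vforms (Suc k)" "x = app \<theta> ?f" by blast
      obtain q where "homogeneous k q" "app \<theta> ?f = q * ?f" using app_logder[OF arrangement(1) \<theta>(1,2)] by blast
      then show "x \<in> ?R" unfolding \<theta>(3) forms_def by blast
    qed
    show "?R \<subseteq> ?L"
    proof
      fix x assume "x \<in> ?R"
      then obtain q where q: "homogeneous k q" "x = q * ?f" unfolding forms_def by blast
      let ?\<theta> = "vsmult (const3 (1 / of_nat (card A)) * q) eul"
      have "app ?\<theta> ?f = const3 (1 / of_nat (card A) * of_nat (card A)) * q * ?f"
        by (simp only: app_simps app_eul[OF fin] of_nat_const3 const3_mult mult_ac)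
      then have "app ?\<theta> ?f = x" using d0 q(2) by simp
      moreover have "?\<theta> \<in> vforms (k + Suc 0)"
        by (intro vforms_simps(4) hom_const_mult q(1)) (simp add: eul_def vforms_def homog_vec_def)
      then have "?\<theta> \<in> vforms (Suc k)" by simp
      moreover have "?\<theta> \<in> logder A" by (simp add: logder_def)
      ultimately show "x \<in> ?L" by blast
    qed
  qed
  moreover have "fdim scaleP ((\<lambda>q. q * ?f) ` forms k) ((k + 1) * (k + 2) div 2)"
  proof (rule fdim_inj_image[OF _ fdim_forms])
    show "Vector_Spaces.linear scaleP scaleP (\<lambda>q. q * ?f)"
      by (simp add: Vector_Spaces.linear_iff vector_space_scaleP scaleP_def ring_distribs mult_ac)
  qed (use defpoly_nz[OF arrangement(1)] in simp)
  ultimately show ?thesis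
    using mr fdim_unique[OF vector_space_scaleP] by metis
qed

section \<open>Saito determinants, Cramer's rule and dependent syzygies\<close>

definition vdet :: "vec3 \<Rightarrow> vec3 \<Rightarrow> vec3 \<Rightarrow> poly3" where
  "vdet \<alpha> \<beta> \<gamma> = (case \<alpha> of (a1, a2, a3) \<Rightarrow> case \<beta> of (b1, b2, b3) \<Rightarrow> case \<gamma> of (c1, c2, c3) \<Rightarrow>
    a1 * (b2 * c3 - b3 * c2) - a2 * (b1 * c3 - b3 * c1) + a3 * (b1 * c2 - b2 * c1))"

lemma cramer:
  "vsmult (vdet \<alpha> \<beta> \<gamma>) \<theta> = vsmult (vdet \<theta> \<beta> \<gamma>) \<alpha> + vsmult (vdet \<alpha> \<theta> \<gamma>) \<beta> + vsmult (vdet \<alpha> \<beta> \<theta>) \<gamma>"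
  by (cases \<alpha>; cases \<beta>; cases \<gamma>; cases \<theta>) (simp add: vdet_def algebra_simps)

lemma det_zero:
  fixes a b c :: complex
  assumes "a * x1 + b * y1 + c * z1 = 0" "a * x2 + b * y2 + c * z2 = 0" "a * x3 + b * y3 + c * z3 = 0"
    and "(a, b, c) \<noteq> (0, 0, 0)"
  shows "x1 * (y2 * z3 - z2 * y3) - y1 * (x2 * z3 - z2 * x3) + z1 * (x2 * y3 - y2 * x3) = 0" (is "?D = 0")
proof -
  have "a * ?D = (a * x1 + b * y1 + c * z1) * (y2 * z3 - z2 * y3) - (a * x2 + b * y2 + c * z2) * (y1 * z3 - z1 * y3)
      + (a * x3 + b * y3 + c * z3) * (y1 * z2 - z1 * y2)"
    by (simp add: algebra_simps)
  moreover have "b * ?D = - (a * x1 + b * y1 + c * z1) * (x2 * z3 - z2 * x3) + (a * x2 + b * y2 + c * z2) * (x1 * z3 - z1 * x3)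
      - (a * x3 + b * y3 + c * z3) * (x1 * z2 - z1 * x2)"
    by (simp add: algebra_simps)
  moreover have "c * ?D = (a * x1 + b * y1 + c * z1) * (x2 * y3 - y2 * x3) - (a * x2 + b * y2 + c * z2) * (x1 * y3 - y1 * x3)
      + (a * x3 + b * y3 + c * z3) * (x1 * y2 - y1 * x2)"
    by (simp add: algebra_simps)
  ultimately show ?thesis using assms by auto
qed

text \<open>At a point of a line l the three values are annihilated by l, hence linearly dependent;
  so each linear form divides the determinant.\<close>

lemma saito:
  assumes "arrangement A" "\<alpha> \<in> logder A" "\<beta> \<in> logder A" "\<gamma> \<in> logder A"
  shows "defpoly A dvd vdet \<alpha> \<beta> \<gamma>"
proof (rule defpoly_dvd[OF assms(1)])
  fix l assume l: "l \<in> A"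
  then have l0: "l \<noteq> (0, 0, 0)" using assms(1) unfolding arrangement_def by blast
  obtain a b c where le: "l = (a, b, c)" by (cases l)
  obtain a1 a2 a3 b1 b2 b3 c1 c2 c3 where e: "\<alpha> = (a1, a2, a3)" "\<beta> = (b1, b2, b3)" "\<gamma> = (c1, c2, c3)"
    by (cases \<alpha>; cases \<beta>; cases \<gamma>)
  have t: "evalp (tang \<theta> l) x = 0" if "\<theta> \<in> logder A" "dot l x = 0" for \<theta> x
    using that l lin_form_dvd_iff[OF l0] unfolding logder_def by blast
  show "lin_form l dvd vdet \<alpha> \<beta> \<gamma>"
    unfolding lin_form_dvd_iff[OF l0]
  proof (intro allI impI)
    fix x assume x: "dot l x = 0"
    have "a * evalp a1 x + b * evalp a2 x + c * evalp a3 x = 0" "a * evalp b1 x + b * evalp b2 x + c * evalp b3 x = 0"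
      "a * evalp c1 x + b * evalp c2 x + c * evalp c3 x = 0"
      using t[OF assms(2) x] t[OF assms(3) x] t[OF assms(4) x] by (simp_all add: e le tang_def)
    from det_zero[OF this l0[unfolded le]]
    show "evalp (vdet \<alpha> \<beta> \<gamma>) x = 0" by (simp add: e vdet_def mult.commute)
  qed
qed

lemma hom_vdet:
  assumes "\<alpha> \<in> vforms i" "\<beta> \<in> vforms j" "\<gamma> \<in> vforms k"
  shows "homogeneous (i + j + k) (vdet \<alpha> \<beta> \<gamma>)"
proof -
  obtain a1 a2 a3 b1 b2 b3 c1 c2 c3 where e: "\<alpha> = (a1, a2, a3)" "\<beta> = (b1, b2, b3)" "\<gamma> = (c1, c2, c3)"
    by (cases \<alpha>; cases \<beta>; cases \<gamma>)
  have m: "homogeneous (i + j + k) (x * (y * z - y' * z'))"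
    if "homogeneous i x" "homogeneous j y" "homogeneous k z" "homogeneous j y'" "homogeneous k z'" for x y z y' z'
    using hom_mult[OF that(1) hom_diff[OF hom_mult[OF that(2,3)] hom_mult[OF that(4,5)]]] by (simp add: add.assoc)
  show ?thesis
    using assms unfolding e vdet_def vforms_def homog_vec_def mem_Collect_eq prod.case
    by (intro hom_add hom_diff m) simp_all
qed

lemma linear_form_exists:
  assumes "homogeneous (Suc 0) p"
  shows "\<exists>l. p = lin_form l"
proof -
  let ?c = "Poly_Mapping.lookup p"
  have "p = Poly_Mapping.single (1, 0, 0) (?c (1, 0, 0)) + Poly_Mapping.single (0, 1, 0) (?c (0, 1, 0)) +
      Poly_Mapping.single (0, 0, 1) (?c (0, 0, 1))"
  proof (rule poly_mapping_eqI)
    fix m :: mono3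
    obtain i j k where m: "m = (i, j, k)" by (cases m)
    have "?c m = 0" if "i + j + k \<noteq> 1"
    proof (rule ccontr)
      assume "?c m \<noteq> 0"
      then have "m \<in> Poly_Mapping.keys p" by (simp add: in_keys_iff)
      then have "mdeg m = Suc 0" using assms unfolding homogeneous_def by blast
      then show False using that by (simp add: m mdeg_def)
    qed
    moreover have "i + j + k = 1 \<longleftrightarrow> m = (1, 0, 0) \<or> m = (0, 1, 0) \<or> m = (0, 0, 1)"
      by (auto simp: m)
    ultimately show "?c m = Poly_Mapping.lookup (Poly_Mapping.single (1, 0, 0) (?c (1, 0, 0)) +
        Poly_Mapping.single (0, 1, 0) (?c (0, 1, 0)) + Poly_Mapping.single (0, 0, 1) (?c (0, 0, 1))) m"
      by (cases "i + j + k = 1") (auto simp: lookup_add lookup_single when_def m)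
  qed
  also have "\<dots> = lin_form (?c (1, 0, 0), ?c (0, 1, 0), ?c (0, 0, 1))"
    by (simp add: lin_form_def monomial_eq)
  finally show ?thesis by blast
qed

text \<open>Cancelling the gcd of the first entries leaves coprime a and b, and a q = p b then
  forces a to divide p. Hence the two vectors are multiples of one common vector.\<close>

lemma gcd_parallel:
  fixes p1 p2 p3 q1 q2 q3 :: "'a::ring_gcd"
  assumes "p1 \<noteq> 0" "p1 * q2 = p2 * q1" "p1 * q3 = p3 * q1"
  shows "\<exists>a b u1 u2 u3. p1 = a * u1 \<and> p2 = a * u2 \<and> p3 = a * u3 \<and> q1 = b * u1 \<and> q2 = b * u2 \<and> q3 = b * u3"
proof -
  define g where "g = gcd p1 q1"
  have g0: "g \<noteq> 0" using assms(1) by (simp add: g_def)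
  obtain a b where ab: "p1 = a * g" "q1 = b * g" "coprime a b"
    using gcd_coprime_exists[of p1 q1] g0 unfolding g_def by blast
  have a0: "a \<noteq> 0" using assms(1) ab(1) by auto
  have *: "\<exists>u. p = a * u \<and> q = b * u" if "p1 * q = p * q1" for p q
  proof -
    have "(a * q) * g = (p * b) * g" using that unfolding ab(1,2) by (simp add: mult_ac)
    then have e: "a * q = p * b" using g0 by simp
    then have "a dvd p * b" by (metis dvd_triv_left)
    then have "a dvd p" using ab(3) coprime_dvd_mult_left_iff by blast
    then obtain u where u: "p = a * u" by blast
    have "a * q = a * (b * u)" using e unfolding u by (simp add: mult_ac)
    then show ?thesis using u a0 by auto
  qed
  obtain u2 where "p2 = a * u2 \<and> q2 = b * u2" using *[OF assms(2)] by blast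
  moreover obtain u3 where "p3 = a * u3 \<and> q3 = b * u3" using *[OF assms(3)] by blast
  ultimately show ?thesis using ab(1,2) by blast
qed

lemma poly3_parallel:
  fixes p1 p2 p3 q1 q2 q3 :: poly3
  assumes "p1 \<noteq> 0" "p1 * q2 = p2 * q1" "p1 * q3 = p3 * q1"
  shows "\<exists>a b u1 u2 u3. p1 = a * u1 \<and> p2 = a * u2 \<and> p3 = a * u3 \<and> q1 = b * u1 \<and> q2 = b * u2 \<and> q3 = b * u3"
proof -
  have n: "nested p1 \<noteq> 0" using assms(1) by (simp add: nested_eq_0_iff)
  have m: "nested p1 * nested q2 = nested p2 * nested q1" "nested p1 * nested q3 = nested p3 * nested q1"
    using assms(2,3) by (simp_all flip: nested_hom(2))
  obtain a b u1 u2 u3 where *: "nested p1 = a * u1" "nested p2 = a * u2" "nested p3 = a * u3"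
    "nested q1 = b * u1" "nested q2 = b * u2" "nested q3 = b * u3"
    using gcd_parallel[OF n m] by blast
  obtain a' where a': "nested a' = a" using nested_surj by blast
  obtain b' where b': "nested b' = b" using nested_surj by blast
  obtain v1 where v1: "nested v1 = u1" using nested_surj by blast
  obtain v2 where v2: "nested v2 = u2" using nested_surj by blast
  obtain v3 where v3: "nested v3 = u3" using nested_surj by blast
  have "p1 = a' * v1 \<and> p2 = a' * v2 \<and> p3 = a' * v3 \<and> q1 = b' * v1 \<and> q2 = b' * v2 \<and> q3 = b' * v3"
    using * a' b' v1 v2 v3 by (simp flip: nested_inj)
  then show ?thesis by blast
qed

lemma vec_parallel:
  assumes "\<theta> \<noteq> 0"
    and "\<And>p q r x y z. \<theta> = (p, q, r) \<Longrightarrow> \<eta> = (x, y, z) \<Longrightarrow> q * z = r * y \<and> r * x = p * z \<and> p * y = q * x"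
  shows "\<exists>a b u. \<theta> = vsmult a u \<and> \<eta> = vsmult b u"
proof -
  obtain p q r x y z where e: "\<theta> = (p, q, r)" "\<eta> = (x, y, z)" by (cases \<theta>; cases \<eta>)
  have m: "q * z = r * y" "r * x = p * z" "p * y = q * x" using assms(2)[OF e] by auto
  consider "p \<noteq> 0" | "q \<noteq> 0" | "r \<noteq> 0" using assms(1) by (auto simp: e zero_prod_def)
  then have "\<exists>a b u v w. p = a * u \<and> q = a * v \<and> r = a * w \<and> x = b * u \<and> y = b * v \<and> z = b * w"
  proof cases
    case 1
    have "p * y = q * x" "p * z = r * x" using m by simp_all
    from poly3_parallel[OF 1 this] show ?thesis by blast
  next
    case 2
    have "q * x = p * y" "q * z = r * y" using m by simp_all
    from poly3_parallel[OF 2 this] show ?thesis by blast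
  next
    case 3
    have "r * x = p * z" "r * y = q * z" using m by simp_all
    from poly3_parallel[OF 3 this] show ?thesis by blast
  qed
  then obtain a b u v w where "\<theta> = vsmult a (u, v, w)" "\<eta> = vsmult b (u, v, w)" by (auto simp: e)
  then show ?thesis by blast
qed

text \<open>Write n for the cross product of \<theta> and \<eta>, and G for the gradient of f. The
  product of E(f) and n is G times the determinant, plus multiples of \<theta>(f) and \<eta>(f). All
  these vanish, and E(f) is nonzero, so n = 0.\<close>

lemma vdet_eul_0:
  assumes arrangement: "arrangement A" "A \<noteq> {}" and \<theta>: "\<theta> \<in> AR (defpoly A)" and \<eta>: "\<eta> \<in> AR (defpoly A)"
    and det: "vdet eul \<theta> \<eta> = 0" and e: "\<theta> = (p, q, r)" "\<eta> = (x, y, z)"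
  shows "q * z = r * y \<and> r * x = p * z \<and> p * y = q * x"
proof -
  have fin: "finite A" using arrangement(1) by (simp add: arrangement_def)
  let ?f = "defpoly A"
  define F G H where "F = dx ?f" and "G = dy ?f" and "H = dz ?f"
  define X Y Z where "X = varX" and "Y = varY" and "Z = varZ"
  have 1: "p * F + q * G + r * H = 0" and 2: "x * F + y * G + z * H = 0"
    using \<theta> \<eta> by (simp_all add: AR_app app_def e F_def G_def H_def)
  have 3: "X * (q * z - r * y) - Y * (p * z - r * x) + Z * (p * y - q * x) = 0"
    using det by (simp add: vdet_def eul_def e X_def Y_def Z_def)
  have ee: "X * F + Y * G + Z * H = of_nat (card A) * ?f"
    using app_eul[OF fin] by (simp add: app_def eul_def F_def G_def H_def X_def Y_def Z_def)
  have nz: "X * F + Y * G + Z * H \<noteq> 0"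
    unfolding ee using defpoly_nz[OF arrangement(1)] arrangement(2) fin by (simp add: of_nat_const3)
  have "(q * z - r * y) * (X * F + Y * G + Z * H) =
      F * (X * (q * z - r * y) - Y * (p * z - r * x) + Z * (p * y - q * x)) +
      (Y * z - Z * y) * (p * F + q * G + r * H) - (Y * r - Z * q) * (x * F + y * G + z * H)"
    by (simp add: algebra_simps)
  then have a: "q * z - r * y = 0" using nz unfolding 1 2 3 by simp
  have "(r * x - p * z) * (X * F + Y * G + Z * H) =
      G * (X * (q * z - r * y) - Y * (p * z - r * x) + Z * (p * y - q * x)) +
      (Z * x - X * z) * (p * F + q * G + r * H) - (Z * p - X * r) * (x * F + y * G + z * H)"
    by (simp add: algebra_simps)
  then have b: "r * x - p * z = 0" using nz unfolding 1 2 3 by simp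
  have "(p * y - q * x) * (X * F + Y * G + Z * H) =
      H * (X * (q * z - r * y) - Y * (p * z - r * x) + Z * (p * y - q * x)) +
      (X * y - Y * x) * (p * F + q * G + r * H) - (X * q - Y * p) * (x * F + y * G + z * H)"
    by (simp add: algebra_simps)
  then have c: "p * y - q * x = 0" using nz unfolding 1 2 3 by simp
  show ?thesis using a b c by simp
qed

lemma vdet_lincomb:
  "vdet eul (vsmult a \<theta> + vsmult b \<eta>) \<eta> = a * vdet eul \<theta> \<eta>"
  "vdet eul \<theta> (vsmult a \<theta> + vsmult b \<eta>) = b * vdet eul \<theta> \<eta>"
  by (cases \<theta>; cases \<eta>; simp add: vdet_def eul_def algebra_simps)+

lemma indep_if_vdet:
  assumes "vdet eul \<theta> \<eta> \<noteq> 0" "vsmult a \<theta> + vsmult b \<eta> = 0"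
  shows "a = 0 \<and> b = 0"
proof -
  have "vdet eul 0 \<eta> = 0" "vdet eul \<theta> 0 = 0"
    by (cases \<eta>; cases \<theta>; simp add: vdet_def eul_def zero_prod_def)+
  then show ?thesis
    using vdet_lincomb(1)[of a \<theta> b \<eta>] vdet_lincomb(2)[of \<theta> a b \<eta>] assms by simp
qed

lemma eul_logder: "eul \<in> logder A"
  by (simp add: logder_def)

lemma eul_vforms: "eul \<in> vforms (Suc 0)"
  by (simp add: eul_def vforms_def homog_vec_def)

text \<open>Cramer's rule for E, \<theta>, \<eta>, in which all determinants are divisible by f.
  Applying the resulting identity to f kills everything but the E-term, so its coefficient is
  zero.\<close>

lemma saito_cramer:
  assumes arrangement: "arrangement A" "A \<noteq> {}" and g: "\<theta> \<in> AR (defpoly A)" "\<eta> \<in> AR (defpoly A)" "\<xi> \<in> AR (defpoly A)"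
    and h: "vdet eul \<theta> \<eta> = defpoly A * h"
  shows "\<exists>a b. vdet eul \<xi> \<eta> = defpoly A * a \<and> vdet eul \<theta> \<xi> = defpoly A * b \<and> vsmult h \<xi> = vsmult a \<theta> + vsmult b \<eta>"
proof -
  have fin: "finite A" using arrangement(1) by (simp add: arrangement_def)
  note D = subsetD[OF AR_subset_logder[OF arrangement(1)]]
  note nz = defpoly_nz[OF arrangement(1)]
  obtain e where e: "vdet \<xi> \<theta> \<eta> = defpoly A * e"
    using saito[OF arrangement(1) D[OF g(3)] D[OF g(1)] D[OF g(2)]] by blast
  obtain a where a: "vdet eul \<xi> \<eta> = defpoly A * a"
    using saito[OF arrangement(1) eul_logder D[OF g(3)] D[OF g(2)]] by blast
  obtain b where b: "vdet eul \<theta> \<xi> = defpoly A * b"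
    using saito[OF arrangement(1) eul_logder D[OF g(1)] D[OF g(3)]] by blast
  have "vsmult (defpoly A) (vsmult h \<xi>) = vsmult (defpoly A) (vsmult e eul + vsmult a \<theta> + vsmult b \<eta>)"
    using cramer[of eul \<theta> \<eta> \<xi>] unfolding h e a b by (simp add: vsmult_algebra)
  then have eq: "vsmult h \<xi> = vsmult e eul + vsmult a \<theta> + vsmult b \<eta>"
    using vsmult_cancel[OF nz] by blast
  have "app (vsmult h \<xi>) (defpoly A) = e * (of_nat (card A) * defpoly A)"
    using g unfolding eq by (simp add: AR_app app_eul[OF fin])
  then have "e * (of_nat (card A) * defpoly A) = 0" using g(3) by (simp add: AR_app)
  then have "e = 0" using nz arrangement(2) fin by (simp add: of_nat_const3)
  then have "vsmult h \<xi> = vsmult a \<theta> + vsmult b \<eta>" using eq by (simp add: vsmult_algebra)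
  then show ?thesis using a b by blast
qed

definition vhcomp :: "nat \<Rightarrow> vec3 \<Rightarrow> vec3" where
  "vhcomp k \<theta> = (case \<theta> of (p, q, r) \<Rightarrow> (hcomp k p, hcomp k q, hcomp k r))"

lemma vhcomp_add: "vhcomp k (\<theta> + \<eta>) = vhcomp k \<theta> + vhcomp k \<eta>"
  by (cases \<theta>; cases \<eta>) (simp add: vhcomp_def)

lemma hcomp_id: "homogeneous k p \<Longrightarrow> hcomp k p = p"
  using hcomp_hom[of k p k] by simp

lemma vhcomp_id: "\<theta> \<in> vforms k \<Longrightarrow> vhcomp k \<theta> = \<theta>"
  by (cases \<theta>) (simp add: vhcomp_def vforms_def homog_vec_def hcomp_id)

lemma vhcomp_vsmult:
  assumes "\<theta> \<in> vforms d" "d \<le> k"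
  shows "vhcomp k (vsmult c \<theta>) = vsmult (hcomp (k - d) c) \<theta>"
proof -
  obtain p q r where e: "\<theta> = (p, q, r)" by (cases \<theta>)
  have "hcomp k (c * x) = hcomp (k - d) c * x" if "homogeneous d x" for x
    using hcomp_mult[OF that, of "k - d" c] assms(2) by simp
  then show ?thesis using assms(1) by (simp add: e vhcomp_def vforms_def homog_vec_def)
qed

text \<open>Multiplying a relation by the linear form l and eliminating g3 leaves a relation between
  the independent g1 and g2. It shows that the prime l divides c3 a and c3 b, hence c3.\<close>

lemma relations:
  assumes det: "vdet eul g1 g2 \<noteq> 0" and l: "l \<noteq> (0, 0, 0)"
    and rel: "vsmult (lin_form l) g3 = vsmult a g1 + vsmult b g2"
    and ndvd: "\<not> (lin_form l dvd a \<and> lin_form l dvd b)"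
    and 0: "vsmult c1 g1 + vsmult c2 g2 + vsmult c3 g3 = 0"
  shows "\<exists>c. c1 = - (c * a) \<and> c2 = - (c * b) \<and> c3 = lin_form l * c"
proof -
  let ?h = "lin_form l"
  have "vsmult ?h (vsmult c1 g1 + vsmult c2 g2) + vsmult c3 (vsmult ?h g3) =
      vsmult ?h (vsmult c1 g1 + vsmult c2 g2 + vsmult c3 g3)"
    by (simp add: vsmult_algebra mult.commute)
  then have "vsmult (?h * c1 + c3 * a) g1 + vsmult (?h * c2 + c3 * b) g2 = 0"
    unfolding 0 rel by (simp add: vsmult_algebra algebra_simps)
  then have e: "?h * c1 + c3 * a = 0" "?h * c2 + c3 * b = 0"
    using indep_if_vdet[OF det] by blast+
  have "?h dvd c3 * a" "?h dvd c3 * b"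
    using e by (metis add_eq_0_iff dvd_minus_iff dvd_triv_left)+
  then have "?h dvd c3" using lin_form_prime[OF l] ndvd by blast
  then obtain c where c: "c3 = ?h * c" by blast
  have "?h * (c1 + c * a) = ?h * 0" "?h * (c2 + c * b) = ?h * 0"
    using e unfolding c by (simp_all add: algebra_simps)
  then have "c1 + c * a = 0" "c2 + c * b = 0"
    using poly3_cancel_left[OF lin_form_nz[OF l]] by blast+
  then show ?thesis using c by (metis add_eq_0_iff2)
qed

lemma twice_div: "2 * ((n + 1) * (n + 2) div 2) = (n + 1) * (n + (2::nat))"
  by simp

lemma span3_three_mem:
  assumes "span3 [g1, g2, g3] = AR f"
  shows "g1 \<in> AR f" "g2 \<in> AR f" "g3 \<in> AR f"
proof -
  have "vsmult a g1 + vsmult b g2 + vsmult c g3 \<in> AR f" for a b c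
    unfolding assms[symmetric] span3_three by blast
  from this[of 1 0 0] this[of 0 1 0] this[of 0 0 1] show "g1 \<in> AR f" "g2 \<in> AR f" "g3 \<in> AR f"
    by (simp_all add: vsmult_algebra)
qed

text \<open>The shape in which minimality gets contradicted: three generators that are combinations
  of two syzygies.\<close>

lemma span3_twoI:
  assumes sp: "span3 [g1, g2, g3] = AR f" and uv: "u \<in> AR f" "v \<in> AR f"
    and "g1 = vsmult a1 u + vsmult b1 v" "g2 = vsmult a2 u + vsmult b2 v" "g3 = vsmult a3 u + vsmult b3 v"
  shows "span3 [u, v] = AR f"
proof
  show "span3 [u, v] \<subseteq> AR f" unfolding span3_two using uv AR_simps by blast
  show "AR f \<subseteq> span3 [u, v]"
  proof
    fix x assume "x \<in> AR f"
    then obtain a b c where "x = vsmult a g1 + vsmult b g2 + vsmult c g3"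
      unfolding sp[symmetric] span3_three by blast
    then have "x = vsmult (a * a1 + b * a2 + c * a3) u + vsmult (a * b1 + b * b2 + c * b3) v"
      unfolding assms(4-6) by (simp add: vsmult_algebra algebra_simps)
    then show "x \<in> span3 [u, v]" unfolding span3_two by blast
  qed
qed

text \<open>Comparing the Hilbert function of the module of logarithmic fields with the one computed from the
  resolution determines the number of triple points from the exponents. The first two generators are
  independent, since otherwise both would be multiples of a single syzygy and two generators would
  suffice.\<close>

lemma exponent_equation:
  assumes arrangement: "arrangement A" "A \<noteq> {}" and le: "\<And>P. P \<in> P2 \<Longrightarrow> mult_at A P \<le> 3"
    and g: "g1 \<in> vforms d1" "g2 \<in> vforms d2" "g3 \<in> vforms d3"
    and sp: "span3 [g1, g2, g3] = AR (defpoly A)"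
    and min: "\<And>hs. span3 hs = AR (defpoly A) \<Longrightarrow> 3 \<le> length hs"
    and d: "d1 \<le> d2" "d1 + d2 = card A" "d3 = d2 + 1"
  shows "g1 \<noteq> 0" "2 * npts A 3 + d1 + 3 * d2 + 2 = d1 * d1 + d2 * d2"
proof -
  let ?f = "defpoly A"
  have fin: "finite A" using arrangement(1) by (simp add: arrangement_def)
  note nz = defpoly_nz[OF arrangement(1)]
  note gA = span3_three_mem[OF sp]
  have no2: "span3 [u, v] \<noteq> AR ?f" for u v using min[of "[u, v]"] by auto
  show g1: "g1 \<noteq> 0"
  proof
    assume "g1 = 0"
    then have "span3 [g2, g3] = AR ?f"
      by (intro span3_twoI[OF sp gA(2,3), of 0 0 1 0 0 1]) (simp_all add: vsmult_algebra)
    then show False using no2 by blast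
  qed
  obtain h where h: "vdet eul g1 g2 = ?f * h"
    using saito[OF arrangement(1) eul_logder] AR_subset_logder[OF arrangement(1)] gA by blast
  have h0: "h \<noteq> 0"
  proof
    assume "h = 0"
    then have "vdet eul g1 g2 = 0" using h by simp
    from vec_parallel[OF g1 vdet_eul_0[OF arrangement gA(1,2) this]]
    obtain a b u where u: "g1 = vsmult a u" "g2 = vsmult b u" by blast
    have "a * app u ?f = 0" using gA(1) unfolding u(1) AR_app by simp
    moreover have "a \<noteq> 0" using g1 u(1) by (auto simp: vsmult_algebra)
    ultimately have "u \<in> AR ?f" by (simp add: AR_app)
    then have "span3 [u, g3] = AR ?f"
      using u by (intro span3_twoI[OF sp _ gA(3), of u a 0 b 0 0 1]) (simp_all add: vsmult_algebra)
    then show False using no2 by blast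
  qed
  have det: "vdet eul g1 g2 \<noteq> 0" using h h0 nz by simp
  \<comment> \<open>The determinant has degree 1 + d1 + d2, which is one more than the degree of
    f.\<close>
  have "homogeneous (Suc 0) h"
  proof (rule hom_cancel[OF _ hom_defpoly[OF fin] nz])
    show "homogeneous (Suc 0 + card A) (h * ?f)"
      using hom_vdet[OF eul_vforms g(1,2)] d(2) by (simp add: h mult.commute)
  qed
  then obtain l where l: "h = lin_form l" using linear_form_exists by blast
  have l0: "l \<noteq> (0, 0, 0)" using h0 l by (auto simp: lin_form_def)
  obtain a b where ab: "vdet eul g3 g2 = ?f * a" "vdet eul g1 g3 = ?f * b"
    "vsmult h g3 = vsmult a g1 + vsmult b g2"
    using saito_cramer[OF arrangement gA h] by blast
  have ha: "homogeneous (d3 + 1 - d1) a"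
  proof (rule hom_cancel[OF _ hom_defpoly[OF fin] nz])
    have "d3 + 1 - d1 + card A = Suc 0 + d3 + d2" using d by simp
    then show "homogeneous (d3 + 1 - d1 + card A) (a * ?f)"
      using hom_vdet[OF eul_vforms g(3,2)] by (simp add: ab mult.commute)
  qed
  have hb: "homogeneous (d3 + 1 - d2) b"
  proof (rule hom_cancel[OF _ hom_defpoly[OF fin] nz])
    have "d3 + 1 - d2 + card A = Suc 0 + d1 + d3" using d by simp
    then show "homogeneous (d3 + 1 - d2 + card A) (b * ?f)"
      using hom_vdet[OF eul_vforms g(1,3)] by (simp add: ab mult.commute)
  qed
  \<comment> \<open>Otherwise the relation could be divided by h, and g3 would be redundant.\<close>
  have ndvd: "\<not> (lin_form l dvd a \<and> lin_form l dvd b)"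
  proof
    assume "lin_form l dvd a \<and> lin_form l dvd b"
    then obtain a' b' where "a = h * a'" "b = h * b'" unfolding l by (elim conjE dvdE)
    then have "vsmult h g3 = vsmult h (vsmult a' g1 + vsmult b' g2)"
      using ab(3) by (simp add: vsmult_algebra)
    then have "g3 = vsmult a' g1 + vsmult b' g2" using vsmult_cancel[OF h0] by blast
    then have "span3 [g1, g2] = AR ?f"
      by (intro span3_twoI[OF sp gA(1,2), of 1 0 0 1 a' b']) (simp_all add: vsmult_algebra)
    then show False using no2 by blast
  qed
  note rels = relations[OF det l0 ab(3)[unfolded l] ndvd]
  \<comment> \<open>Large enough for \<open>hilbert_logder\<close>, and such that a multiplier of
    the relation has degree k - d3 - 1 = \<open>card A\<close>.\<close>
  define k where "k = card A + d3 + 1"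
  define k' where "k' = card A + d3"
  have kk: "k = Suc k'" by (simp add: k_def k'_def)
  obtain N where N: "fdim scaleV (logder A \<inter> vforms k) N"
    "N + card A * (k + 1) = 3 * ((k + 1) * (k + 2) div 2) + npts A 3"
    using hilbert_logder[OF arrangement(1) le, of k] by (auto simp: k_def)
  obtain M where M: "fdim scaleV (AR ?f \<inter> vforms k) M" "N = M + (k' + 1) * (k' + 2) div 2"
    using fdim_AR[OF arrangement N(1)[unfolded kk]] unfolding kk by blast
  define \<Phi> where "\<Phi> c = vsmult (fst c) g1 + vsmult (fst (snd c)) g2 + vsmult (snd (snd c)) g3" for c :: vec3
  have lin: "Vector_Spaces.linear scaleV scaleV \<Phi>"
    unfolding Vector_Spaces.linear_iff
  proof (intro conjI vector_space_scaleV allI)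
    show "\<Phi> (x + y) = \<Phi> x + \<Phi> y" for x y by (simp add: \<Phi>_def vsmult_algebra)
    show "\<Phi> (scaleV c x) = scaleV c (\<Phi> x)" for c x
      by (cases x) (simp add: \<Phi>_def scaleV_vsmult vsmult_algebra)
  qed
  define U where "U = forms (k - d1) \<times> forms (k - d2) \<times> forms (k - d3)"
  let ?T = "\<lambda>n::nat. (n + 1) * (n + 2) div 2"
  have dU: "fdim scaleV U (?T (k - d1) + (?T (k - d2) + ?T (k - d3)))"
    unfolding U_def by (rule fdim_forms3)
  obtain m r where mr: "fdim scaleV {c \<in> U. \<Phi> c = 0} m" "fdim scaleV (\<Phi> ` U) r"
    "?T (k - d1) + (?T (k - d2) + ?T (k - d3)) = m + r"
    using rank_nullity[OF lin dU] by blast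
  have ks: "d1 \<le> k" "d2 \<le> k" "d3 \<le> k" using d by (simp_all add: k_def)
  have "\<Phi> ` U = AR ?f \<inter> vforms k"
  proof
    show "\<Phi> ` U \<subseteq> AR ?f \<inter> vforms k"
    proof
      fix x assume "x \<in> \<Phi> ` U"
      then obtain c where cU: "c \<in> U" "x = \<Phi> c" by blast
      obtain c1 c2 c3 where ce: "c = (c1, c2, c3)" by (cases c)
      have c: "homogeneous (k - d1) c1" "homogeneous (k - d2) c2" "homogeneous (k - d3) c3"
        "x = vsmult c1 g1 + vsmult c2 g2 + vsmult c3 g3"
        using cU by (simp_all add: ce \<Phi>_def U_def forms_def)
      have "x \<in> AR ?f" unfolding c(4) using gA by (intro AR_simps)
      moreover have "x \<in> vforms k"
        unfolding c(4) using vforms_simps(4)[OF c(1) g(1)] vforms_simps(4)[OF c(2) g(2)]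
          vforms_simps(4)[OF c(3) g(3)] ks by (intro vforms_simps(2)) simp_all
      ultimately show "x \<in> AR ?f \<inter> vforms k" by blast
    qed
    show "AR ?f \<inter> vforms k \<subseteq> \<Phi> ` U"
    proof
      fix x assume x: "x \<in> AR ?f \<inter> vforms k"
      then obtain c1 c2 c3 where c: "x = vsmult c1 g1 + vsmult c2 g2 + vsmult c3 g3"
        unfolding sp[symmetric] span3_three by blast
      \<comment> \<open>The coefficients supplied by \<open>span3\<close> need not be homogeneous;
        taking the part of degree k makes them so.\<close>
      have "x = vhcomp k x" using x vhcomp_id[of x k] by simp
      also have "\<dots> = \<Phi> (hcomp (k - d1) c1, hcomp (k - d2) c2, hcomp (k - d3) c3)"
        unfolding c by (simp add: \<Phi>_def vhcomp_add vhcomp_vsmult[OF g(1) ks(1)] vhcomp_vsmult[OF g(2) ks(2)] vhcomp_vsmult[OF g(3) ks(3)])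
      finally have "x = \<Phi> (hcomp (k - d1) c1, hcomp (k - d2) c2, hcomp (k - d3) c3)" .
      moreover have "(hcomp (k - d1) c1, hcomp (k - d2) c2, hcomp (k - d3) c3) \<in> U"
        by (simp add: U_def forms_def hom_hcomp)
      ultimately show "x \<in> \<Phi> ` U" by blast
    qed
  qed
  then have r: "r = M" using mr(2) M(1) fdim_unique[OF vector_space_scaleV] by simp
  \<comment> \<open>Every relation is a multiple of the single relation (-a, -b, h), which
    parametrises the kernel of \<open>\<Phi>\<close> by forms.\<close>
  define \<Psi> where "\<Psi> c = (- (c * a), - (c * b), h * c)" for c
  have "{c \<in> U. \<Phi> c = 0} = \<Psi> ` forms (card A)"
  proof
    show "{c \<in> U. \<Phi> c = 0} \<subseteq> \<Psi> ` forms (card A)"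
    proof
      fix x assume xU: "x \<in> {c \<in> U. \<Phi> c = 0}"
      obtain c1 c2 c3 where x1: "x = (c1, c2, c3)" by (cases x)
      have x: "x = (c1, c2, c3)" "homogeneous (k - d3) c3"
        "vsmult c1 g1 + vsmult c2 g2 + vsmult c3 g3 = 0"
        using xU by (simp_all add: x1 \<Phi>_def U_def forms_def)
      obtain c where c: "c1 = - (c * a)" "c2 = - (c * b)" "c3 = h * c"
        using rels[OF x(3)] unfolding l by blast
      have "homogeneous (card A) c"
      proof (rule hom_cancel)
        show "homogeneous (card A + Suc 0) (c * h)"
          using x(2) unfolding c(3) by (simp add: k_def mult.commute)
        show "homogeneous (Suc 0) h" "h \<noteq> 0" using h0 unfolding l by (simp_all add: hom_lin_form)
      qed
      then show "x \<in> \<Psi> ` forms (card A)" unfolding x(1) c \<Psi>_def forms_def by blast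
    qed
    show "\<Psi> ` forms (card A) \<subseteq> {c \<in> U. \<Phi> c = 0}"
    proof
      fix x assume "x \<in> \<Psi> ` forms (card A)"
      then obtain c where c: "homogeneous (card A) c" "x = \<Psi> c" unfolding forms_def by blast
      have "\<Phi> x = vsmult c (vsmult h g3 - (vsmult a g1 + vsmult b g2))"
        by (simp add: c(2) \<Phi>_def \<Psi>_def vsmult_algebra algebra_simps)
      then have "\<Phi> x = 0" using ab(3) by (simp add: vsmult_algebra)
      moreover have "x \<in> U"
      proof -
        have "homogeneous (card A + (d3 + 1 - d1)) (c * a)" "homogeneous (card A + (d3 + 1 - d2)) (c * b)"
          "homogeneous (Suc 0 + card A) (h * c)"
          using hom_mult[OF c(1) ha] hom_mult[OF c(1) hb] hom_mult[OF hom_lin_form c(1), of l] by (simp_all add: l)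
        moreover have "card A + (d3 + 1 - d1) = k - d1" "card A + (d3 + 1 - d2) = k - d2" "Suc 0 + card A = k - d3"
          using d by (simp_all add: k_def)
        ultimately show ?thesis unfolding c(2) \<Psi>_def U_def forms_def by (simp add: hom_uminus)
      qed
      ultimately show "x \<in> {c \<in> U. \<Phi> c = 0}" by blast
    qed
  qed
  moreover have "fdim scaleV (\<Psi> ` forms (card A)) (?T (card A))"
  proof (rule fdim_inj_image[OF _ fdim_forms])
    show "Vector_Spaces.linear scaleP scaleV \<Psi>"
      by (simp add: Vector_Spaces.linear_iff vector_space_scaleP vector_space_scaleV scaleP_def \<Psi>_def scaleV_simp algebra_simps)
    show "x = 0" if "\<Psi> x = 0" for x using that h0 by (simp add: \<Psi>_def zero_prod_def)
  qed
  ultimately have m: "m = ?T (card A)"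
    using mr(1) fdim_unique[OF vector_space_scaleV] by simp
  \<comment> \<open>This removes the truncated subtractions, and doubling the equations below
    removes \<open>div\<close>; what remains is a polynomial identity in d1 and d2.\<close>
  have k1: "k - d1 = 2 * d2 + 2" "k - d2 = d1 + d2 + 2" "k - d3 = d1 + d2 + 1" "k = d1 + 2 * d2 + 2"
    "k' = d1 + 2 * d2 + 1" "card A = d1 + d2"
    using d by (simp_all add: k_def k'_def)
  have e1: "?T (2 * d2 + 2) + (?T (d1 + d2 + 2) + ?T (d1 + d2 + 1)) = ?T (d1 + d2) + M"
    using mr(3) unfolding r m k1(1-3,6) .
  have e2: "M + ?T (d1 + 2 * d2 + 1) + (d1 + d2) * (d1 + 2 * d2 + 2 + 1) = 3 * ?T (d1 + 2 * d2 + 2) + npts A 3"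
    using N(2) unfolding M(2) k1(4-6) .
  have "2 * ?T (2 * d2 + 2) + (2 * ?T (d1 + d2 + 2) + 2 * ?T (d1 + d2 + 1)) = 2 * ?T (d1 + d2) + 2 * M"
    using e1 by linarith
  moreover have "2 * M + 2 * ?T (d1 + 2 * d2 + 1) + 2 * ((d1 + d2) * (d1 + 2 * d2 + 2 + 1)) =
      3 * (2 * ?T (d1 + 2 * d2 + 2)) + 2 * npts A 3"
    using e2 by linarith
  ultimately show "2 * npts A 3 + d1 + 3 * d2 + 2 = d1 * d1 + d2 * d2"
    unfolding twice_div by (simp add: algebra_simps)
qed

section \<open>The numerical case analysis\<close>

lemma exponents_bounded:
  fixes d1 d2 n2 n3 :: nat
  assumes 1: "2 * n3 + d1 + 3 * d2 + 2 = d1 * d1 + d2 * d2"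
    and 2: "(d1 + d2) * (d1 + d2 - 1) = 2 * n2 + 6 * n3" and pos: "1 \<le> d1"
  shows "d2 \<le> 6"
proof (rule ccontr)
  assume "\<not> d2 \<le> 6"
  define x y n where "x = int d1" and "y = int d2" and "n = int n3"
  have y: "y \<ge> 7" using \<open>\<not> d2 \<le> 6\<close> by (simp add: y_def)
  have e1: "2 * n + x + 3 * y + 2 = x * x + y * y"
    using arg_cong[OF 1, of int] by (simp add: x_def y_def n_def)
  have "int ((d1 + d2) * (d1 + d2 - 1)) = (x + y) * (x + y - 1)"
    using pos by (simp add: x_def y_def of_nat_diff)
  then have "(x + y) * (x + y - 1) = int (2 * n2 + 6 * n3)" unfolding 2 by (rule sym)
  then have e2: "(x + y) * (x + y - 1) \<ge> 6 * n" by (simp add: n_def)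
  \<comment> \<open>Eliminating n gives a quadratic inequality in x and y; doubled, it is completed
    to a square in x.\<close>
  have "(2 * x - y - 1)\<^sup>2 + 3 * y * (y - 6) - 13 \<le> 0"
    using e1 e2 by (simp add: algebra_simps power2_eq_square)
  moreover have "3 * y * 1 \<le> 3 * y * (y - 6)" using y by (intro mult_left_mono) simp_all
  ultimately have "3 * y \<le> 13" using zero_le_power2[of "2 * x - y - 1"] by linarith
  then show False using y by simp
qed

text \<open>Of the 21 pairs, (3,3), (2,4), (3,4), (4,4), (3,5) and (4,5) survive. The bound without
  triple points removes (2,3), the node bound (1,4), (2,5) and (3,6), the general degree bound (1,5)
  and (2,6), parity (4,6), (5,5) and (5,6); for the remaining pairs n2 or n3 would be
  negative.\<close>

lemma exponents_cases:
  fixes d1 d2 n2 n3 :: nat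
  assumes 1: "2 * n3 + d1 + 3 * d2 + 2 = d1 * d1 + d2 * d2"
    and 2: "(d1 + d2) * (d1 + d2 - 1) = 2 * n2 + 6 * n3" and pos: "1 \<le> d1" "d1 \<le> d2"
    and b: "d1 + d2 < 2 * d1 + 4" "n2 \<noteq> 0 \<Longrightarrow> d1 + d2 \<noteq> 2 * d1 + 3" "n3 = 0 \<Longrightarrow> d1 + d2 < d1 + 3"
    and p: "even (d1 + d2) \<Longrightarrow> d1 + d2 \<le> 2 * n2" "odd (d1 + d2) \<Longrightarrow> n2 \<noteq> 1"
  shows "(d1 + d2, n2, n3) \<in> {(6, 9, 2), (7, 9, 4), (8, 7, 7), (9, 6, 10)}"
proof -
  have "d2 \<le> 6" using exponents_bounded[OF 1 2 pos(1)] .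
  then have "d1 \<in> {1, 2, 3, 4, 5, 6}" "d2 \<in> {1, 2, 3, 4, 5, 6}" using pos by auto
  then show ?thesis
    using 1 2 pos(2) b p by (elim insertE emptyE; simp; presburger?)
qed

section \<open>From lists of lines to sets, and the restriction on the weak-combinatorics\<close>

lemma arrangement_set:
  assumes "line_arrangement L"
  shows "distinct L" "arrangement (set L)" "length L = card (set L)" "arr_poly L = defpoly (set L)"
    "point_mult L P = mult_at (set L) P" "n_pts L k = npts (set L) k"
proof -
  show d: "distinct L"
    unfolding distinct_conv_nth
  proof (intro allI impI)
    fix i j assume ij: "i < length L" "j < length L" "i \<noteq> j"
    have "\<not> L ! i = L ! j" if "i < j" "j < length L" for i j
    proof
      assume "L ! i = L ! j"
      then have "proportional (L ! i) (L ! j)" using proportional_refl by simp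
      then show False using assms that unfolding line_arrangement_def by blast
    qed
    then show "L ! i \<noteq> L ! j" using ij by (cases "i < j") (auto simp del: split_paired_All dest: sym)
  qed
  show "arrangement (set L)"
    unfolding arrangement_def
  proof (intro conjI ballI impI)
    show "(0, 0, 0) \<notin> set L" using assms unfolding line_arrangement_def by (metis in_set_conv_nth)
    fix l m assume "l \<in> set L" "m \<in> set L" "l \<noteq> m"
    then obtain i j where ij: "i < length L" "j < length L" "l = L ! i" "m = L ! j" "i \<noteq> j"
      by (metis in_set_conv_nth)
    then consider "i < j" | "j < i" by linarith
    then show "\<not> proportional l m"
    proof cases
      case 1
      then show ?thesis using assms ij unfolding line_arrangement_def by simp
    next
      case 2
      then have "\<not> proportional m l" using assms ij unfolding line_arrangement_def by simp
      then show ?thesis using proportional_sym by blast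
    qed
  qed simp
  show "length L = card (set L)" using distinct_card[OF d] by simp
  show "arr_poly L = defpoly (set L)"
    unfolding arr_poly_def defpoly_def using prod.distinct_set_conv_list[OF d, of lin_form] by simp
  have mult_at: "point_mult L P = mult_at (set L) P" for P
  proof -
    have "bij_betw (\<lambda>i. L ! i) {i. i < length L \<and> (\<forall>q\<in>P. on_line (L ! i) q)} {l \<in> set L. \<forall>q\<in>P. on_line l q}"
      unfolding bij_betw_def
    proof
      show "inj_on (\<lambda>i. L ! i) {i. i < length L \<and> (\<forall>q\<in>P. on_line (L ! i) q)}"
        by (rule inj_on_subset[OF inj_on_nth[OF d, of "{i. i < length L}"]]) auto
      show "(\<lambda>i. L ! i) ` {i. i < length L \<and> (\<forall>q\<in>P. on_line (L ! i) q)} = {l \<in> set L. \<forall>q\<in>P. on_line l q}"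
        unfolding set_conv_nth by blast
    qed
    then show ?thesis unfolding point_mult_def mult_at_def by (rule bij_betw_same_card)
  qed
  show "point_mult L P = mult_at (set L) P" by (rule mult_at)
  show "n_pts L k = npts (set L) k" by (simp add: n_pts_def npts_def mult_at)
qed

theorem weak_combinatorics:
  assumes L: "line_arrangement L" "only_double_triple L"
    and mpog: "minimal_plus_one_generated (length L) (arr_poly L)"
  shows "(length L, n_pts L 2, n_pts L 3) \<in> {(6, 9, 2), (7, 9, 4), (8, 7, 7), (9, 6, 10)}"
proof -
  note S = arrangement_set[OF L(1)]
  obtain d1 d2 d3 where syz: "syzygy_curve 3 (defpoly (set L)) [d1, d2, d3]" and d: "d1 + d2 = length L" "d3 - d2 = 1"
    using mpog unfolding minimal_plus_one_generated_def S(4) by blast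
  have ord: "d1 \<le> d2" "1 \<le> d1" using syz by (auto simp: syzygy_curve_def)
  obtain gs where gs: "length gs = 3" "\<forall>i<3. homog_vec ([d1, d2, d3] ! i) (gs ! i)" "span3 gs = AR (defpoly (set L))"
    "\<And>hs. span3 hs = AR (defpoly (set L)) \<Longrightarrow> 3 \<le> length hs"
    using syz unfolding syzygy_curve_def by blast
  obtain g1 g2 g3 where g: "gs = [g1, g2, g3]"
    using gs(1) by (auto simp: numeral_3_eq_3 length_Suc_conv)
  have hom: "g1 \<in> vforms d1" "g2 \<in> vforms d2" "g3 \<in> vforms d3"
    using gs(2)[rule_format, of 0] gs(2)[rule_format, of 1] gs(2)[rule_format, of 2] by (simp_all add: g vforms_def)
  have le: "mult_at (set L) P \<le> 3" if "P \<in> P2" for P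
    using L(2) that unfolding only_double_triple_def S(5) by blast
  have ne: "set L \<noteq> {}" using d ord by auto
  \<comment> \<open>The difference d3 - d2 is truncated, but its value 1 excludes
    truncation.\<close>
  have d': "d1 + d2 = card (set L)" "d3 = d2 + 1" using d S(3) by simp_all
  note E = exponent_equation[OF S(2) ne le hom gs(3)[unfolded g] gs(4) ord(1) d']
  note B = syzygy_degree_bounds[OF S(2) ne le span3_three_mem(1)[OF gs(3)[unfolded g]] hom(1) E(1)]
  have "(d1 + d2, npts (set L) 2, npts (set L) 3) \<in> {(6, 9, 2), (7, 9, 4), (8, 7, 7), (9, 6, 10)}"
  proof (rule exponents_cases[OF E(2) _ ord(2,1)])
    show "(d1 + d2) * (d1 + d2 - 1) = 2 * npts (set L) 2 + 6 * npts (set L) 3"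
      using count_pairs[OF S(2) le] unfolding d' .
  qed (use B even_count[OF S(2) le] odd_count[OF S(2) le] d' in simp_all)
  then show ?thesis unfolding S(6) d(1) .
qed

subsection \<open>Recognising minimal plus-one generated arrangements\<close>

lemma varZ_lin_form: "varZ = lin_form (0, 0, 1)"
  by (simp add: lin_form_def)

lemma varX_lin_form: "varX = lin_form (1, 0, 0)"
  by (simp add: lin_form_def)

lemma varY_lin_form: "varY = lin_form (0, 1, 0)"
  by (simp add: lin_form_def)

text \<open>Reduction modulo z, represented inside S by polynomials free of z.\<close>

definition setZ :: "poly3 \<Rightarrow> poly3" where "setZ = ev const3 varX varY 0"

lemma setZ_simps [simp]:
  "setZ (p + q) = setZ p + setZ q" "setZ (p - q) = setZ p - setZ q" "setZ (p * q) = setZ p * setZ q"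
  "setZ (p ^ n) = setZ p ^ n" "setZ (const3 c) = const3 c" "setZ varX = varX" "setZ varY = varY"
  "setZ varZ = 0" "setZ 0 = 0"
  by (simp_all add: setZ_def)

lemma setZ_idem: "setZ (setZ p) = setZ p"
proof (induction p rule: poly3_induct)
  case (single m c)
  show ?case by (cases m) (simp add: monomial_eq)
qed simp_all

lemma varZ_dvd_iff: "varZ dvd p \<longleftrightarrow> setZ p = 0"
proof
  assume "setZ p = 0"
  moreover have "varZ dvd p - setZ p" unfolding setZ_def by (rule dvd_ev_diff) simp_all
  ultimately show "varZ dvd p" by simp
qed (auto elim!: dvdE)

lemma evalp_setZ: "evalp (setZ p) (x, y, z) = evalp p (x, y, 0)"
  by (simp add: setZ_def evalp_ev)

lemma lin_form_power_dvd:
  assumes l: "l \<noteq> (0, 0, 0)" and v: "\<not> lin_form l dvd v" and d: "lin_form l ^ n dvd u * v"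
  shows "lin_form l ^ n dvd u"
  using d
proof (induction n arbitrary: u)
  case (Suc n)
  then have "lin_form l dvd u * v" by (metis dvd_mult_left power_Suc)
  then obtain u' where u: "u = lin_form l * u'" using lin_form_prime[OF l] v by blast
  obtain w where "u * v = lin_form l ^ Suc n * w" using Suc.prems by blast
  then have "lin_form l * (u' * v) = lin_form l * (lin_form l ^ n * w)"
    unfolding u by (simp add: mult_ac)
  then have "u' * v = lin_form l ^ n * w" using poly3_cancel_left[OF lin_form_nz[OF l]] by blast
  then have "lin_form l ^ n dvd u'" using Suc.IH by (metis dvd_triv_left)
  then show ?case unfolding u by (simp add: mult_dvd_mono)
qed simp

text \<open>Modulo z the equation reads \<alpha> b = \<beta> a with a monomial a. The values of b at
  (0,1,0) and (1,0,0) show that neither x nor, if it occurs in a, y divides b; so the powers of x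
  and y in a can be split off \<alpha>.\<close>

lemma proportional_mod_varZ:
  assumes a: "setZ a = const3 k * (varX ^ i * varY ^ j)" and k: "k \<noteq> 0"
    and b: "evalp b (0, 1, 0) \<noteq> 0" "j \<noteq> 0 \<Longrightarrow> evalp b (1, 0, 0) \<noteq> 0"
    and eq: "varZ dvd \<alpha> * b - \<beta> * a"
  shows "\<exists>c. varZ dvd \<alpha> - c * a \<and> varZ dvd \<beta> - c * b"
proof -
  let ?a = "setZ a" and ?b = "setZ b" and ?\<alpha> = "setZ \<alpha>" and ?\<beta> = "setZ \<beta>"
  have e: "?\<alpha> * ?b = ?\<beta> * ?a" using eq by (simp add: varZ_dvd_iff)
  have X: "\<not> varX dvd ?b"
    using b(1) unfolding varX_lin_form
    by (subst lin_form_dvd_iff) (auto simp: dot_simps evalp_setZ intro!: exI[of _ "(0, 1, 0)"])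
  have nX: "varX ^ i \<noteq> 0"
    using poly3_power_eq_0 lin_form_nz[of "(1, 0, 0)"] unfolding varX_lin_form by force
  have nY: "varY ^ j \<noteq> 0"
    using poly3_power_eq_0 lin_form_nz[of "(0, 1, 0)"] unfolding varY_lin_form by force
  have "?\<alpha> * ?b = varX ^ i * (?\<beta> * const3 k * varY ^ j)" unfolding e a by (simp add: mult_ac)
  then have "varX ^ i dvd ?\<alpha> * ?b" by (metis dvd_triv_left)
  then have "varX ^ i dvd ?\<alpha>"
    by (rule lin_form_power_dvd[of "(1, 0, 0)", folded varX_lin_form, OF _ X, rotated]) simp
  then obtain u where u: "?\<alpha> = varX ^ i * u" by blast
  have "varX ^ i * (u * ?b) = varX ^ i * (const3 k * ?\<beta> * varY ^ j)"
    using e unfolding a u by (simp add: mult_ac)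
  then have e2: "u * ?b = const3 k * ?\<beta> * varY ^ j" using poly3_cancel_left[OF nX] by blast
  have "varY ^ j dvd u"
  proof (cases "j = 0")
    case False
    then have Y: "\<not> varY dvd ?b"
      using b(2) unfolding varY_lin_form
      by (subst lin_form_dvd_iff) (auto simp: dot_simps evalp_setZ intro!: exI[of _ "(1, 0, 0)"])
    have "varY ^ j dvd u * ?b" unfolding e2 by (rule dvd_triv_right)
    then show ?thesis
      by (rule lin_form_power_dvd[of "(0, 1, 0)", folded varY_lin_form, OF _ Y, rotated]) simp
  qed simp
  then obtain w where w: "u = varY ^ j * w" by blast
  have "varY ^ j * (w * ?b) = varY ^ j * (const3 k * ?\<beta>)" using e2 unfolding w by (simp add: mult_ac)
  then have e3: "w * ?b = const3 k * ?\<beta>" using poly3_cancel_left[OF nY] by blast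
  define c where "c = const3 (1 / k) * w"
  have kk: "const3 (1 / k) * const3 k = 1" using k by (simp flip: const3_mult)
  have "?\<alpha> = (const3 (1 / k) * const3 k) * ?\<alpha>" unfolding kk by simp
  also have "\<dots> = c * ?a" unfolding u w c_def a by (simp only: mult_ac)
  finally have \<alpha>: "?\<alpha> = c * ?a" .
  have "?\<beta> = (const3 (1 / k) * const3 k) * ?\<beta>" unfolding kk by simp
  also have "\<dots> = c * ?b" unfolding c_def using e3 by (simp add: mult.assoc)
  finally have \<beta>: "?\<beta> = c * ?b" .
  have "?\<alpha> = setZ c * ?a" "?\<beta> = setZ c * ?b"
    using arg_cong[OF \<alpha>, of setZ] arg_cong[OF \<beta>, of setZ] by (simp_all add: setZ_idem)
  then have "varZ dvd \<alpha> - c * a \<and> varZ dvd \<beta> - c * b" by (simp add: varZ_dvd_iff)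
  then show ?thesis by blast
qed

text \<open>Since E(f) = d f, subtracting \<theta>(f) / (d f) times E turns a logarithmic field into
  a syzygy.\<close>

lemma euler_projection:
  assumes arrangement: "arrangement A" "A \<noteq> {}" and \<theta>: "\<theta> \<in> logder A" "\<theta> \<in> vforms (Suc k)"
  shows "\<exists>q. \<theta> - vsmult q eul \<in> AR (defpoly A) \<inter> vforms (Suc k)"
proof -
  have fin: "finite A" using arrangement(1) by (simp add: arrangement_def)
  obtain q where q: "homogeneous k q" "app \<theta> (defpoly A) = q * defpoly A" using app_logder[OF arrangement(1) \<theta>] by blast
  let ?q = "const3 (1 / of_nat (card A)) * q"
  have 1: "const3 (1 / of_nat (card A)) * const3 (of_nat (card A)) = 1"
    using fin arrangement(2) by (simp flip: const3_mult)
  have "?q * (const3 (of_nat (card A)) * defpoly A) =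
      (const3 (1 / of_nat (card A)) * const3 (of_nat (card A))) * (q * defpoly A)"
    by (simp only: mult_ac)
  also have "\<dots> = q * defpoly A" unfolding 1 by simp
  finally have "app (\<theta> - vsmult ?q eul) (defpoly A) = 0"
    by (simp only: app_simps q(2) app_eul[OF fin] of_nat_const3 diff_self)
  moreover have "vsmult ?q eul \<in> vforms (k + Suc 0)"
    by (intro vforms_simps(4) hom_const_mult q(1) eul_vforms)
  then have "\<theta> - vsmult ?q eul \<in> vforms (Suc k)" using \<theta>(2) vforms_simps(3) by simp
  ultimately show ?thesis unfolding AR_app by blast
qed

lemma span3_short:
  assumes "length hs \<le> 2"
  shows "\<exists>u v. span3 hs = span3 [u, v]"
proof -
  consider "hs = []" | x where "hs = [x]" | x y where "hs = [x, y]"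
    using assms by (cases hs; cases "tl hs") auto
  then show ?thesis
  proof cases
    case 1
    have "span3 hs = span3 [0, 0]" unfolding span3_two by (simp add: 1 span3_def vsmult_algebra)
    then show ?thesis by blast
  next
    case 2
    have "span3 [x] = {vsmult a x + vsmult b 0 | a b. True}"
      by (auto simp: span3_def vsmult_algebra intro: exI[of _ "\<lambda>_. _"])
    then show ?thesis unfolding 2 span3_two[symmetric] by blast
  qed blast
qed

text \<open>A sum of two rank-one 3 x 3 matrices has determinant zero, so it is not the identity.
  This is what excludes two generators.\<close>

lemma rank_two_obstruction:
  fixes c d e f :: "nat \<Rightarrow> complex"
  assumes "\<And>i j. i < 3 \<Longrightarrow> j < 3 \<Longrightarrow> c i * d j + e i * f j = (if i = j then 1 else 0)"
  shows False
proof -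
  define M where "M i j = c i * d j + e i * f j" for i j
  have "M 0 0 * (M 1 1 * M 2 2 - M 1 2 * M 2 1) - M 0 1 * (M 1 0 * M 2 2 - M 1 2 * M 2 0) +
      M 0 2 * (M 1 0 * M 2 1 - M 1 1 * M 2 0) = 0"
    unfolding M_def by (simp add: algebra_simps)
  moreover have "M i j = (if i = j then 1 else 0)" if "i < 3" "j < 3" for i j
    using assms that by (simp add: M_def)
  ultimately show False by simp
qed

text \<open>The generators only have to be logarithmic, as subtracting a multiple of the Euler field turns them
  into syzygies. Modulo z the coefficient a is a monomial and b does not vanish at its zeros, so a and b are
  coprime there. This forces the linear form in Saito's determinant to be proportional to z, and every
  relation a' g1 + b' g2 = 0 modulo z to be a multiple of the given one.\<close>

lemma minimal_plus_one_generatedI: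
  assumes arrangement: "arrangement A" and le: "1 \<le> d1" "d1 \<le> d2" "d1 + d2 = card A"
    and g: "g1 \<in> logder A" "g2 \<in> logder A" "g3 \<in> logder A"
      "g1 \<in> vforms d1" "g2 \<in> vforms d2" "g3 \<in> vforms (Suc d2)"
    and rel: "vsmult varZ g3 = vsmult a g1 + vsmult b g2 + vsmult c eul"
    and a: "setZ a = const3 k * (varX ^ i * varY ^ j)" "k \<noteq> 0"
    and b: "evalp b (0, 1, 0) \<noteq> 0" "j \<noteq> 0 \<Longrightarrow> evalp b (1, 0, 0) \<noteq> 0"
    and ab0: "evalp a (0, 0, 0) = 0" "evalp b (0, 0, 0) = 0"
    and det: "evalp (vdet eul g1 g2) x \<noteq> 0"
  shows "minimal_plus_one_generated (card A) (defpoly A)"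
proof -
  let ?f = "defpoly A"
  have fin: "finite A" using arrangement by (simp add: arrangement_def)
  have ne: "A \<noteq> {}" using le by auto
  note nz = defpoly_nz[OF arrangement]
  have z0: "(0, 0, 1) \<noteq> ((0, 0, 0) :: pt3)" by simp
  note zp = lin_form_prime[OF z0, folded varZ_lin_form]
  have zn: "varZ \<noteq> 0" using lin_form_nz[OF z0] by (simp add: varZ_lin_form)
  obtain d1' d2' where d': "d1 = Suc d1'" "d2 = Suc d2'" using le by (metis Suc_le_D le_trans One_nat_def)
  obtain q1 where q1: "g1 - vsmult q1 eul \<in> AR ?f \<inter> vforms d1"
    using euler_projection[OF arrangement ne g(1)] g(4) unfolding d' by blast
  obtain q2 where q2: "g2 - vsmult q2 eul \<in> AR ?f \<inter> vforms d2"
    using euler_projection[OF arrangement ne g(2)] g(5) unfolding d' by blast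
  obtain q3 where q3: "g3 - vsmult q3 eul \<in> AR ?f \<inter> vforms (Suc d2)"
    using euler_projection[OF arrangement ne g(3,6)] by blast
  define G1 G2 G3 where "G1 = g1 - vsmult q1 eul" and "G2 = g2 - vsmult q2 eul" and "G3 = g3 - vsmult q3 eul"
  have GA: "G1 \<in> AR ?f" "G2 \<in> AR ?f" "G3 \<in> AR ?f" and GV: "G1 \<in> vforms d1" "G2 \<in> vforms d2" "G3 \<in> vforms (Suc d2)"
    using q1 q2 q3 by (simp_all add: G1_def G2_def G3_def)
  \<comment> \<open>All multiples of E in the corrected relation; applying the relation to f shows
    that they cancel.\<close>
  define w where "w = c + a * q1 + b * q2 - varZ * q3"
  have w: "vsmult varZ G3 = vsmult a G1 + vsmult b G2 + vsmult w eul"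
  proof -
    have "vsmult varZ G3 = vsmult varZ g3 - vsmult (varZ * q3) eul" by (simp add: G3_def vsmult_algebra)
    also have "\<dots> = vsmult a G1 + vsmult b G2 + vsmult w eul"
      unfolding rel by (simp add: G1_def G2_def w_def vsmult_algebra)
    finally show ?thesis .
  qed
  have "app (vsmult varZ G3) ?f = w * (of_nat (card A) * ?f)"
    using GA unfolding w by (simp add: AR_app app_eul[OF fin])
  then have "w * (of_nat (card A) * ?f) = 0" using GA(3) by (simp add: AR_app)
  then have "w = 0" using nz ne fin by (simp add: of_nat_const3)
  then have R: "vsmult varZ G3 = vsmult a G1 + vsmult b G2" using w by (simp add: vsmult_algebra)
  have "vdet eul G1 G2 = vdet eul g1 g2"
    unfolding G1_def G2_def by (cases g1; cases g2) (simp add: vdet_def eul_def algebra_simps)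
  then have det0: "vdet eul G1 G2 \<noteq> 0" using det by force
  have Za: "\<not> varZ dvd a" using a lin_form_nz[of "(1,0,0)"] lin_form_nz[of "(0,1,0)"]
    by (auto simp: varZ_dvd_iff varX_lin_form varY_lin_form dest!: poly3_power_eq_0)
  have indep: "s = s' \<and> t = t'" if "vsmult s G1 + vsmult t G2 = vsmult s' G1 + vsmult t' G2" for s t s' t'
  proof -
    have "vsmult (s - s') G1 + vsmult (t - t') G2 = (vsmult s G1 + vsmult t G2) - (vsmult s' G1 + vsmult t' G2)"
      by (simp add: vsmult_algebra)
    then show ?thesis using indep_if_vdet[OF det0, of "s - s'" "t - t'"] that by simp
  qed
  obtain h where h: "vdet eul G1 G2 = ?f * h"
    using saito[OF arrangement eul_logder] AR_subset_logder[OF arrangement] GA by blast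
  have h0: "h \<noteq> 0" using det0 h by auto
  have "homogeneous (Suc 0) h"
  proof (rule hom_cancel[OF _ hom_defpoly[OF fin] nz])
    show "homogeneous (Suc 0 + card A) (h * ?f)"
      using hom_vdet[OF eul_vforms GV(1,2)] le(3) by (simp add: h mult.commute)
  qed
  then obtain l where l: "h = lin_form l" using linear_form_exists by blast
  have l0: "l \<noteq> (0, 0, 0)" using h0 l by (auto simp: lin_form_def)
  \<comment> \<open>Saito's determinant gives a second relation with h in place of z; comparing the
    coefficients at the independent G1 and G2 yields h a = z a', and z does not divide a.\<close>
  have "varZ dvd h"
  proof -
    obtain a' b' where ab: "vsmult h G3 = vsmult a' G1 + vsmult b' G2"
      using saito_cramer[OF arrangement ne GA h] by blast
    have "vsmult h (vsmult varZ G3) = vsmult varZ (vsmult h G3)" by (simp add: vsmult_algebra mult.commute)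
    then have "vsmult (h * a) G1 + vsmult (h * b) G2 = vsmult (varZ * a') G1 + vsmult (varZ * b') G2"
      unfolding R ab by (simp add: vsmult_algebra)
    then have "h * a = varZ * a'" using indep by blast
    then have "varZ dvd h * a" by simp
    then show ?thesis using zp Za by blast
  qed
  then have "proportional (0, 0, 1) l"
    using lin_form_dvd_lin_form[OF z0 l0] by (simp add: l varZ_lin_form)
  then obtain \<tau> where \<tau>: "\<tau> \<noteq> 0" "l = (0, 0, \<tau>)" by (auto simp: proportional_def)
  have h\<tau>: "h = const3 \<tau> * varZ" unfolding l \<tau>(2) by (simp add: lin_form_def)
  have unit: "const3 (1 / \<tau>) * const3 \<tau> = 1" using \<tau>(1) by (simp flip: const3_mult)
  \<comment> \<open>Otherwise the determinant would contain z twice, whereas h is a constant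
    multiple of z.\<close>
  have not_both: "\<not> (vdvd varZ G1 \<and> vdvd varZ G2)"
  proof
    assume "vdvd varZ G1 \<and> vdvd varZ G2"
    then obtain u1 u2 where u: "G1 = vsmult varZ u1" "G2 = vsmult varZ u2" unfolding vdvd_def by blast
    have uA: "u1 \<in> AR ?f" "u2 \<in> AR ?f" using GA(1,2) zn unfolding u AR_app by simp_all
    obtain e where e: "vdet eul u1 u2 = ?f * e"
      using saito[OF arrangement eul_logder] AR_subset_logder[OF arrangement] uA by blast
    have "vdet eul G1 G2 = varZ * (varZ * vdet eul u1 u2)"
      unfolding u by (cases u1; cases u2) (simp add: vdet_def eul_def algebra_simps)
    then have "?f * h = ?f * (varZ * (varZ * e))" using h e by (simp add: mult_ac)
    then have "h = varZ * (varZ * e)" using poly3_cancel_left[OF nz] by blast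
    then have "varZ * const3 \<tau> = varZ * (varZ * e)" using h\<tau> by (simp add: mult.commute)
    then have "const3 \<tau> = varZ * e" using poly3_cancel_left[OF zn] by blast
    then have "evalp (const3 \<tau>) (0, 0, 0) = evalp (varZ * e) (0, 0, 0)" by (rule arg_cong)
    then show False using \<tau>(1) by simp
  qed
  have vz: "varZ dvd s" if "vdvd varZ (vsmult s G)" "\<not> vdvd varZ G" for s G
    using that zp by (cases G) (simp add: vdvd_iff, blast)
  have span: "span3 [G1, G2, G3] = AR ?f"
  proof
    show "span3 [G1, G2, G3] \<subseteq> AR ?f"
    proof
      fix y assume "y \<in> span3 [G1, G2, G3]"
      then obtain s t r where y: "y = vsmult s G1 + vsmult t G2 + vsmult r G3"
        unfolding span3_three by blast
      show "y \<in> AR ?f" unfolding y using GA by (intro AR_simps)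
    qed
    show "AR ?f \<subseteq> span3 [G1, G2, G3]"
    proof
      fix \<theta> assume \<theta>: "\<theta> \<in> AR ?f"
      obtain \<alpha>' \<beta>' where ab': "vsmult h \<theta> = vsmult \<alpha>' G1 + vsmult \<beta>' G2"
        using saito_cramer[OF arrangement ne GA(1,2) \<theta> h] by blast
      define \<alpha> \<beta> where "\<alpha> = const3 (1 / \<tau>) * \<alpha>'" and "\<beta> = const3 (1 / \<tau>) * \<beta>'"
      have "vsmult varZ \<theta> = vsmult (const3 (1 / \<tau>) * const3 \<tau> * varZ) \<theta>" unfolding unit by simp
      also have "\<dots> = vsmult (const3 (1 / \<tau>)) (vsmult h \<theta>)" by (simp add: h\<tau> vsmult_algebra mult.assoc)
      finally have ab: "vsmult varZ \<theta> = vsmult \<alpha> G1 + vsmult \<beta> G2"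
        unfolding ab' by (simp add: vsmult_algebra \<alpha>_def \<beta>_def)
      \<comment> \<open>Eliminating between the relations for \<theta> and G3 shows that z divides s
        G1 and s G2, hence s. So (\<alpha>, \<beta>) is proportional to (a, b) modulo z, and a
        multiple of G3 accounts for the difference.\<close>
      let ?s = "\<alpha> * b - \<beta> * a"
      have "vsmult ?s G1 = vsmult b (vsmult \<alpha> G1 + vsmult \<beta> G2) - vsmult \<beta> (vsmult a G1 + vsmult b G2)"
        by (simp add: vsmult_algebra mult.commute)
      also have "\<dots> = vsmult varZ (vsmult b \<theta> - vsmult \<beta> G3)"
        unfolding ab[symmetric] R[symmetric] by (simp add: vsmult_algebra mult.commute)
      finally have 1: "vdvd varZ (vsmult ?s G1)" unfolding vdvd_def by blast
      have "vsmult ?s G2 = vsmult \<alpha> (vsmult a G1 + vsmult b G2) - vsmult a (vsmult \<alpha> G1 + vsmult \<beta> G2)"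
        by (simp add: vsmult_algebra mult.commute)
      also have "\<dots> = vsmult varZ (vsmult \<alpha> G3 - vsmult a \<theta>)"
        unfolding ab[symmetric] R[symmetric] by (simp add: vsmult_algebra mult.commute)
      finally have 2: "vdvd varZ (vsmult ?s G2)" unfolding vdvd_def by blast
      have "varZ dvd ?s" using vz[OF 1] vz[OF 2] not_both by blast
      then obtain e where "varZ dvd \<alpha> - e * a" "varZ dvd \<beta> - e * b"
        using proportional_mod_varZ[OF a b] by blast
      then obtain \<alpha>2 \<beta>2 where "\<alpha> - e * a = varZ * \<alpha>2" "\<beta> - e * b = varZ * \<beta>2" by (elim dvdE)
      then have \<alpha>\<beta>: "\<alpha> = e * a + varZ * \<alpha>2" "\<beta> = e * b + varZ * \<beta>2" by (simp_all add: algebra_simps)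
      have "vsmult varZ \<theta> = vsmult e (vsmult a G1 + vsmult b G2) + vsmult varZ (vsmult \<alpha>2 G1 + vsmult \<beta>2 G2)"
        unfolding ab \<alpha>\<beta> by (simp add: vsmult_algebra algebra_simps)
      also have "\<dots> = vsmult varZ (vsmult \<alpha>2 G1 + vsmult \<beta>2 G2 + vsmult e G3)"
        unfolding R[symmetric] by (simp add: vsmult_algebra mult.commute)
      finally have "\<theta> = vsmult \<alpha>2 G1 + vsmult \<beta>2 G2 + vsmult e G3" using vsmult_cancel[OF zn] by blast
      then show "\<theta> \<in> span3 [G1, G2, G3]" unfolding span3_three by blast
    qed
  qed
  \<comment> \<open>A Nakayama argument at the origin: writing the G's in terms of u and v and back
    gives the identity up to relations, and relations vanish at the origin, so the 3 x 3 identity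
    would factor through a space of dimension two.\<close>
  have min: "3 \<le> length hs" if hs: "span3 hs = AR ?f" for hs
  proof (rule ccontr)
    assume "\<not> 3 \<le> length hs"
    then obtain u v where uv: "span3 [u, v] = AR ?f" using span3_short[of hs] hs by auto
    \<comment> \<open>Every relation is a multiple of (-a, -b, z), and a, b, z all vanish at the
      origin.\<close>
    have rel0: "evalp c1 (0, 0, 0) = 0 \<and> evalp c2 (0, 0, 0) = 0 \<and> evalp c3 (0, 0, 0) = 0"
      if "vsmult c1 G1 + vsmult c2 G2 + vsmult c3 G3 = 0" for c1 c2 c3
      using relations[OF det0 z0 R[unfolded varZ_lin_form] _ that] Za ab0
      unfolding varZ_lin_form by (auto simp: dot_simps)
    have comb: "\<exists>s t. G = vsmult s u + vsmult t v" if "G \<in> AR ?f" for G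
      using that unfolding uv[symmetric] span3_two by blast
    obtain s0 t0 where G1: "G1 = vsmult s0 u + vsmult t0 v" using comb[OF GA(1)] by blast
    obtain s1 t1 where G2: "G2 = vsmult s1 u + vsmult t1 v" using comb[OF GA(2)] by blast
    obtain s2 t2 where G3: "G3 = vsmult s2 u + vsmult t2 v" using comb[OF GA(3)] by blast
    have "u \<in> span3 [u, v]" "v \<in> span3 [u, v]"
      unfolding span3_two
      by (rule CollectI, rule exI[of _ 1], rule exI[of _ 0], simp add: vsmult_algebra,
          rule CollectI, rule exI[of _ 0], rule exI[of _ 1], simp add: vsmult_algebra)
    then obtain x0 x1 x2 y0 y1 y2 where u: "u = vsmult x0 G1 + vsmult x1 G2 + vsmult x2 G3"
      and v: "v = vsmult y0 G1 + vsmult y1 G2 + vsmult y2 G3"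
      unfolding uv span[symmetric] span3_three by blast
    let ?o = "(0, 0, 0) :: pt3"
    have r: "vsmult (s * x0 + t * y0 - e0) G1 + vsmult (s * x1 + t * y1 - e1) G2 + vsmult (s * x2 + t * y2 - e2) G3 = 0"
      if "vsmult e0 G1 + vsmult e1 G2 + vsmult e2 G3 = vsmult s u + vsmult t v" for s t e0 e1 e2
    proof -
      have "vsmult (s * x0 + t * y0 - e0) G1 + vsmult (s * x1 + t * y1 - e1) G2 + vsmult (s * x2 + t * y2 - e2) G3 =
        vsmult s (vsmult x0 G1 + vsmult x1 G2 + vsmult x2 G3) + vsmult t (vsmult y0 G1 + vsmult y1 G2 + vsmult y2 G3) -
        (vsmult e0 G1 + vsmult e1 G2 + vsmult e2 G3)"
        by (simp add: vsmult_algebra)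
      also have "\<dots> = 0" unfolding u[symmetric] v[symmetric] that by simp
      finally show ?thesis .
    qed
    have "vsmult 1 G1 + vsmult 0 G2 + vsmult 0 G3 = vsmult s0 u + vsmult t0 v"
      "vsmult 0 G1 + vsmult 1 G2 + vsmult 0 G3 = vsmult s1 u + vsmult t1 v"
      "vsmult 0 G1 + vsmult 0 G2 + vsmult 1 G3 = vsmult s2 u + vsmult t2 v"
      by (simp_all only: vsmult_algebra G1[symmetric] G2[symmetric] G3[symmetric] add_0_left add_0_right)
    note P = this[THEN r, THEN rel0]
    show False
    proof (rule rank_two_obstruction)
      fix i j :: nat assume "i < 3" "j < 3"
      then have "i \<in> {0, 1, 2}" "j \<in> {0, 1, 2}" by auto
      then show "(\<lambda>i. evalp (if i = 0 then s0 else if i = 1 then s1 else s2) ?o) i *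
          (\<lambda>j. evalp (if j = 0 then x0 else if j = 1 then x1 else x2) ?o) j +
          (\<lambda>i. evalp (if i = 0 then t0 else if i = 1 then t1 else t2) ?o) i *
          (\<lambda>j. evalp (if j = 0 then y0 else if j = 1 then y1 else y2) ?o) j = (if i = j then 1 else 0)"
        using P by auto
    qed
  qed
  have "syzygy_curve 3 ?f [d1, d2, Suc d2]"
    unfolding syzygy_curve_def
  proof (intro conjI exI[of _ "[G1, G2, G3]"])
    show "\<forall>i<3. homog_vec ([d1, d2, Suc d2] ! i) ([G1, G2, G3] ! i)"
    proof (intro allI impI)
      fix i :: nat assume "i < 3"
      then have "i \<in> {0, 1, 2}" by auto
      then show "homog_vec ([d1, d2, Suc d2] ! i) ([G1, G2, G3] ! i)"
        using GV by (elim insertE emptyE) (simp_all add: vforms_def)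
    qed
    show "\<forall>hs. span3 hs = AR ?f \<longrightarrow> 3 \<le> length hs" using min by blast
  qed (use le span in simp_all)
  moreover have "Suc d2 - d2 = 1" by simp
  ultimately show ?thesis using le(3) unfolding minimal_plus_one_generated_def by blast
qed

subsection \<open>Explicit arrangements\<close>

text \<open>Integer coordinates make incidence questions decidable by evaluation.\<close>

type_synonym ipt = "int \<times> int \<times> int"

definition ipt :: "ipt \<Rightarrow> pt3" where
  "ipt l = (case l of (a, b, c) \<Rightarrow> (of_int a, of_int b, of_int c))"

definition icr :: "ipt \<Rightarrow> ipt \<Rightarrow> ipt" where
  "icr l m = (case l of (a, b, c) \<Rightarrow> case m of (d, e, f) \<Rightarrow> (b * f - c * e, c * d - a * f, a * e - b * d))"

definition idot :: "ipt \<Rightarrow> ipt \<Rightarrow> int" where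
  "idot l m = (case l of (a, b, c) \<Rightarrow> case m of (d, e, f) \<Rightarrow> a * d + b * e + c * f)"

text \<open>A point of multiplicity at least 4 would be the intersection of two lines l, m with at least four
  lines k through it.\<close>

definition double_triple_check :: "ipt list \<Rightarrow> bool" where
  "double_triple_check K \<longleftrightarrow> (0, 0, 0) \<notin> set K \<and> sorted_wrt (\<lambda>l m. icr l m \<noteq> (0, 0, 0)) K \<and>
     (\<forall>l\<in>set K. \<forall>m\<in>set K. l = m \<or> length (filter (\<lambda>k. idot k (icr l m) = 0) K) \<le> 3)"

lemma ipt_simps:
  "ipt (a, b, c) = (of_int a, of_int b, of_int c)" "cross (ipt l) (ipt m) = ipt (icr l m)"
  "dot (ipt l) (ipt m) = of_int (idot l m)" "ipt l = (0, 0, 0) \<longleftrightarrow> l = (0, 0, 0)"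
  by (cases l; cases m; simp add: ipt_def icr_def idot_def cross_def dot_def)+

lemma real_arrangement_ipt: "real_arrangement (map ipt K)"
  unfolding real_arrangement_def by (simp add: ipt_def split: prod.split)

lemma line_arrangement_ipt:
  assumes "double_triple_check K"
  shows "line_arrangement (map ipt K)"
  unfolding line_arrangement_def
proof (intro conjI allI impI)
  have nz: "l \<noteq> (0, 0, 0)" if "l \<in> set K" for l using assms that unfolding double_triple_check_def by blast
  fix i assume "i < length (map ipt K)"
  then show "map ipt K ! i \<noteq> (0, 0, 0)" using nz[of "K ! i"] by (simp add: ipt_simps)
next
  have nz: "l \<noteq> (0, 0, 0)" if "l \<in> set K" for l using assms that unfolding double_triple_check_def by blast
  fix i j assume ij: "i < j \<and> j < length (map ipt K)"
  then have "icr (K ! i) (K ! j) \<noteq> (0, 0, 0)"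
    using assms unfolding double_triple_check_def sorted_wrt_iff_nth_less by simp
  moreover have "ipt (K ! i) \<noteq> (0, 0, 0)" "ipt (K ! j) \<noteq> (0, 0, 0)"
    using nz ij by (simp_all add: ipt_simps)
  ultimately show "\<not> proportional (map ipt K ! i) (map ipt K ! j)"
    using ij by (simp add: proportional_iff_cross ipt_simps)
qed

lemma only_double_triple_ipt:
  assumes "double_triple_check K"
  shows "only_double_triple (map ipt K)"
  unfolding only_double_triple_def
proof
  note S = arrangement_set[OF line_arrangement_ipt[OF assms]]
  fix P assume "P \<in> P2"
  then obtain p where p: "p \<noteq> (0, 0, 0)" "P = pclass p" using P2_pclass by blast
  let ?S = "{l \<in> set (map ipt K). dot l p = 0}"
  have "card ?S \<le> 3"
  proof (cases "card ?S \<le> Suc 0")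
    case False
    then have "\<not> (\<forall>x\<in>?S. \<forall>y\<in>?S. x = y)" using card_le_Suc0_iff_eq[of ?S] by simp
    then obtain x y where xy: "x \<in> ?S" "y \<in> ?S" "x \<noteq> y" by blast
    then obtain l m where lm: "l \<in> set K" "m \<in> set K" "x = ipt l" "y = ipt m" by auto
    have "x \<noteq> (0, 0, 0)" "y \<noteq> (0, 0, 0)" using xy S(2) unfolding arrangement_def by blast+
    moreover have "\<not> proportional x y" using arrD[OF S(2), of x y] xy by blast
    ultimately have "cross x y \<noteq> (0, 0, 0)" using proportional_iff_cross by blast
    then obtain t where t: "p = scale3 t (cross x y)" using meet_parallel[of x p y] xy by blast
    have t0: "t \<noteq> 0" using p(1) t by (intro notI) simp
    have "?S \<subseteq> ipt ` set (filter (\<lambda>k. idot k (icr l m) = 0) K)"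
    proof
      fix z assume z: "z \<in> ?S"
      then obtain k where k: "k \<in> set K" "z = ipt k" by auto
      have "t * dot z (cross x y) = 0" using z unfolding t dot_simps(2) by blast
      then have "idot k (icr l m) = 0" using t0 by (simp add: k(2) lm(3,4) ipt_simps)
      then show "z \<in> ipt ` set (filter (\<lambda>k. idot k (icr l m) = 0) K)" using k by simp
    qed
    then have "card ?S \<le> card (set (filter (\<lambda>k. idot k (icr l m) = 0) K))"
      using surj_card_le[OF _ \<open>?S \<subseteq> _\<close>] by simp
    also have "\<dots> \<le> length (filter (\<lambda>k. idot k (icr l m) = 0) K)" by (rule card_length)
    also have "\<dots> \<le> 3"
    proof -
      have "l \<noteq> m" using xy(3) lm by blast
      then show ?thesis using assms lm(1,2) unfolding double_triple_check_def by blast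
    qed
    finally show ?thesis .
  qed simp
  then show "point_mult (map ipt K) P \<le> 3" unfolding S(5) p(2) mult_at_pclass[OF p(1)] .
qed

lemma const3_of_int: "const3 (of_int a) = of_int a"
  by (cases a rule: int_cases2) (simp_all add: const3_of_nat const3_uminus)

text \<open>The list \<open>qs\<close> holds one divisibility certificate per line, so that
  membership reduces to polynomial identities with integer coefficients.\<close>

lemma logder_ipt:
  assumes "list_all2 (\<lambda>l q. of_int (fst l) * fst g + of_int (fst (snd l)) * fst (snd g) +
      of_int (snd (snd l)) * snd (snd g) =
      (of_int (fst l) * varX + of_int (fst (snd l)) * varY + of_int (snd (snd l)) * varZ) * q) K qs"
  shows "g \<in> logder (set (map ipt K))"
  unfolding logder_def
proof (intro CollectI ballI)
  fix l assume "l \<in> set (map ipt K)"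
  then obtain k where k: "k \<in> set K" "l = ipt k" by auto
  then obtain i where i: "i < length K" "k = K ! i" by (metis in_set_conv_nth)
  obtain a b c where abc: "K ! i = (a, b, c)" by (cases "K ! i")
  obtain p q r where pqr: "g = (p, q, r)" by (cases g)
  have "of_int a * p + of_int b * q + of_int c * r =
      (of_int a * varX + of_int b * varY + of_int c * varZ) * (qs ! i)"
    using list_all2_nthD[OF assms i(1)] by (simp add: abc pqr)
  then have "tang g l = lin_form l * (qs ! i)"
    by (simp add: k(2) i(2) abc pqr ipt_simps tang_def lin_form_def const3_of_int)
  then show "lin_form l dvd tang g l" by simp
qed

lemma hom_numeral: "homogeneous 0 (numeral n)"
  using hom_const[of "numeral n"] by simp

lemma hom_cong: "homogeneous k p \<Longrightarrow> n = k \<Longrightarrow> homogeneous n p"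
  by simp

lemma setZ_numeral: "setZ (numeral n) = numeral n" "setZ (- p) = - setZ p"
  using setZ_simps(5)[of "numeral n"] by (simp_all add: setZ_def)

text \<open>The fields below are solutions of linear systems, simplified modulo the Euler field. The witness
  lists contain the quotients of the value of the field at each line by the equation of that line. The
  arrangements of 6 and 9 lines are a grid of two pencils and a configuration of 9 lines with 10 triple
  points that is symmetric under both coordinate reflections.\<close>

definition lines_six :: "ipt list" where
  "lines_six = [(1, 0, 0), (1, 0, 1), (1, 0, -1), (0, 1, 0), (0, 1, 1), (0, 1, -1)]"

text \<open>The product y (y + z) (y - z) of one pencil, times the derivation in the direction of y,
  which annihilates the forms of the other pencil. The second field exchanges the roles of x and
  y.\<close>

definition g1_six :: vec3 where
  "g1_six =
    (0,
     varY ^ 3 - varY * varZ ^ 2,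
     0)"

lemma g1_six_logder: "g1_six \<in> logder (set (map ipt lines_six))"
  by (rule logder_ipt[of _ _ "[0,
      0,
      0,
      varY ^ 2 - varZ ^ 2,
      varY ^ 2 - varY * varZ,
      varY ^ 2 + varY * varZ]"])
    (simp add: g1_six_def lines_six_def algebra_simps eval_nat_numeral)

definition g2_six :: vec3 where
  "g2_six =
    (varX ^ 3 - varX * varZ ^ 2,
     0,
     0)"

lemma g2_six_logder: "g2_six \<in> logder (set (map ipt lines_six))"
  by (rule logder_ipt[of _ _ "[varX ^ 2 - varZ ^ 2,
      varX ^ 2 - varX * varZ,
      varX ^ 2 + varX * varZ,
      0,
      0,
      0]"])
    (simp add: g2_six_def lines_six_def algebra_simps eval_nat_numeral)

definition g3_six :: vec3 where
  "g3_six =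
    (- (varX * varY ^ 2 * varZ),
     - (varX ^ 2 * varY * varZ),
     - (varX ^ 2 * varY ^ 2))"

lemma g3_six_logder: "g3_six \<in> logder (set (map ipt lines_six))"
  by (rule logder_ipt[of _ _ "[- (varY ^ 2 * varZ),
      - (varX * varY ^ 2),
      varX * varY ^ 2,
      - (varX ^ 2 * varZ),
      - (varX ^ 2 * varY),
      varX ^ 2 * varY]"])
    (simp add: g3_six_def lines_six_def algebra_simps eval_nat_numeral)

lemma check_six: "double_triple_check lines_six"
  by code_simp

lemma mpog_six: "minimal_plus_one_generated (length lines_six) (arr_poly (map ipt lines_six))"
proof -
  define A where "A = set (map ipt lines_six)"
  note S = arrangement_set[OF line_arrangement_ipt[OF check_six], folded A_def]
  have card: "card A = 6" using S(3) by (simp add: lines_six_def)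
  let ?a = "varX ^ 2 :: poly3"
  let ?b = "varY ^ 2 :: poly3"
  \<comment> \<open>The fields are logarithmic without being syzygies, so z divides the combination
    of the first two only after a multiple of E has been added.\<close>
  let ?c = "- (varX ^ 2 * varY ^ 2) :: poly3"
  have "minimal_plus_one_generated (card A) (defpoly A)"
  \<comment> \<open>The numbers 1, 2, 0 describe \<open>?a\<close> modulo z as 1 x^2 y^0. The test
    point lies on no line of the arrangement and off z = 0, so the determinant, a constant multiple
    of z f, does not vanish there.\<close>
  proof (rule minimal_plus_one_generatedI[OF S(2), of 3 3 g1_six g2_six g3_six ?a ?b ?c 1 2 0 "(5, 3, 1)"])
    show "vsmult varZ g3_six = vsmult ?a g1_six + vsmult ?b g2_six + vsmult ?c eul"
      by (simp add: g1_six_def g2_six_def g3_six_def eul_def algebra_simps eval_nat_numeral)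
    show "g1_six \<in> vforms 3"
      unfolding g1_six_def vforms_def homog_vec_def mem_Collect_eq prod.case
      by (intro conjI hom_0 hom_add hom_diff hom_uminus;
          (rule hom_cong, (rule hom_mult hom_power hom_var hom_numeral)+, simp))
    show "g2_six \<in> vforms 3"
      unfolding g2_six_def vforms_def homog_vec_def mem_Collect_eq prod.case
      by (intro conjI hom_0 hom_add hom_diff hom_uminus;
          (rule hom_cong, (rule hom_mult hom_power hom_var hom_numeral)+, simp))
    show "g3_six \<in> vforms (Suc 3)"
      unfolding g3_six_def vforms_def homog_vec_def mem_Collect_eq prod.case
      by (intro conjI hom_0 hom_add hom_diff hom_uminus;
          (rule hom_cong, (rule hom_mult hom_power hom_var hom_numeral)+, simp))
    show "evalp (vdet eul g1_six g2_six) (5, 3, 1) \<noteq> 0"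
      by (simp add: vdet_def eul_def g1_six_def g2_six_def)
    show "setZ ?a = const3 1 * (varX ^ 2 * varY ^ 0)"
      by (simp add: setZ_numeral mult.assoc)
  qed (simp_all add: card g1_six_logder[folded A_def] g2_six_logder[folded A_def] g3_six_logder[folded A_def])
  then show ?thesis using S(3) by (simp add: S(4))
qed

section \<open>Seven lines, exponents (3, 4, 5)\<close>

text \<open>Symmetric under x -> -x. The four triple points lie in pairs on the lines x = 0 and y =
  0.\<close>

definition lines_seven :: "ipt list" where
  "lines_seven = [(1, 0, 0), (0, 1, 0), (0, 0, 1), (1, -1, -1), (1, 1, 1), (1, 2, -1), (1, -2, 1)]"

definition g1_seven :: vec3 where
  "g1_seven =
    (- (varX * varZ ^ 2),
     - (varY ^ 2 * varZ) + varY * varZ ^ 2,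
     - (varX ^ 2 * varZ) + 2 * varY ^ 2 * varZ)"

lemma g1_seven_logder: "g1_seven \<in> logder (set (map ipt lines_seven))"
  by (rule logder_ipt[of _ _ "[- (varZ ^ 2),
      - (varY * varZ) + varZ ^ 2,
      - (varX ^ 2) + 2 * varY ^ 2,
      varX * varZ + varY * varZ,
      - (varX * varZ) + varY * varZ,
      varX * varZ - 2 * varY * varZ,
      - (varX * varZ) - 2 * varY * varZ]"])
    (simp add: g1_seven_def lines_seven_def algebra_simps eval_nat_numeral)

definition g2_seven :: vec3 where
  "g2_seven =
    (4 * varX * varY ^ 2 * varZ + 3 * varX * varY * varZ ^ 2 - 4 * varX * varZ ^ 3,
     3 * varX ^ 2 * varY * varZ - 2 * varY ^ 3 * varZ - varY ^ 2 * varZ ^ 2 + varY * varZ ^ 3,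
     3 * varX ^ 2 * varY * varZ - 4 * varX ^ 2 * varZ ^ 2)"

lemma g2_seven_logder: "g2_seven \<in> logder (set (map ipt lines_seven))"
  by (rule logder_ipt[of _ _ "[4 * varY ^ 2 * varZ + 3 * varY * varZ ^ 2 - 4 * varZ ^ 3,
      3 * varX ^ 2 * varZ - 2 * varY ^ 2 * varZ - varY * varZ ^ 2 + varZ ^ 3,
      3 * varX ^ 2 * varY - 4 * varX ^ 2 * varZ,
      - (6 * varX * varY * varZ) + 4 * varX * varZ ^ 2 - 2 * varY ^ 2 * varZ + varY * varZ ^ 2,
      6 * varX * varY * varZ - 4 * varX * varZ ^ 2 - 2 * varY ^ 2 * varZ + varY * varZ ^ 2,
      3 * varX * varY * varZ + 4 * varX * varZ ^ 2 - 2 * varY ^ 2 * varZ - 2 * varY * varZ ^ 2,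
      - (3 * varX * varY * varZ) - 4 * varX * varZ ^ 2 - 2 * varY ^ 2 * varZ - 2 * varY * varZ ^ 2]"])
    (simp add: g2_seven_def lines_seven_def algebra_simps eval_nat_numeral)

definition g3_seven :: vec3 where
  "g3_seven =
    (- (varX ^ 5) + 15 * varX ^ 3 * varY ^ 2 - 4 * varX ^ 3 * varY * varZ + 2 * varX ^ 3 * varZ ^ 2 -
      20 * varX * varY ^ 4 - 16 * varX * varY ^ 3 * varZ + 9 * varX * varY ^ 2 * varZ ^ 2 +
      4 * varX * varY * varZ ^ 3 - varX * varZ ^ 4,
     5 * varX ^ 4 * varY - 15 * varX ^ 2 * varY ^ 3 + 6 * varX ^ 2 * varY ^ 2 * varZ -
       6 * varX ^ 2 * varY * varZ ^ 2 + 4 * varY ^ 5 + 4 * varY ^ 4 * varZ - 3 * varY ^ 3 * varZ ^ 2 -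
       2 * varY ^ 2 * varZ ^ 3 + varY * varZ ^ 4,
     0)"

lemma g3_seven_logder: "g3_seven \<in> logder (set (map ipt lines_seven))"
  by (rule logder_ipt[of _ _ "[- (varX ^ 4) + 15 * varX ^ 2 * varY ^ 2 - 4 * varX ^ 2 * varY * varZ +
    2 * varX ^ 2 * varZ ^ 2 - 20 * varY ^ 4 - 16 * varY ^ 3 * varZ + 9 * varY ^ 2 * varZ ^ 2 +
    4 * varY * varZ ^ 3 - varZ ^ 4,
      5 * varX ^ 4 - 15 * varX ^ 2 * varY ^ 2 + 6 * varX ^ 2 * varY * varZ - 6 * varX ^ 2 * varZ ^ 2 +
        4 * varY ^ 4 + 4 * varY ^ 3 * varZ - 3 * varY ^ 2 * varZ ^ 2 - 2 * varY * varZ ^ 3 + varZ ^ 4,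
      0,
      - (varX ^ 4) - 6 * varX ^ 3 * varY - varX ^ 3 * varZ + 9 * varX ^ 2 * varY ^ 2 -
        11 * varX ^ 2 * varY * varZ + varX ^ 2 * varZ ^ 2 + 24 * varX * varY ^ 3 -
        8 * varX * varY ^ 2 * varZ - 4 * varX * varY * varZ ^ 2 + varX * varZ ^ 3 + 4 * varY ^ 4 -
        3 * varY ^ 2 * varZ ^ 2 + varY * varZ ^ 3,
      - (varX ^ 4) + 6 * varX ^ 3 * varY + varX ^ 3 * varZ + 9 * varX ^ 2 * varY ^ 2 -
        11 * varX ^ 2 * varY * varZ + varX ^ 2 * varZ ^ 2 - 24 * varX * varY ^ 3 +
        8 * varX * varY ^ 2 * varZ + 4 * varX * varY * varZ ^ 2 - varX * varZ ^ 3 + 4 * varY ^ 4 -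
        3 * varY ^ 2 * varZ ^ 2 + varY * varZ ^ 3,
      - (varX ^ 4) + 12 * varX ^ 3 * varY - varX ^ 3 * varZ - 9 * varX ^ 2 * varY ^ 2 +
        10 * varX ^ 2 * varY * varZ + varX ^ 2 * varZ ^ 2 - 12 * varX * varY ^ 3 -
        17 * varX * varY ^ 2 * varZ - 4 * varX * varY * varZ ^ 2 + varX * varZ ^ 3 + 4 * varY ^ 4 +
        6 * varY ^ 3 * varZ - 2 * varY * varZ ^ 3,
      - (varX ^ 4) - 12 * varX ^ 3 * varY + varX ^ 3 * varZ - 9 * varX ^ 2 * varY ^ 2 +
        10 * varX ^ 2 * varY * varZ + varX ^ 2 * varZ ^ 2 + 12 * varX * varY ^ 3 +
        17 * varX * varY ^ 2 * varZ + 4 * varX * varY * varZ ^ 2 - varX * varZ ^ 3 + 4 * varY ^ 4 +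
        6 * varY ^ 3 * varZ - 2 * varY * varZ ^ 3]"])
    (simp add: g3_seven_def lines_seven_def algebra_simps eval_nat_numeral)

lemma check_seven: "double_triple_check lines_seven"
  by code_simp

lemma mpog_seven: "minimal_plus_one_generated (length lines_seven) (arr_poly (map ipt lines_seven))"
proof -
  define A where "A = set (map ipt lines_seven)"
  note S = arrangement_set[OF line_arrangement_ipt[OF check_seven], folded A_def]
  have card: "card A = 7" using S(3) by (simp add: lines_seven_def)
  let ?a = "6 * varX ^ 2 * varY - 9 * varX ^ 2 * varZ + 2 * varY ^ 2 * varZ + varZ ^ 3 :: poly3"
  let ?b = "2 * varX ^ 2 - 4 * varY ^ 2 - varY * varZ :: poly3"
  let ?c = "- (varX ^ 4 * varZ) + 7 * varX ^ 2 * varY ^ 2 * varZ - 4 * varX ^ 2 * varY * varZ ^ 2 +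
    varX ^ 2 * varZ ^ 3 - 4 * varY ^ 4 * varZ - 2 * varY ^ 2 * varZ ^ 3 :: poly3"
  have "minimal_plus_one_generated (card A) (defpoly A)"
  \<comment> \<open>Modulo z, \<open>?a\<close> is 6 x^2 y and \<open>?b\<close> is 2 x^2 - 4 y^2,
    which is nonzero at both (0,1,0) and (1,0,0).\<close>
  proof (rule minimal_plus_one_generatedI[OF S(2), of 3 4 g1_seven g2_seven g3_seven ?a ?b ?c 6 2 1 "(5, 1, 1)"])
    show "vsmult varZ g3_seven = vsmult ?a g1_seven + vsmult ?b g2_seven + vsmult ?c eul"
      by (simp add: g1_seven_def g2_seven_def g3_seven_def eul_def algebra_simps eval_nat_numeral)
    show "g1_seven \<in> vforms 3"
      unfolding g1_seven_def vforms_def homog_vec_def mem_Collect_eq prod.case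
      by (intro conjI hom_0 hom_add hom_diff hom_uminus;
          (rule hom_cong, (rule hom_mult hom_power hom_var hom_numeral)+, simp))
    show "g2_seven \<in> vforms 4"
      unfolding g2_seven_def vforms_def homog_vec_def mem_Collect_eq prod.case
      by (intro conjI hom_0 hom_add hom_diff hom_uminus;
          (rule hom_cong, (rule hom_mult hom_power hom_var hom_numeral)+, simp))
    show "g3_seven \<in> vforms (Suc 4)"
      unfolding g3_seven_def vforms_def homog_vec_def mem_Collect_eq prod.case
      by (intro conjI hom_0 hom_add hom_diff hom_uminus;
          (rule hom_cong, (rule hom_mult hom_power hom_var hom_numeral)+, simp))
    show "evalp (vdet eul g1_seven g2_seven) (5, 1, 1) \<noteq> 0"
      by (simp add: vdet_def eul_def g1_seven_def g2_seven_def)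
    show "setZ ?a = const3 6 * (varX ^ 2 * varY ^ 1)"
      by (simp add: setZ_numeral mult.assoc)
  qed (simp_all add: card g1_seven_logder[folded A_def] g2_seven_logder[folded A_def] g3_seven_logder[folded A_def])
  then show ?thesis using S(3) by (simp add: S(4))
qed

section \<open>Eight lines, exponents (4, 4, 5)\<close>

text \<open>Symmetric under x -> -x. The lines y, z and y + z meet in (1,0,0); each of x = 0, y = 0
  and y + z = 0 carries two further triple points, seven in all.\<close>

definition lines_eight :: "ipt list" where
  "lines_eight = [(1, 0, 0), (0, 1, 1), (0, 1, 0), (0, 0, -1), (1, 1, 2), (1, -1, -2), (1, -3, -2), (1, 3, 2)]"

definition g1_eight :: vec3 where
  "g1_eight =
    (varX ^ 3 * varZ - 4 * varX * varZ ^ 3,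
     13 * varY ^ 3 * varZ + 24 * varY ^ 2 * varZ ^ 2 + 8 * varY * varZ ^ 3,
     - (6 * varY ^ 3 * varZ) - 9 * varY ^ 2 * varZ ^ 2)"

lemma g1_eight_logder: "g1_eight \<in> logder (set (map ipt lines_eight))"
  by (rule logder_ipt[of _ _ "[varX ^ 2 * varZ - 4 * varZ ^ 3,
      7 * varY ^ 2 * varZ + 8 * varY * varZ ^ 2,
      13 * varY ^ 2 * varZ + 24 * varY * varZ ^ 2 + 8 * varZ ^ 3,
      - (6 * varY ^ 3) - 9 * varY ^ 2 * varZ,
      varX ^ 2 * varZ - varX * varY * varZ - 2 * varX * varZ ^ 2 + varY ^ 2 * varZ + 4 * varY * varZ ^ 2,
      varX ^ 2 * varZ + varX * varY * varZ + 2 * varX * varZ ^ 2 + varY ^ 2 * varZ + 4 * varY * varZ ^ 2,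
      varX ^ 2 * varZ + 3 * varX * varY * varZ + 2 * varX * varZ ^ 2 + 9 * varY ^ 2 * varZ +
        12 * varY * varZ ^ 2,
      varX ^ 2 * varZ - 3 * varX * varY * varZ - 2 * varX * varZ ^ 2 + 9 * varY ^ 2 * varZ +
        12 * varY * varZ ^ 2]"])
    (simp add: g1_eight_def lines_eight_def algebra_simps eval_nat_numeral)

definition g2_eight :: vec3 where
  "g2_eight =
    (3 * varX * varY ^ 2 * varZ + 8 * varX * varY * varZ ^ 2 + 4 * varX * varZ ^ 3,
     - (varX ^ 2 * varY * varZ),
     2 * varX ^ 2 * varY * varZ + varX ^ 2 * varZ ^ 2)"

lemma g2_eight_logder: "g2_eight \<in> logder (set (map ipt lines_eight))"
  by (rule logder_ipt[of _ _ "[3 * varY ^ 2 * varZ + 8 * varY * varZ ^ 2 + 4 * varZ ^ 3,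
      varX ^ 2 * varZ,
      - (varX ^ 2 * varZ),
      2 * varX ^ 2 * varY + varX ^ 2 * varZ,
      3 * varX * varY * varZ + 2 * varX * varZ ^ 2,
      - (3 * varX * varY * varZ) - 2 * varX * varZ ^ 2,
      - (varX * varY * varZ) - 2 * varX * varZ ^ 2,
      varX * varY * varZ + 2 * varX * varZ ^ 2]"])
    (simp add: g2_eight_def lines_eight_def algebra_simps eval_nat_numeral)

definition g3_eight :: vec3 where
  "g3_eight =
    (14 * varX ^ 5 - 56 * varX ^ 3 * varZ ^ 2 + 108 * varX * varY ^ 4 + 300 * varX * varY ^ 3 * varZ +
      144 * varX * varY ^ 2 * varZ ^ 2,
     140 * varX ^ 2 * varY ^ 3 + 342 * varX ^ 2 * varY ^ 2 * varZ + 112 * varX ^ 2 * varY * varZ ^ 2 -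
       18 * varY ^ 5 - 66 * varY ^ 4 * varZ - 72 * varY ^ 3 * varZ ^ 2 - 24 * varY ^ 2 * varZ ^ 3,
     - (90 * varX ^ 2 * varY ^ 2 * varZ))"

lemma g3_eight_logder: "g3_eight \<in> logder (set (map ipt lines_eight))"
  by (rule logder_ipt[of _ _ "[14 * varX ^ 4 - 56 * varX ^ 2 * varZ ^ 2 + 108 * varY ^ 4 +
    300 * varY ^ 3 * varZ + 144 * varY ^ 2 * varZ ^ 2,
      140 * varX ^ 2 * varY ^ 2 + 112 * varX ^ 2 * varY * varZ - 18 * varY ^ 4 - 48 * varY ^ 3 * varZ -
        24 * varY ^ 2 * varZ ^ 2,
      140 * varX ^ 2 * varY ^ 2 + 342 * varX ^ 2 * varY * varZ + 112 * varX ^ 2 * varZ ^ 2 -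
        18 * varY ^ 4 - 66 * varY ^ 3 * varZ - 72 * varY ^ 2 * varZ ^ 2 - 24 * varY * varZ ^ 3,
      - (90 * varX ^ 2 * varY ^ 2),
      14 * varX ^ 4 - 14 * varX ^ 3 * varY - 28 * varX ^ 3 * varZ + 14 * varX ^ 2 * varY ^ 2 +
        56 * varX ^ 2 * varY * varZ + 126 * varX * varY ^ 3 + 78 * varX * varY ^ 2 * varZ -
        18 * varY ^ 4 - 30 * varY ^ 3 * varZ - 12 * varY ^ 2 * varZ ^ 2,
      14 * varX ^ 4 + 14 * varX ^ 3 * varY + 28 * varX ^ 3 * varZ + 14 * varX ^ 2 * varY ^ 2 +
        56 * varX ^ 2 * varY * varZ - 126 * varX * varY ^ 3 - 78 * varX * varY ^ 2 * varZ -
        18 * varY ^ 4 - 30 * varY ^ 3 * varZ - 12 * varY ^ 2 * varZ ^ 2,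
      14 * varX ^ 4 + 42 * varX ^ 3 * varY + 28 * varX ^ 3 * varZ + 126 * varX ^ 2 * varY ^ 2 +
        168 * varX ^ 2 * varY * varZ - 42 * varX * varY ^ 3 - 90 * varX * varY ^ 2 * varZ -
        18 * varY ^ 4 - 54 * varY ^ 3 * varZ - 36 * varY ^ 2 * varZ ^ 2,
      14 * varX ^ 4 - 42 * varX ^ 3 * varY - 28 * varX ^ 3 * varZ + 126 * varX ^ 2 * varY ^ 2 +
        168 * varX ^ 2 * varY * varZ + 42 * varX * varY ^ 3 + 90 * varX * varY ^ 2 * varZ -
        18 * varY ^ 4 - 54 * varY ^ 3 * varZ - 36 * varY ^ 2 * varZ ^ 2]"])
    (simp add: g3_eight_def lines_eight_def algebra_simps eval_nat_numeral)

lemma check_eight: "double_triple_check lines_eight"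
  by code_simp

lemma mpog_eight: "minimal_plus_one_generated (length lines_eight) (arr_poly (map ipt lines_eight))"
proof -
  define A where "A = set (map ipt lines_eight)"
  note S = arrangement_set[OF line_arrangement_ipt[OF check_eight], folded A_def]
  have card: "card A = 8" using S(3) by (simp add: lines_eight_def)
  let ?a = "14 * varX ^ 2 - 3 * varY * varZ :: poly3"
  let ?b = "42 * varY ^ 2 - 3 * varY * varZ :: poly3"
  let ?c = "3 * varX ^ 2 * varY * varZ ^ 2 - 18 * varY ^ 4 * varZ - 27 * varY ^ 3 * varZ ^ 2 :: poly3"
  have "minimal_plus_one_generated (card A) (defpoly A)"
  proof (rule minimal_plus_one_generatedI[OF S(2), of 4 4 g1_eight g2_eight g3_eight ?a ?b ?c 14 2 0 "(1, 1, 1)"])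
    show "vsmult varZ g3_eight = vsmult ?a g1_eight + vsmult ?b g2_eight + vsmult ?c eul"
      by (simp add: g1_eight_def g2_eight_def g3_eight_def eul_def algebra_simps eval_nat_numeral)
    show "g1_eight \<in> vforms 4"
      unfolding g1_eight_def vforms_def homog_vec_def mem_Collect_eq prod.case
      by (intro conjI hom_0 hom_add hom_diff hom_uminus;
          (rule hom_cong, (rule hom_mult hom_power hom_var hom_numeral)+, simp))
    show "g2_eight \<in> vforms 4"
      unfolding g2_eight_def vforms_def homog_vec_def mem_Collect_eq prod.case
      by (intro conjI hom_0 hom_add hom_diff hom_uminus;
          (rule hom_cong, (rule hom_mult hom_power hom_var hom_numeral)+, simp))
    show "g3_eight \<in> vforms (Suc 4)"
      unfolding g3_eight_def vforms_def homog_vec_def mem_Collect_eq prod.case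
      by (intro conjI hom_0 hom_add hom_diff hom_uminus;
          (rule hom_cong, (rule hom_mult hom_power hom_var hom_numeral)+, simp))
    show "evalp (vdet eul g1_eight g2_eight) (1, 1, 1) \<noteq> 0"
      by (simp add: vdet_def eul_def g1_eight_def g2_eight_def)
    show "setZ ?a = const3 14 * (varX ^ 2 * varY ^ 0)"
      by (simp add: setZ_numeral mult.assoc)
  qed (simp_all add: card g1_eight_logder[folded A_def] g2_eight_logder[folded A_def] g3_eight_logder[folded A_def])
  then show ?thesis using S(3) by (simp add: S(4))
qed

section \<open>Nine lines, exponents (4, 5, 6)\<close>

definition lines_nine :: "ipt list" where
  "lines_nine = [(1, 0, 0), (1, 0, -1), (1, 0, 1), (1, -1, 0), (1, 1, 0), (1, -1, -2), (1, -1, 2), (1, 1, -2), (1, 1, 2)]"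

definition g1_nine :: vec3 where
  "g1_nine =
    (2 * varX ^ 3 * varY - 8 * varX * varY * varZ ^ 2,
     3 * varX ^ 4 - 12 * varX ^ 2 * varZ ^ 2 - varY ^ 4 + 4 * varY ^ 2 * varZ ^ 2,
     - (6 * varX ^ 2 * varY * varZ))"

lemma g1_nine_logder: "g1_nine \<in> logder (set (map ipt lines_nine))"
  by (rule logder_ipt[of _ _ "[2 * varX ^ 2 * varY - 8 * varY * varZ ^ 2,
      2 * varX ^ 2 * varY + 8 * varX * varY * varZ,
      2 * varX ^ 2 * varY - 8 * varX * varY * varZ,
      - (3 * varX ^ 3) - varX ^ 2 * varY - varX * varY ^ 2 + 12 * varX * varZ ^ 2 - varY ^ 3 +
        4 * varY * varZ ^ 2,
      3 * varX ^ 3 - varX ^ 2 * varY + varX * varY ^ 2 - 12 * varX * varZ ^ 2 - varY ^ 3 +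
        4 * varY * varZ ^ 2,
      - (3 * varX ^ 3) - varX ^ 2 * varY - 6 * varX ^ 2 * varZ - varX * varY ^ 2 +
        4 * varX * varY * varZ - varY ^ 3 + 2 * varY ^ 2 * varZ,
      - (3 * varX ^ 3) - varX ^ 2 * varY + 6 * varX ^ 2 * varZ - varX * varY ^ 2 -
        4 * varX * varY * varZ - varY ^ 3 - 2 * varY ^ 2 * varZ,
      3 * varX ^ 3 - varX ^ 2 * varY + 6 * varX ^ 2 * varZ + varX * varY ^ 2 + 4 * varX * varY * varZ -
        varY ^ 3 - 2 * varY ^ 2 * varZ,
      3 * varX ^ 3 - varX ^ 2 * varY - 6 * varX ^ 2 * varZ + varX * varY ^ 2 - 4 * varX * varY * varZ -
        varY ^ 3 + 2 * varY ^ 2 * varZ]"])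
    (simp add: g1_nine_def lines_nine_def algebra_simps eval_nat_numeral)

definition g2_nine :: vec3 where
  "g2_nine =
    (- (2 * varX ^ 3 * varY ^ 2) + 2 * varX * varY ^ 2 * varZ ^ 2,
     - (2 * varX ^ 4 * varY) + 2 * varX ^ 2 * varY * varZ ^ 2,
     varX ^ 4 * varZ + varX ^ 2 * varY ^ 2 * varZ - 5 * varX ^ 2 * varZ ^ 3 - varY ^ 2 * varZ ^ 3 +
       4 * varZ ^ 5)"

lemma g2_nine_logder: "g2_nine \<in> logder (set (map ipt lines_nine))"
  by (rule logder_ipt[of _ _ "[- (2 * varX ^ 2 * varY ^ 2) + 2 * varY ^ 2 * varZ ^ 2,
      - (varX ^ 3 * varZ) - 2 * varX ^ 2 * varY ^ 2 - varX ^ 2 * varZ ^ 2 - 3 * varX * varY ^ 2 * varZ +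
        4 * varX * varZ ^ 3 - varY ^ 2 * varZ ^ 2 + 4 * varZ ^ 4,
      varX ^ 3 * varZ - 2 * varX ^ 2 * varY ^ 2 - varX ^ 2 * varZ ^ 2 + 3 * varX * varY ^ 2 * varZ -
        4 * varX * varZ ^ 3 - varY ^ 2 * varZ ^ 2 + 4 * varZ ^ 4,
      2 * varX ^ 3 * varY - 2 * varX * varY * varZ ^ 2,
      - (2 * varX ^ 3 * varY) + 2 * varX * varY * varZ ^ 2,
      2 * varX ^ 3 * varY - 2 * varX ^ 3 * varZ + 2 * varX ^ 2 * varY * varZ - 4 * varX ^ 2 * varZ ^ 2 -
        2 * varX * varY * varZ ^ 2 + 2 * varX * varZ ^ 3 - 2 * varY * varZ ^ 3 + 4 * varZ ^ 4,
      2 * varX ^ 3 * varY + 2 * varX ^ 3 * varZ - 2 * varX ^ 2 * varY * varZ - 4 * varX ^ 2 * varZ ^ 2 -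
        2 * varX * varY * varZ ^ 2 - 2 * varX * varZ ^ 3 + 2 * varY * varZ ^ 3 + 4 * varZ ^ 4,
      - (2 * varX ^ 3 * varY) - 2 * varX ^ 3 * varZ - 2 * varX ^ 2 * varY * varZ -
        4 * varX ^ 2 * varZ ^ 2 + 2 * varX * varY * varZ ^ 2 + 2 * varX * varZ ^ 3 +
        2 * varY * varZ ^ 3 + 4 * varZ ^ 4,
      - (2 * varX ^ 3 * varY) + 2 * varX ^ 3 * varZ + 2 * varX ^ 2 * varY * varZ -
        4 * varX ^ 2 * varZ ^ 2 + 2 * varX * varY * varZ ^ 2 - 2 * varX * varZ ^ 3 -
        2 * varY * varZ ^ 3 + 4 * varZ ^ 4]"])
    (simp add: g2_nine_def lines_nine_def algebra_simps eval_nat_numeral)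

definition g3_nine :: vec3 where
  "g3_nine =
    (15 * varX ^ 5 * varZ + 3 * varX * varY ^ 4 * varZ - 12 * varX * varY ^ 2 * varZ ^ 3,
     18 * varX ^ 2 * varY ^ 3 * varZ - 12 * varX ^ 2 * varY * varZ ^ 3,
     3 * varX ^ 6 - 6 * varX ^ 4 * varY ^ 2 + 3 * varX ^ 2 * varY ^ 4 -
       6 * varX ^ 2 * varY ^ 2 * varZ ^ 2 + 12 * varX ^ 2 * varZ ^ 4)"

lemma g3_nine_logder: "g3_nine \<in> logder (set (map ipt lines_nine))"
  by (rule logder_ipt[of _ _ "[15 * varX ^ 4 * varZ + 3 * varY ^ 4 * varZ - 12 * varY ^ 2 * varZ ^ 3,
      - (3 * varX ^ 5) + 12 * varX ^ 4 * varZ + 6 * varX ^ 3 * varY ^ 2 + 12 * varX ^ 3 * varZ ^ 2 +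
        6 * varX ^ 2 * varY ^ 2 * varZ + 12 * varX ^ 2 * varZ ^ 3 - 3 * varX * varY ^ 4 +
        12 * varX * varY ^ 2 * varZ ^ 2,
      3 * varX ^ 5 + 12 * varX ^ 4 * varZ - 6 * varX ^ 3 * varY ^ 2 - 12 * varX ^ 3 * varZ ^ 2 +
        6 * varX ^ 2 * varY ^ 2 * varZ + 12 * varX ^ 2 * varZ ^ 3 + 3 * varX * varY ^ 4 -
        12 * varX * varY ^ 2 * varZ ^ 2,
      15 * varX ^ 4 * varZ + 15 * varX ^ 3 * varY * varZ + 15 * varX ^ 2 * varY ^ 2 * varZ -
        3 * varX * varY ^ 3 * varZ + 12 * varX * varY * varZ ^ 3,
      15 * varX ^ 4 * varZ - 15 * varX ^ 3 * varY * varZ + 15 * varX ^ 2 * varY ^ 2 * varZ +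
        3 * varX * varY ^ 3 * varZ - 12 * varX * varY * varZ ^ 3,
      - (6 * varX ^ 5) - 6 * varX ^ 4 * varY + 3 * varX ^ 4 * varZ + 6 * varX ^ 3 * varY ^ 2 -
        9 * varX ^ 3 * varY * varZ + 6 * varX ^ 3 * varZ ^ 2 + 6 * varX ^ 2 * varY ^ 3 +
        3 * varX ^ 2 * varY ^ 2 * varZ - 12 * varX ^ 2 * varY * varZ ^ 2 + 12 * varX ^ 2 * varZ ^ 3 -
        3 * varX * varY ^ 3 * varZ + 6 * varX * varY ^ 2 * varZ ^ 2,
      6 * varX ^ 5 + 6 * varX ^ 4 * varY + 3 * varX ^ 4 * varZ - 6 * varX ^ 3 * varY ^ 2 -
        9 * varX ^ 3 * varY * varZ - 6 * varX ^ 3 * varZ ^ 2 - 6 * varX ^ 2 * varY ^ 3 +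
        3 * varX ^ 2 * varY ^ 2 * varZ + 12 * varX ^ 2 * varY * varZ ^ 2 + 12 * varX ^ 2 * varZ ^ 3 -
        3 * varX * varY ^ 3 * varZ - 6 * varX * varY ^ 2 * varZ ^ 2,
      - (6 * varX ^ 5) + 6 * varX ^ 4 * varY + 3 * varX ^ 4 * varZ + 6 * varX ^ 3 * varY ^ 2 +
        9 * varX ^ 3 * varY * varZ + 6 * varX ^ 3 * varZ ^ 2 - 6 * varX ^ 2 * varY ^ 3 +
        3 * varX ^ 2 * varY ^ 2 * varZ + 12 * varX ^ 2 * varY * varZ ^ 2 + 12 * varX ^ 2 * varZ ^ 3 +
        3 * varX * varY ^ 3 * varZ + 6 * varX * varY ^ 2 * varZ ^ 2,
      6 * varX ^ 5 - 6 * varX ^ 4 * varY + 3 * varX ^ 4 * varZ - 6 * varX ^ 3 * varY ^ 2 +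
        9 * varX ^ 3 * varY * varZ - 6 * varX ^ 3 * varZ ^ 2 + 6 * varX ^ 2 * varY ^ 3 +
        3 * varX ^ 2 * varY ^ 2 * varZ - 12 * varX ^ 2 * varY * varZ ^ 2 + 12 * varX ^ 2 * varZ ^ 3 +
        3 * varX * varY ^ 3 * varZ - 6 * varX * varY ^ 2 * varZ ^ 2]"])
    (simp add: g3_nine_def lines_nine_def algebra_simps eval_nat_numeral)

lemma check_nine: "double_triple_check lines_nine"
  by code_simp

lemma mpog_nine: "minimal_plus_one_generated (length lines_nine) (arr_poly (map ipt lines_nine))"
proof -
  define A where "A = set (map ipt lines_nine)"
  note S = arrangement_set[OF line_arrangement_ipt[OF check_nine], folded A_def]
  have card: "card A = 9" using S(3) by (simp add: lines_nine_def)
  let ?a = "2 * varX ^ 2 * varY + varY * varZ ^ 2 :: poly3"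
  let ?b = "3 * varX ^ 2 + varY ^ 2 :: poly3"
  let ?c = "2 * varX ^ 4 * varY ^ 2 + 15 * varX ^ 4 * varZ ^ 2 + 2 * varX ^ 2 * varY ^ 4 +
    8 * varX ^ 2 * varY ^ 2 * varZ ^ 2 + varY ^ 4 * varZ ^ 2 - 4 * varY ^ 2 * varZ ^ 4 :: poly3"
  have "minimal_plus_one_generated (card A) (defpoly A)"
  \<comment> \<open>Modulo z, \<open>?a\<close> is 2 x^2 y, and \<open>?b\<close> is 3 x^2 + y^2,
    which has no zero on x = 0 or y = 0 besides the origin.\<close>
  proof (rule minimal_plus_one_generatedI[OF S(2), of 4 5 g1_nine g2_nine g3_nine ?a ?b ?c 2 2 1 "(5, 1, 1)"])
    show "vsmult varZ g3_nine = vsmult ?a g1_nine + vsmult ?b g2_nine + vsmult ?c eul"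
      by (simp add: g1_nine_def g2_nine_def g3_nine_def eul_def algebra_simps eval_nat_numeral)
    show "g1_nine \<in> vforms 4"
      unfolding g1_nine_def vforms_def homog_vec_def mem_Collect_eq prod.case
      by (intro conjI hom_0 hom_add hom_diff hom_uminus;
          (rule hom_cong, (rule hom_mult hom_power hom_var hom_numeral)+, simp))
    show "g2_nine \<in> vforms 5"
      unfolding g2_nine_def vforms_def homog_vec_def mem_Collect_eq prod.case
      by (intro conjI hom_0 hom_add hom_diff hom_uminus;
          (rule hom_cong, (rule hom_mult hom_power hom_var hom_numeral)+, simp))
    show "g3_nine \<in> vforms (Suc 5)"
      unfolding g3_nine_def vforms_def homog_vec_def mem_Collect_eq prod.case
      by (intro conjI hom_0 hom_add hom_diff hom_uminus;
          (rule hom_cong, (rule hom_mult hom_power hom_var hom_numeral)+, simp))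
    show "evalp (vdet eul g1_nine g2_nine) (5, 1, 1) \<noteq> 0"
      by (simp add: vdet_def eul_def g1_nine_def g2_nine_def)
    show "setZ ?a = const3 2 * (varX ^ 2 * varY ^ 1)"
      by (simp add: setZ_numeral mult.assoc)
  qed (simp_all add: card g1_nine_logder[folded A_def] g2_nine_logder[folded A_def] g3_nine_logder[folded A_def])
  then show ?thesis using S(3) by (simp add: S(4))
qed

section \<open>Realisation of the four weak-combinatorics over the reals\<close>

text \<open>The numbers of nodes and triple points come from \<open>weak_combinatorics\<close>
  rather than from counting.\<close>

lemma realization:
  assumes "double_triple_check K" "minimal_plus_one_generated (length K) (arr_poly (map ipt K))"
  shows "line_arrangement (map ipt K) \<and> real_arrangement (map ipt K) \<and> only_double_triple (map ipt K) \<and>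
    minimal_plus_one_generated (length (map ipt K)) (arr_poly (map ipt K)) \<and>
    (length K, n_pts (map ipt K) 2, n_pts (map ipt K) 3) \<in> {(6, 9, 2), (7, 9, 4), (8, 7, 7), (9, 6, 10)}"
  using weak_combinatorics[of "map ipt K"] assms line_arrangement_ipt only_double_triple_ipt real_arrangement_ipt
  by simp

theorem theoremA:
  shows "(\<forall>L. line_arrangement L \<and> only_double_triple L \<and>
              minimal_plus_one_generated (length L) (arr_poly L) \<longrightarrow>
              (length L, n_pts L 2, n_pts L 3) \<in> {(6, 9, 2), (7, 9, 4), (8, 7, 7), (9, 6, 10)})
       \<and> (\<forall>w \<in> {(6, 9, 2), (7, 9, 4), (8, 7, 7), (9, 6, 10)}.
            \<exists>L. line_arrangement L \<and> real_arrangement L \<and> only_double_triple L \<and>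
                minimal_plus_one_generated (length L) (arr_poly L) \<and>
                (length L, n_pts L 2, n_pts L 3) = w)"
proof (intro conjI allI impI ballI)
  fix L
  assume "line_arrangement L \<and> only_double_triple L \<and> minimal_plus_one_generated (length L) (arr_poly L)"
  then show "(length L, n_pts L 2, n_pts L 3) \<in> {(6, 9, 2), (7, 9, 4), (8, 7, 7), (9, 6, 10)}"
    using weak_combinatorics by blast
next
  fix w :: "nat \<times> nat \<times> nat"
  let ?P = "\<lambda>L. line_arrangement L \<and> real_arrangement L \<and> only_double_triple L \<and>
    minimal_plus_one_generated (length L) (arr_poly L)"
  have ex: "\<exists>L. ?P L \<and> (length L, n_pts L 2, n_pts L 3) = (d, m, n)"
    if "double_triple_check K" "minimal_plus_one_generated (length K) (arr_poly (map ipt K))" "length K = d"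
      "(d, m, n) \<in> {(6, 9, 2), (7, 9, 4), (8, 7, 7), (9, 6, 10)}" for K d m n
  proof (intro exI[of _ "map ipt K"] conjI)
    note R = realization[OF that(1,2)]
    \<comment> \<open>The four triples have different first entries, so the number of lines selects
      the right one.\<close>
    show "(length (map ipt K), n_pts (map ipt K) 2, n_pts (map ipt K) 3) = (d, m, n)"
      using R that(3,4) by auto
  qed (use realization[OF that(1,2)] in blast)+
  assume "w \<in> {(6, 9, 2), (7, 9, 4), (8, 7, 7), (9, 6, 10)}"
  then consider "w = (6, 9, 2)" | "w = (7, 9, 4)" | "w = (8, 7, 7)" | "w = (9, 6, 10)" by blast
  then show "\<exists>L. line_arrangement L \<and> real_arrangement L \<and> only_double_triple L \<and>
      minimal_plus_one_generated (length L) (arr_poly L) \<and> (length L, n_pts L 2, n_pts L 3) = w"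
  proof cases
    case 1
    then show ?thesis using ex[OF check_six mpog_six, of 6 9 2] by (simp add: lines_six_def) 
  next
    case 2
    then show ?thesis using ex[OF check_seven mpog_seven, of 7 9 4] by (simp add: lines_seven_def) 
  next
    case 3
    then show ?thesis using ex[OF check_eight mpog_eight, of 8 7 7] by (simp add: lines_eight_def) 
  next
    case 4
    then show ?thesis using ex[OF check_nine mpog_nine, of 9 6 10] by (simp add: lines_nine_def) 
  qed
qed

end
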